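(* Let $R$ be an elliptic root system with marking of codimension $1$ (i.e. $d_{n-1}<d_n$), let $(g,\zeta,L)$ be an admissible triplet with $L$ of zero type, and let $z^0,\dots,z^n$ be a basis of $(L\oplus\mathbb R\delta)\otimes_{\mathbb R}\mathbb C$ with $z^0=\delta/(-2\pi\sqrt{-1})$, $z^1,\dots,z^{n-1}\in(L\cap F)\otimes\mathbb C$, $z^n\in(L\cap F)^\perp\otimes\mathbb C$, $\widetilde I(z^\alpha,z^\beta)=\delta_{\alpha+\beta,n}$ and $g\cdot z^\alpha=\zeta^{d_\alpha}z^\alpha$ $(0\le\alpha,\beta\le n)$. For $x^0:=\delta/(-2\pi\sqrt{-1})$ and a set of basic invariants $x^1,\dots,x^n$, the following conditions are equivalent: (i) $\frac{\partial x^n}{\partial z^n}\big|_{L^\perp}$ is a nonzero constant. (ii) $x^n|_{L^\perp}$ is a nonzero constant. (iii) $\widetilde I_W(dx^n,dx^n)|_{L^\perp}=0$. (iv) $(\partial/\partial x^n)^2\,\widetilde I_W(dx^n,dx^n)=0$.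
   Context: Root system. $l\ge 1$ is an integer, $n=l+1$. $F$ is a real vector space of dimension $l+2$ with a positive semi-definite symmetric bilinear form $I$ whose radical $\mathrm{rad}\,I$ has dimension $2$. For $\alpha\in F$ with $I(\alpha,\alpha)\ne0$ put $\alpha^\vee=2\alpha/I(\alpha,\alpha)$, $w_\alpha(u)=u-I(u,\alpha^\vee)\alpha$. $R\subset F$ is an elliptic root system belonging to $(F,I)$: a set of vectors with $I(\alpha,\alpha)\neq 0$ such that (1) the additive group $Q(R)$ generated by $R$ is a full lattice in $F$; (2) $I(\alpha,\beta^\vee)\in\mathbb Z$ for $\alpha,\beta\in R$; (3) $w_\alpha(R)=R$ for $\alpha\in R$; (4) if $R=R_1\cup R_2$ with $R_1\perp R_2$ then $R_1$ or $R_2$ is empty. A marking is fixed: a line $G\subset\mathrm{rad}\,I$ with $G\cap Q(R)\simeq\mathbb Z$; $a,\delta$ are chosen with $G\cap Q(R)=\mathbb Za$, $Q(R)\cap\mathrm{rad}\,I=\mathbb Za\oplus\mathbb Z\delta$. $(I_R:I)>0$ is the smallest number such that $(I_R:I)I$ makes $Q(R)$ an even lattice. Hyperbolic extension. $\widetilde F\supset F$ is a real vector space of dimension $l+3$ with symmetric bilinear form $\widetilde I$ (extended $\mathbb C$-bilinearly to $\widetilde F\otimes\mathbb C$), $\widetilde I|_F=I$, $\mathrm{rad}\,\widetilde I=\mathbb Ra$; $\Lambda_0\in\widetilde F$ satisfies $\widetilde I(\Lambda_0,\delta)=1$, $\widetilde I(\Lambda_0,\Lambda_0)=0$. $O(\widetilde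 F,F,\mathrm{rad}\,I)$ is the group of $g\in GL(\widetilde F)$ preserving $\widetilde I$ with $g(F)\subset F$ and $g|_{\mathrm{rad}\,I}=id$. The elliptic Weyl group $W\subset O(\widetilde F,F,\mathrm{rad}\,I)$ is generated by $\widetilde w_\alpha(u)=u-\widetilde I(u,\alpha^\vee)\alpha$ ($\alpha\in R$). Exponents. Following Saito, the image of $R$ in $F/G$ is a reduced affine root system. Let $\alpha_0,\dots,\alpha_l\in R$ be lifts of its simple roots, $n_i$ the coprime positive integers with $\sum n_i\alpha_i\equiv\pm\delta$ mod $G$, $k(\alpha)=\min\{k\in\mathbb Z_{>0}\mid\alpha+ka\in R\}$. The exponents $m_0\le\dots\le m_l=:m_{max}$ are the numbers $(I_R:I)I(\alpha_i,\alpha_i)n_i/(2k(\alpha_i))$ in increasing order. $d_n$ is the smallest common denominator of the $m_i/m_{max}$, $d_\alpha:=m_{\alpha-1}d_n/m_{max}$ ($1\le\alpha\le n$), $d_0:=0$. In codimension $1$ ($d_{n-1}<d_n$) it is known that $d_\alpha+d_{n-\alpha}=d_n$ ($0\le\alpha\le n$). Invariants. $Y=\{x\in\mathrm{Hom}_{\mathbb R}(\widetilde F,\mathbb C)\mid\langle a,x\rangle=-2\pi\sqrt{-1},\ \mathrm{Re}\langle\delta,x\rangle>0\}$, $H=\{x\in\mathrm{Hom}_{\mathbb R}(\mathrm{rad}\,I,\mathbb C)\mid \langle a,x\rangle=-2\pi\sqrt{-1},\ \mathrm{Re}\langle\delta,x\rangle>0\}$, $\pi:Y\to H$ restriction; $F(Y),F(H)$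 are the rings of holomorphic functions, $F(H)\subset F(Y)$ via $\pi^*$. $g\in O(\widetilde F,F,\mathrm{rad}\,I)$ acts on $Y$ by $\langle\gamma,g\cdot x\rangle=\langle g^{-1}\gamma,x\rangle$ and on functions by $(g\cdot f)(x)=f(g^{-1}x)$. The Euler field $E$ is the vector field on $Y$ with $E(f)=0$ for $f\in F$ and $E(\Lambda_0)=(I_R:I)d_n/m_{max}$. $S^W_m$ is the set of $W$-invariant $f\in F(Y)$ with $Ef=mf$; $S^W=\bigoplus_{m\ge0}S^W_m$. It is known that $S^W$ is a polynomial $F(H)$-algebra on algebraically independent homogeneous generators $x^1,\dots,x^n$ of degrees $0<d_1\le\dots\le d_n$, called a set of basic invariants. Admissible triplet. $(g,\zeta,L)$ ($g\in O(\widetilde F,F,\mathrm{rad}\,I)$, $\zeta\in\mathbb C^*$, $L\subset\widetilde F$ a subspace) is admissible if: (i) $g$ is semi-simple, $(g-id)(\widetilde F)\subset F$; (ii) $\zeta$ is a primitive $d_n$-th root of unity and $g\cdot x^\alpha=\zeta^{d_\alpha}x^\alpha$ ($1\le\alpha\le n$) for a set of basic invariants; (iii) $\widetilde F=L\oplus\mathrm{rad}\,I$, $g(L)=L$, $L\cap R=\emptyset$. $L$ is of zero type if $\widetilde I|_L$ has $n-1$ positive, one zero and no negative eigenvalues. $L^\perp=\{x\in Y\mid\langle v,x\rangle=0\ \forall v\in L\}$; $\pi$ gives $L^\perp\simeq H$, so $f|_{L^\perp}$ is regarded as an element of $F(H)$. $(L\cap F)^\perp:=\{x\in L\mid\widetilde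 I(x,y)=0\ \forall y\in L\cap F\}$. A basis $z^0,\dots,z^n$ as in the claim exists and gives coordinates on $Y$; partial derivatives $\partial/\partial z^\beta$ are in these coordinates. Bilinear form on invariants. $\widetilde I_W(dx^\alpha,dx^\beta):=\sum_{\gamma_1,\gamma_2=0}^n\frac{\partial x^\alpha}{\partial z^{\gamma_1}}\frac{\partial x^\beta}{\partial z^{\gamma_2}}\widetilde I(z^{\gamma_1},z^{\gamma_2})\in S^W$ for $0\le\alpha,\beta\le n$. $\partial/\partial x^n$ is the derivation of $S^W=F(H)[x^1,\dots,x^n]$ with respect to the coordinates $x^0,x^1,\dots,x^n$. *)

theory Defs
  imports "HOL-Analysis.Analysis" "Jordan_Normal_Form.Char_Poly"
begin

section \<open>Elliptic root systems\<close>

definition radical_on :: "'v set \<Rightarrow> ('v \<Rightarrow> 'v \<Rightarrow> real) \<Rightarrow> 'v set" where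
  "radical_on F I = {u \<in> F. \<forall>v\<in>F. I u v = 0}"

definition coroot :: "('v::real_vector \<Rightarrow> 'v \<Rightarrow> real) \<Rightarrow> 'v \<Rightarrow> 'v" where
  "coroot I \<alpha> = (2 / I \<alpha> \<alpha>) *\<^sub>R \<alpha>"

definition reflection :: "('v::real_vector \<Rightarrow> 'v \<Rightarrow> real) \<Rightarrow> 'v \<Rightarrow> 'v \<Rightarrow> 'v" where
  "reflection I \<alpha> u = u - I u (coroot I \<alpha>) *\<^sub>R \<alpha>"

definition int_span :: "'v::real_vector set \<Rightarrow> 'v set" where
  "int_span S = (\<lambda>A. 0 \<in> A \<and> (\<forall>x\<in>A. \<forall>y\<in>A. x - y \<in> A)) hull S"

definition full_lattice :: "'v::real_vector set \<Rightarrow> 'v set \<Rightarrow> bool" where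
  "full_lattice F Q \<longleftrightarrow> (\<exists>B. independent B \<and> span B = F \<and> Q = int_span B)"

definition elliptic_root_system ::
    "'v::real_vector set \<Rightarrow> ('v \<Rightarrow> 'v \<Rightarrow> real) \<Rightarrow> 'v set \<Rightarrow> bool" where
  "elliptic_root_system F I R \<longleftrightarrow>
     R \<subseteq> F \<and> (\<forall>\<alpha>\<in>R. I \<alpha> \<alpha> \<noteq> 0) \<and>
     full_lattice F (int_span R) \<and>
     (\<forall>\<alpha>\<in>R. \<forall>\<beta>\<in>R. I \<alpha> (coroot I \<beta>) \<in> \<int>) \<and>
     (\<forall>\<alpha>\<in>R. reflection I \<alpha> ` R = R) \<and>
     (\<forall>R1 R2. R = R1 \<union> R2 \<and> (\<forall>\<alpha>\<in>R1. \<forall>\<beta>\<in>R2. I \<alpha> \<beta> = 0) \<longrightarrow> R1 = {} \<or> R2 = {})"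

text \<open>
  The hyperbolic extension \<open>F~\<close> is a whole type \<open>'v\<close> of class \<^class>\<open>euclidean_space\<close>.
  Its inner product and norm are auxiliary: they supply finite-dimensionality and the topology needed
  to speak about holomorphic functions, and no definition depends on their choice.
  The form \<open>I\<close> on \<open>F\<close> is the restriction of \<open>form\<close>, the form on \<open>F~\<close>.
  The record also holds the lifts \<open>simple i\<close> (\<open>0 \<le> i \<le> l\<close>) of the
  simple roots and their labels \<open>n\<^sub>i\<close>.
\<close>

record 'v ell_data =
  rk :: nat                       (* l *)
  space_F :: "'v set"
  form :: "'v \<Rightarrow> 'v \<Rightarrow> real"
  roots :: "'v set"
  vec_a :: 'v
  vec_delta :: 'v
  Lambda0 :: 'v
  simple :: "nat \<Rightarrow> 'v"
  label :: "nat \<Rightarrow> nat"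

definition nn :: "'v ell_data \<Rightarrow> nat" where
  "nn D = rk D + 1"

definition rad_I :: "'v ell_data \<Rightarrow> 'v set" where
  "rad_I D = radical_on (space_F D) (form D)"

definition root_lattice :: "'v::real_vector ell_data \<Rightarrow> 'v set" where
  "root_lattice D = int_span (roots D)"

definition line_G :: "'v::real_vector ell_data \<Rightarrow> 'v set" where
  "line_G D = span {vec_a D}"

definition is_marking :: "'v::real_vector ell_data \<Rightarrow> bool" where
  "is_marking D \<longleftrightarrow>
     vec_a D \<noteq> 0 \<and> line_G D \<subseteq> rad_I D \<and>
     line_G D \<inter> root_lattice D = {of_int i *\<^sub>R vec_a D | i. True} \<and>
     vec_a D \<noteq> vec_delta D \<and> independent {vec_a D, vec_delta D} \<and>
     root_lattice D \<inter> rad_I D = {of_int i *\<^sub>R vec_a D + of_int j *\<^sub>R vec_delta D | i j. True}"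

definition is_hyperbolic_extension :: "'v::euclidean_space ell_data \<Rightarrow> bool" where
  "is_hyperbolic_extension D \<longleftrightarrow>
     DIM('v) = rk D + 3 \<and>
     bilinear (form D) \<and> (\<forall>u v. form D u v = form D v u) \<and>
     radical_on UNIV (form D) = span {vec_a D} \<and>
     form D (Lambda0 D) (vec_delta D) = 1 \<and> form D (Lambda0 D) (Lambda0 D) = 0"

text \<open>
  Elements of \<open>F/G\<close> are handled through representatives in \<open>F\<close>, congruence being modulo \<open>line_G\<close>.
\<close>

definition quotient_reduced :: "'v::real_vector ell_data \<Rightarrow> bool" where
  "quotient_reduced D \<longleftrightarrow>
     (\<forall>\<alpha>\<in>roots D. \<forall>\<beta>\<in>roots D. \<forall>c::real. \<beta> - c *\<^sub>R \<alpha> \<in> line_G D \<longrightarrow> c = 1 \<or> c = - 1)"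

definition simple_root_lifts :: "'v::real_vector ell_data \<Rightarrow> bool" where
  "simple_root_lifts D \<longleftrightarrow>
     (\<forall>i\<le>rk D. simple D i \<in> roots D) \<and>
     (\<forall>c::nat \<Rightarrow> real. (\<Sum>i\<le>rk D. c i *\<^sub>R simple D i) \<in> line_G D \<longrightarrow> (\<forall>i\<le>rk D. c i = 0)) \<and>
     (\<forall>\<beta>\<in>roots D. \<exists>k::nat \<Rightarrow> nat.
        \<beta> - (\<Sum>i\<le>rk D. of_nat (k i) *\<^sub>R simple D i) \<in> line_G D \<or>
        \<beta> + (\<Sum>i\<le>rk D. of_nat (k i) *\<^sub>R simple D i) \<in> line_G D)"

definition labels_ok :: "'v::real_vector ell_data \<Rightarrow> bool" where
  "labels_ok D \<longleftrightarrow>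
     (\<forall>i\<le>rk D. 0 < label D i) \<and> Gcd (label D ` {..rk D}) = 1 \<and>
     ((\<Sum>i\<le>rk D. of_nat (label D i) *\<^sub>R simple D i) - vec_delta D \<in> line_G D \<or>
      (\<Sum>i\<le>rk D. of_nat (label D i) *\<^sub>R simple D i) + vec_delta D \<in> line_G D)"

definition marked_elliptic :: "'v::euclidean_space ell_data \<Rightarrow> bool" where
  "marked_elliptic D \<longleftrightarrow>
     1 \<le> rk D \<and>
     subspace (space_F D) \<and> dim (space_F D) = rk D + 2 \<and>
     (\<forall>u\<in>space_F D. 0 \<le> form D u u) \<and> dim (rad_I D) = 2 \<and>
     is_hyperbolic_extension D \<and>
     elliptic_root_system (space_F D) (form D) (roots D) \<and>
     is_marking D \<and> quotient_reduced D \<and> simple_root_lifts D \<and> labels_ok D"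


section \<open>Exponents and degrees\<close>

text \<open>The number \<open>(I\<^sub>R : I)\<close>.\<close>

definition even_scale :: "'v::real_vector ell_data \<Rightarrow> real" where
  "even_scale D =
     (LEAST c. 0 < c \<and> (\<forall>x\<in>root_lattice D. \<exists>k::int. c * form D x x = 2 * of_int k))"

definition kk :: "'v::real_vector ell_data \<Rightarrow> 'v \<Rightarrow> nat" where
  "kk D \<alpha> = (LEAST k. 0 < k \<and> \<alpha> + of_nat k *\<^sub>R vec_a D \<in> roots D)"

definition exponent :: "'v::real_vector ell_data \<Rightarrow> nat \<Rightarrow> real" where
  "exponent D i =
     sort (map (\<lambda>j. even_scale D * form D (simple D j) (simple D j) * label D j
                     / (2 * kk D (simple D j))) [0..<rk D + 1]) ! i"

definition m_max :: "'v::real_vector ell_data \<Rightarrow> real" where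
  "m_max D = exponent D (rk D)"

definition dn :: "'v::real_vector ell_data \<Rightarrow> nat" where
  "dn D = (LEAST d. 0 < d \<and> (\<forall>i\<le>rk D. of_nat d * (exponent D i / m_max D) \<in> \<int>))"

text \<open>The floor only changes the type: its argument is an integer by the choice of \<open>dn\<close>.\<close>

definition deg :: "'v::real_vector ell_data \<Rightarrow> nat \<Rightarrow> nat" where
  "deg D \<alpha> = (if \<alpha> = 0 then 0 else nat \<lfloor>exponent D (\<alpha> - 1) * dn D / m_max D\<rfloor>)"

definition codimension_one :: "'v::real_vector ell_data \<Rightarrow> bool" where
  "codimension_one D \<longleftrightarrow> deg D (nn D - 1) < deg D (nn D)"


section \<open>The domains and their function rings\<close>

text \<open>
  \<open>Hom\<^sub>\<real>(F~, \<complex>)\<close> is the type of bounded linear maps \<open>'v \<Rightarrow>\<^sub>L complex\<close> (all linear maps, by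
  finite dimension), with the complex structure \<open>hom_scale\<close>.
  A function on \<open>Y\<close> is a total function of which only the values on \<open>Y\<close> matter, so that equality
  of functions on \<open>Y\<close> is always stated pointwise on \<open>Y\<close>; similarly for \<open>H\<close>.
\<close>

definition hom_scale ::
    "complex \<Rightarrow> ('v::euclidean_space \<Rightarrow>\<^sub>L complex) \<Rightarrow> ('v \<Rightarrow>\<^sub>L complex)" where
  "hom_scale c y = blinfun_compose (blinfun_mult_right c) y"

definition dom_Y :: "'v::euclidean_space ell_data \<Rightarrow> ('v \<Rightarrow>\<^sub>L complex) set" where
  "dom_Y D = {y. blinfun_apply y (vec_a D) = - 2 * pi * \<i> \<and> 0 < Re (blinfun_apply y (vec_delta D))}"

text \<open>
  \<open>Y\<close> is open in an affine hyperplane with direction \<open>{\<xi>. \<langle>a, \<xi>\<rangle> = 0}\<close>: holomorphy is Frechet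
  differentiability within \<open>Y\<close>, with derivative complex linear on that direction.
\<close>

definition holo_Y :: "'v::euclidean_space ell_data \<Rightarrow> (('v \<Rightarrow>\<^sub>L complex) \<Rightarrow> complex) set" where
  "holo_Y D = {f. \<forall>y\<in>dom_Y D. \<exists>f'. (f has_derivative f') (at y within dom_Y D) \<and>
     (\<forall>c \<xi>. blinfun_apply \<xi> (vec_a D) = 0 \<longrightarrow> f' (hom_scale c \<xi>) = c * f' \<xi>)}"

text \<open>Elements of \<open>Hom\<^sub>\<real>(rad I, \<complex>)\<close> are functions restricted to \<open>rad_I\<close>.\<close>

definition dom_H :: "'v::euclidean_space ell_data \<Rightarrow> ('v \<Rightarrow> complex) set" where
  "dom_H D = {\<phi> \<in> extensional (rad_I D).
     (\<forall>u\<in>rad_I D. \<forall>v\<in>rad_I D. \<phi> (u + v) = \<phi> u + \<phi> v) \<and>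
     (\<forall>r. \<forall>u\<in>rad_I D. \<phi> (r *\<^sub>R u) = r *\<^sub>R \<phi> u) \<and>
     \<phi> (vec_a D) = - 2 * pi * \<i> \<and> 0 < Re (\<phi> (vec_delta D))}"

definition proj_H :: "'v::euclidean_space ell_data \<Rightarrow> ('v \<Rightarrow>\<^sub>L complex) \<Rightarrow> ('v \<Rightarrow> complex)" where
  "proj_H D y = restrict (blinfun_apply y) (rad_I D)"

text \<open>
  Since \<open>rad I = \<real>a \<oplus> \<real>\<delta>\<close>, evaluation at \<open>\<delta>\<close> is a global complex chart
  from \<open>H\<close> onto the right half plane.
\<close>

definition holo_H :: "'v::euclidean_space ell_data \<Rightarrow> (('v \<Rightarrow> complex) \<Rightarrow> complex) set" where
  "holo_H D = {h. \<exists>k. k holomorphic_on {w. 0 < Re w} \<and> (\<forall>\<phi>\<in>dom_H D. h \<phi> = k (\<phi> (vec_delta D)))}"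

text \<open>For a tangent vector \<open>\<xi>\<close>, the derivative of \<open>f\<close> along the constant vector field \<open>\<xi>\<close>.\<close>

definition dir_deriv ::
    "('v::euclidean_space \<Rightarrow>\<^sub>L complex) \<Rightarrow> (('v \<Rightarrow>\<^sub>L complex) \<Rightarrow> complex) \<Rightarrow> ('v \<Rightarrow>\<^sub>L complex) \<Rightarrow> complex" where
  "dir_deriv \<xi> f y = deriv (\<lambda>t. f (y + hom_scale t \<xi>)) 0"


section \<open>Groups and invariants\<close>

definition orth_group :: "'v::euclidean_space ell_data \<Rightarrow> ('v \<Rightarrow> 'v) set" where
  "orth_group D = {g. linear g \<and> bij g \<and> (\<forall>u v. form D (g u) (g v) = form D u v) \<and>
     g ` space_F D \<subseteq> space_F D \<and> (\<forall>u\<in>rad_I D. g u = u)}"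

inductive_set weyl_group :: "'v::euclidean_space ell_data \<Rightarrow> ('v \<Rightarrow> 'v) set"
  for D :: "'v ell_data" where
  one: "id \<in> weyl_group D"
| gen: "\<alpha> \<in> roots D \<Longrightarrow> reflection (form D) \<alpha> \<in> weyl_group D"
| mult: "g \<in> weyl_group D \<Longrightarrow> h \<in> weyl_group D \<Longrightarrow> g \<circ> h \<in> weyl_group D"
| inverse: "g \<in> weyl_group D \<Longrightarrow> inv_into UNIV g \<in> weyl_group D"

definition act_hom :: "('v::euclidean_space \<Rightarrow> 'v) \<Rightarrow> ('v \<Rightarrow>\<^sub>L complex) \<Rightarrow> ('v \<Rightarrow>\<^sub>L complex)" where
  "act_hom g y = Blinfun (\<lambda>v. blinfun_apply y (inv_into UNIV g v))"

definition act_fun ::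
    "('v::euclidean_space \<Rightarrow> 'v) \<Rightarrow> (('v \<Rightarrow>\<^sub>L complex) \<Rightarrow> complex) \<Rightarrow> ('v \<Rightarrow>\<^sub>L complex) \<Rightarrow> complex" where
  "act_fun g f y = f (act_hom (inv_into UNIV g) y)"

text \<open>The Euler field is constant; \<open>euler_vec\<close> is its value as a tangent vector.\<close>

definition euler_vec :: "'v::euclidean_space ell_data \<Rightarrow> ('v \<Rightarrow>\<^sub>L complex)" where
  "euler_vec D = (THE \<xi>. (\<forall>f\<in>space_F D. blinfun_apply \<xi> f = 0) \<and>
     blinfun_apply \<xi> (Lambda0 D) = of_real (even_scale D * dn D / m_max D))"

definition S_W_deg :: "'v::euclidean_space ell_data \<Rightarrow> nat \<Rightarrow> (('v \<Rightarrow>\<^sub>L complex) \<Rightarrow> complex) set" where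
  "S_W_deg D m = {f \<in> holo_Y D.
     (\<forall>w\<in>weyl_group D. \<forall>y\<in>dom_Y D. act_fun w f y = f y) \<and>
     (\<forall>y\<in>dom_Y D. dir_deriv (euler_vec D) f y = of_nat m * f y)}"

definition S_W :: "'v::euclidean_space ell_data \<Rightarrow> (('v \<Rightarrow>\<^sub>L complex) \<Rightarrow> complex) set" where
  "S_W D = {f. \<exists>N h. (\<forall>m\<le>N. h m \<in> S_W_deg D m) \<and> (\<forall>y\<in>dom_Y D. f y = (\<Sum>m\<le>(N::nat). h m y))}"

text \<open>
  A polynomial over \<open>F(H)\<close> in \<open>x\<^sup>1, \<dots>, x\<^sup>n\<close> is given by its family of coefficients, indexed
  by exponent vectors \<open>k :: nat \<Rightarrow> nat\<close> vanishing outside \<open>{1..n}\<close>.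
\<close>

definition poly_supp ::
    "'v::euclidean_space ell_data \<Rightarrow> ((nat \<Rightarrow> nat) \<Rightarrow> ('v \<Rightarrow> complex) \<Rightarrow> complex) \<Rightarrow> (nat \<Rightarrow> nat) set" where
  "poly_supp D c = {k. \<exists>\<phi>\<in>dom_H D. c k \<phi> \<noteq> 0}"

definition poly_H ::
    "'v::euclidean_space ell_data \<Rightarrow> ((nat \<Rightarrow> nat) \<Rightarrow> ('v \<Rightarrow> complex) \<Rightarrow> complex) set" where
  "poly_H D = {c. (\<forall>k. c k \<in> holo_H D) \<and> finite (poly_supp D c) \<and>
     (\<forall>k\<in>poly_supp D c. \<forall>i. i \<notin> {1..nn D} \<longrightarrow> k i = 0)}"

definition eval_poly ::
    "'v::euclidean_space ell_data \<Rightarrow> (nat \<Rightarrow> ('v \<Rightarrow>\<^sub>L complex) \<Rightarrow> complex) \<Rightarrow>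
     ((nat \<Rightarrow> nat) \<Rightarrow> ('v \<Rightarrow> complex) \<Rightarrow> complex) \<Rightarrow> ('v \<Rightarrow>\<^sub>L complex) \<Rightarrow> complex" where
  "eval_poly D x c y = (\<Sum>k\<in>poly_supp D c. c k (proj_H D y) * (\<Prod>i=1..nn D. x i y ^ k i))"

definition basic_invariants ::
    "'v::euclidean_space ell_data \<Rightarrow> (nat \<Rightarrow> ('v \<Rightarrow>\<^sub>L complex) \<Rightarrow> complex) \<Rightarrow> bool" where
  "basic_invariants D x \<longleftrightarrow>
     0 < deg D 1 \<and>
     (\<forall>i\<in>{1..nn D}. x i \<in> S_W_deg D (deg D i)) \<and>
     (\<forall>c\<in>poly_H D. (\<forall>y\<in>dom_Y D. eval_poly D x c y = 0) \<longrightarrow> poly_supp D c = {}) \<and>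
     (\<forall>f\<in>S_W D. \<exists>c\<in>poly_H D. \<forall>y\<in>dom_Y D. f y = eval_poly D x c y)"

text \<open>
  The derivation \<open>\<partial>/\<partial>x\<^sup>j\<close> (\<open>1 \<le> j \<le> n\<close>) of \<open>F(H)[x\<^sup>1, \<dots>, x\<^sup>n]\<close>. If \<open>x\<close> is a set of basic invariants,
  the chosen coefficient family is unique as a family of functions on \<open>H\<close>.
\<close>

definition partial_x ::
    "'v::euclidean_space ell_data \<Rightarrow> (nat \<Rightarrow> ('v \<Rightarrow>\<^sub>L complex) \<Rightarrow> complex) \<Rightarrow> nat \<Rightarrow>
     (('v \<Rightarrow>\<^sub>L complex) \<Rightarrow> complex) \<Rightarrow> ('v \<Rightarrow>\<^sub>L complex) \<Rightarrow> complex" where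
  "partial_x D x j f y =
     (let c = (SOME c. c \<in> poly_H D \<and> (\<forall>y\<in>dom_Y D. f y = eval_poly D x c y))
      in \<Sum>k\<in>poly_supp D c. of_nat (k j) * c k (proj_H D y) *
           (\<Prod>i=1..nn D. x i y ^ (k i - (if i = j then 1 else 0))))"


section \<open>Complexification and coordinates\<close>

text \<open>The pair \<open>(u, v)\<close> stands for \<open>u + \<i> v\<close> in \<open>F~ \<otimes> \<complex>\<close>.\<close>

type_synonym 'v cpx = "'v \<times> 'v"

definition cpx_scale :: "complex \<Rightarrow> 'v::real_vector cpx \<Rightarrow> 'v cpx" where
  "cpx_scale c w = (Re c *\<^sub>R fst w - Im c *\<^sub>R snd w, Re c *\<^sub>R snd w + Im c *\<^sub>R fst w)"

interpretation cpx: vector_space cpx_scale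
  by unfold_locales (auto simp: cpx_scale_def algebra_simps)

definition of_vec :: "'v::real_vector \<Rightarrow> 'v cpx" where
  "of_vec u = (u, 0)"

definition complexify :: "'v set \<Rightarrow> 'v cpx set" where
  "complexify S = S \<times> S"

definition cpx_map :: "('v \<Rightarrow> 'v) \<Rightarrow> 'v cpx \<Rightarrow> 'v cpx" where
  "cpx_map g w = (g (fst w), g (snd w))"

definition cpx_form :: "('v \<Rightarrow> 'v \<Rightarrow> real) \<Rightarrow> 'v cpx \<Rightarrow> 'v cpx \<Rightarrow> complex" where
  "cpx_form I w w' = Complex (I (fst w) (fst w') - I (snd w) (snd w'))
                             (I (fst w) (snd w') + I (snd w) (fst w'))"

definition cpx_eval :: "'v::euclidean_space cpx \<Rightarrow> ('v \<Rightarrow>\<^sub>L complex) \<Rightarrow> complex" where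
  "cpx_eval w y = blinfun_apply y (fst w) + \<i> * blinfun_apply y (snd w)"

text \<open>
  \<open>coord_vec D z \<beta>\<close> is the coordinate vector field \<open>\<partial>/\<partial>z\<^sup>\<beta>\<close> on \<open>Y\<close>, which is constant because the
  coordinates \<open>z\<^sup>0, \<dots>, z\<^sup>n\<close> are linear.
\<close>

definition coord_vec ::
    "'v::euclidean_space ell_data \<Rightarrow> (nat \<Rightarrow> 'v cpx) \<Rightarrow> nat \<Rightarrow> ('v \<Rightarrow>\<^sub>L complex)" where
  "coord_vec D z \<beta> = (THE \<xi>. blinfun_apply \<xi> (vec_a D) = 0 \<and>
     (\<forall>\<gamma>\<le>nn D. cpx_eval (z \<gamma>) \<xi> = (if \<gamma> = \<beta> then 1 else 0)))"

definition partial_z ::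
    "'v::euclidean_space ell_data \<Rightarrow> (nat \<Rightarrow> 'v cpx) \<Rightarrow> nat \<Rightarrow>
     (('v \<Rightarrow>\<^sub>L complex) \<Rightarrow> complex) \<Rightarrow> ('v \<Rightarrow>\<^sub>L complex) \<Rightarrow> complex" where
  "partial_z D z \<beta> f y = dir_deriv (coord_vec D z \<beta>) f y"

definition form_W ::
    "'v::euclidean_space ell_data \<Rightarrow> (nat \<Rightarrow> 'v cpx) \<Rightarrow> (nat \<Rightarrow> ('v \<Rightarrow>\<^sub>L complex) \<Rightarrow> complex) \<Rightarrow>
     nat \<Rightarrow> nat \<Rightarrow> ('v \<Rightarrow>\<^sub>L complex) \<Rightarrow> complex" where
  "form_W D z x \<alpha> \<beta> y =
     (\<Sum>\<gamma>1\<le>nn D. \<Sum>\<gamma>2\<le>nn D. partial_z D z \<gamma>1 (x \<alpha>) y * partial_z D z \<gamma>2 (x \<beta>) y *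
        cpx_form (form D) (z \<gamma>1) (z \<gamma>2))"


section \<open>Admissible triplets\<close>

definition direct_sum_is :: "'v::real_vector set \<Rightarrow> 'v set \<Rightarrow> 'v set \<Rightarrow> bool" where
  "direct_sum_is V A B \<longleftrightarrow> A \<inter> B = {0} \<and> V = {u + v | u v. u \<in> A \<and> v \<in> B}"

definition semisimple_map :: "('v::real_vector \<Rightarrow> 'v) \<Rightarrow> bool" where
  "semisimple_map g \<longleftrightarrow>
     (\<forall>U. subspace U \<and> g ` U \<subseteq> U \<longrightarrow> (\<exists>V. subspace V \<and> g ` V \<subseteq> V \<and> direct_sum_is UNIV U V))"

definition primitive_root :: "nat \<Rightarrow> complex \<Rightarrow> bool" where
  "primitive_root d \<zeta> \<longleftrightarrow> \<zeta> ^ d = 1 \<and> (\<forall>k. 0 < k \<and> k < d \<longrightarrow> \<zeta> ^ k \<noteq> 1)"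

definition admissible_triplet ::
    "'v::euclidean_space ell_data \<Rightarrow> ('v \<Rightarrow> 'v) \<Rightarrow> complex \<Rightarrow> 'v set \<Rightarrow> bool" where
  "admissible_triplet D g \<zeta> L \<longleftrightarrow>
     g \<in> orth_group D \<and> \<zeta> \<noteq> 0 \<and> subspace L \<and>
     semisimple_map g \<and> (\<forall>u. g u - u \<in> space_F D) \<and>
     primitive_root (dn D) \<zeta> \<and>
     (\<exists>x. basic_invariants D x \<and>
        (\<forall>\<alpha>\<in>{1..nn D}. \<forall>y\<in>dom_Y D. act_fun g (x \<alpha>) y = \<zeta> ^ deg D \<alpha> * x \<alpha> y)) \<and>
     direct_sum_is UNIV L (rad_I D) \<and> g ` L = L \<and> L \<inter> roots D = {}"

text \<open>
  The eigenvalues of a symmetric form are those, with multiplicity, of its Gram matrix in some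
  basis; by Sylvester's law of inertia their signs do not depend on the basis.
\<close>

definition zero_type :: "'v::euclidean_space ell_data \<Rightarrow> 'v set \<Rightarrow> bool" where
  "zero_type D L \<longleftrightarrow>
     (\<exists>bs es. distinct bs \<and> independent (set bs) \<and> span (set bs) = L \<and>
        char_poly (Matrix.mat (length bs) (length bs) (\<lambda>(i, j). form D (bs ! i) (bs ! j)))
          = (\<Prod>e\<leftarrow>es. [:- e, 1:]) \<and>
        length (filter (\<lambda>e. 0 < e) es) = nn D - 1 \<and>
        length (filter (\<lambda>e. e = 0) es) = 1 \<and>
        length (filter (\<lambda>e. e < 0) es) = 0)"

definition perp_Y :: "'v::euclidean_space ell_data \<Rightarrow> 'v set \<Rightarrow> ('v \<Rightarrow>\<^sub>L complex) set" where
  "perp_Y D L = {y \<in> dom_Y D. \<forall>v\<in>L. blinfun_apply y v = 0}"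

definition perp_L :: "'v ell_data \<Rightarrow> 'v set \<Rightarrow> 'v set" where
  "perp_L D L = {u \<in> L. \<forall>v\<in>L \<inter> space_F D. form D u v = 0}"

definition nonzero_const_on :: "'y set \<Rightarrow> ('y \<Rightarrow> complex) \<Rightarrow> bool" where
  "nonzero_const_on A f \<longleftrightarrow> (\<exists>c. c \<noteq> 0 \<and> (\<forall>y\<in>A. f y = c))"

end

theory Submission
  imports Defs "HOL-Complex_Analysis.Complex_Analysis"
begin

text \<open>
  Since \<open>E = -2\<pi>i (I\<^sub>R : I) d\<^sub>n / m\<^sub>m\<^sub>a\<^sub>x \<partial>/\<partial>z\<^sup>n\<close>, the derivative in (i) is a nonzero multiple of \<open>x\<^sup>n\<close>.
  The points of \<open>L\<^sup>\<bottom>\<close> are fixed by \<open>g\<close>, so comparing \<open>\<zeta>\<close>-weights shows that on \<open>L\<^sup>\<bottom>\<close> all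
  \<open>x\<^sup>i\<close> with \<open>i < n\<close> and all \<open>\<partial>x\<^sup>n/\<partial>z\<^sup>\<gamma>\<close> with \<open>0 < \<gamma> < n\<close> vanish. Hence on \<open>L\<^sup>\<bottom>\<close> the form
  \<open>I\<^sub>W(dx\<^sup>n, dx\<^sup>n)\<close> is a multiple of the derivative of \<open>(x\<^sup>n)\<^sup>2\<close> along \<open>L\<^sup>\<bottom>\<close>, and it also equals
  \<open>A (x\<^sup>n)\<^sup>2\<close>, where \<open>2 A \<in> F(H)\<close> is its second derivative with respect to \<open>x\<^sup>n\<close>.

  It remains to see that \<open>x\<^sup>n\<close> does not vanish identically on \<open>L\<^sup>\<bottom>\<close>. Otherwise every invariant of positive
  degree would vanish there. But translates of a nonzero invariant along the fibres of \<open>Y \<longrightarrow> H\<close>,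
  multiplied over an orbit of the finite Weyl group, give again an invariant, as for
  theta functions in the theorem of the square, and a generic translation makes it nonzero at a given point.
\<close>

section \<open>Functionals\<close>

text \<open>Homogeneity is used in integrated form: along the flow of E, whose direction is
  \<open>E0\<close> = I~(., delta), an invariant of degree m is multiplied by exp(m s). This is
  where the factors in the orbit product come from: w moves Lambda0, so it preserves the chosen
  fibre directions only up to multiples of \<open>E0\<close>, and each such multiple costs an
  exponential of a linear form in the direction.

  Nonvanishing is needed at a single point of L^perp. L^perp meets every fibre of Y over H, so one
  stays in the fibre of a point where x^n is nonzero; once (x^n)^2 is known to be constant on the
  half plane L^perp, that point decides.

  The analytic obstacle is that I_W(dx^n, dx^n) can be expanded in x^1, ..., x^n only after it is
  known to lie in S^W, whereas holomorphy on Y is defined by first derivatives. Partial derivatives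
  are therefore shown to be holomorphic by Cauchy's formula along lines and differentiation under
  the integral. The degree 2 d_n then reduces the second derivative in x^n to one coefficient in
  F(H).\<close>

lemma hom_scale_apply [simp]: "blinfun_apply (hom_scale c \<xi>) v = c * blinfun_apply \<xi> v"
  by (simp add: hom_scale_def)

lemma hom_scale_0_left [simp]: "hom_scale 0 \<xi> = 0"
  by (rule blinfun_eqI) simp

lemma hom_scale_1 [simp]: "hom_scale 1 \<xi> = \<xi>"
  by (rule blinfun_eqI) simp

lemma hom_scale_hom_scale [simp]: "hom_scale c (hom_scale d \<xi>) = hom_scale (c * d) \<xi>"
  by (rule blinfun_eqI) simp

lemma bounded_linear_hom_scale_left: "bounded_linear (\<lambda>c. hom_scale c \<xi>)"
proof -
  have "linear (\<lambda>c. hom_scale c \<xi>)"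
    by (rule linearI; rule blinfun_eqI) (simp_all add: blinfun.bilinear_simps algebra_simps)
  then show ?thesis
    by (simp add: linear_conv_bounded_linear)
qed

lemma cpx_eval_hom_scale [simp]: "cpx_eval w (hom_scale c \<xi>) = c * cpx_eval w \<xi>"
  by (simp add: cpx_eval_def algebra_simps)

lemma cpx_eval_sum: "cpx_eval w (\<Sum>i\<in>S. \<xi> i) = (\<Sum>i\<in>S. cpx_eval w (\<xi> i))"
  by (simp add: cpx_eval_def blinfun.sum_left sum.distrib sum_distrib_left)

lemma cpx_eval_0 [simp]: "cpx_eval w 0 = 0"
  by (simp add: cpx_eval_def blinfun.bilinear_simps)

lemma cpx_eval_diff: "cpx_eval w (\<xi> - \<eta>) = cpx_eval w \<xi> - cpx_eval w \<eta>"
  by (simp add: cpx_eval_def blinfun.bilinear_simps algebra_simps)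

lemma cpx_eval_of_vec [simp]: "cpx_eval (of_vec v) \<xi> = blinfun_apply \<xi> v"
  by (simp add: cpx_eval_def of_vec_def blinfun.bilinear_simps)

lemma cpx_eval_cpx_scale [simp]: "cpx_eval (cpx_scale c w) \<xi> = c * cpx_eval w \<xi>"
  by (simp add: cpx_eval_def cpx_scale_def blinfun.bilinear_simps scaleR_conv_of_real
      algebra_simps complex_eq_iff)

lemma cpx_eval_add_left: "cpx_eval (w + w') \<xi> = cpx_eval w \<xi> + cpx_eval w' \<xi>"
  by (simp add: cpx_eval_def blinfun.bilinear_simps algebra_simps)

lemma cpx_eval_zero_on_span:
  assumes "w \<in> cpx.span S" and "\<And>s. s \<in> S \<Longrightarrow> cpx_eval s \<xi> = 0"
  shows "cpx_eval w \<xi> = 0"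
  using assms(1)
proof (induction rule: cpx.span_induct_alt)
  case base
  then show ?case by (simp add: cpx_eval_def blinfun.bilinear_simps)
next
  case (step c x y)
  then show ?case by (simp add: cpx_eval_add_left assms(2))
qed

text \<open>Precomposition with w is the action of the inverse of w on functionals. The inverses in
  \<open>act_hom\<close> and \<open>act_fun\<close> cancel, so invariance reads f (pull w y) = f
  y.\<close>

definition pull :: "('v::euclidean_space \<Rightarrow> 'v) \<Rightarrow> ('v \<Rightarrow>\<^sub>L complex) \<Rightarrow> ('v \<Rightarrow>\<^sub>L complex)" where
  "pull w y = Blinfun (\<lambda>v. blinfun_apply y (w v))"

lemma pull_apply [simp]:
  assumes "linear w"
  shows "blinfun_apply (pull w y) v = blinfun_apply y (w v)"
proof -
  have "bounded_linear w"
    using assms by (simp add: linear_conv_bounded_linear)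
  then have "bounded_linear (\<lambda>v. blinfun_apply y (w v))"
    using bounded_linear_compose[OF blinfun.bounded_linear_right] by blast
  then show ?thesis
    by (simp add: pull_def bounded_linear_Blinfun_apply)
qed

lemma pull_add: "linear w \<Longrightarrow> pull w (y + \<xi>) = pull w y + pull w \<xi>"
  by (rule blinfun_eqI) (simp add: blinfun.bilinear_simps)

lemma pull_hom_scale: "linear w \<Longrightarrow> pull w (hom_scale c \<xi>) = hom_scale c (pull w \<xi>)"
  by (rule blinfun_eqI) simp

lemma cpx_eval_pull: "linear w \<Longrightarrow> cpx_eval u (pull w \<xi>) = cpx_eval (cpx_map w u) \<xi>"
  by (simp add: cpx_eval_def cpx_map_def)

lemma act_fun_eq_pull: "bij w \<Longrightarrow> act_fun w f y = f (pull w y)"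
  by (simp add: act_fun_def act_hom_def pull_def inv_inv_eq)

section \<open>Marked elliptic root systems\<close>

locale elliptic =
  fixes D :: "'v::euclidean_space ell_data"
  assumes marked: "marked_elliptic D"
begin

abbreviation "I \<equiv> form D"
abbreviation "F \<equiv> space_F D"
abbreviation "R \<equiv> roots D"
abbreviation "a \<equiv> vec_a D"
abbreviation "\<delta> \<equiv> vec_delta D"
abbreviation "\<Lambda> \<equiv> Lambda0 D"

lemma
  shows bilin: "bilinear I"
    and I_sym: "I u v = I v u"
    and I_Lambda_delta: "I \<Lambda> \<delta> = 1"
    and radical_UNIV: "radical_on UNIV I = span {a}"
    and subspace_F: "subspace F"
    and I_nonneg: "u \<in> F \<Longrightarrow> 0 \<le> I u u"
    and ers: "elliptic_root_system F I R"
  using marked by (auto simp: marked_elliptic_def is_hyperbolic_extension_def)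

lemmas I_simps = bilinear_ladd[OF bilin] bilinear_radd[OF bilin] bilinear_lmul[OF bilin]
  bilinear_rmul[OF bilin] bilinear_lneg[OF bilin] bilinear_rneg[OF bilin]
  bilinear_lzero[OF bilin] bilinear_rzero[OF bilin] bilinear_lsub[OF bilin] bilinear_rsub[OF bilin]

lemma I_a_left [simp]: "I a v = 0"
proof -
  have "a \<in> radical_on UNIV I"
    unfolding radical_UNIV by (simp add: span_base)
  then show ?thesis by (simp add: radical_on_def)
qed

lemma I_a_right [simp]: "I v a = 0"
  using I_sym[of v a] by simp

lemma a_in_rad: "a \<in> rad_I D" and delta_in_rad: "\<delta> \<in> rad_I D"
proof -
  have m: "line_G D \<subseteq> rad_I D"
    "root_lattice D \<inter> rad_I D = {of_int i *\<^sub>R a + of_int j *\<^sub>R \<delta> | i j. True}"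
    using marked by (auto simp: marked_elliptic_def is_marking_def)
  show "a \<in> rad_I D"
    using m(1) by (auto simp: line_G_def span_base)
  have "of_int 0 *\<^sub>R a + of_int 1 *\<^sub>R \<delta> \<in> {of_int i *\<^sub>R a + of_int j *\<^sub>R \<delta> | i j. True}"
    by blast
  then show "\<delta> \<in> rad_I D"
    unfolding m(2)[symmetric] by simp
qed

lemma indep_a_delta: "a \<noteq> \<delta>" "independent {a, \<delta>}"
  using marked by (auto simp: marked_elliptic_def is_marking_def)

lemma a_in_F: "a \<in> F" and delta_in_F: "\<delta> \<in> F"
  using a_in_rad delta_in_rad by (auto simp: rad_I_def radical_on_def)

lemma I_F_rad: "u \<in> F \<Longrightarrow> r \<in> rad_I D \<Longrightarrow> I u r = 0"
  using I_sym by (auto simp: rad_I_def radical_on_def)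

lemma I_F_delta: "u \<in> F \<Longrightarrow> I u \<delta> = 0"
  using I_F_rad delta_in_rad by blast

lemma subspace_rad: "subspace (rad_I D)"
  using subspace_F unfolding subspace_def rad_I_def radical_on_def by (auto simp: I_simps)

lemma rad_eq_span: "rad_I D = span {a, \<delta>}"
proof -
  have "{a, \<delta>} \<subseteq> rad_I D" using a_in_rad delta_in_rad by auto
  moreover have "dim {a, \<delta>} = 2"
    using indep_a_delta by (simp add: dim_eq_card_independent)
  moreover have "dim (rad_I D) = 2"
    using marked by (simp add: marked_elliptic_def)
  moreover have "span {a, \<delta>} \<subseteq> rad_I D"
    using calculation(1) subspace_rad by (simp add: span_minimal)
  ultimately show ?thesis
    by (metis subspace_rad subspace_span subspace_dim_equal dim_span order_refl)
qed

lemma rad_cases: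
  assumes "v \<in> rad_I D"
  obtains p q where "v = p *\<^sub>R a + q *\<^sub>R \<delta>"
proof -
  have "v \<in> span (insert a {\<delta>})" using assms rad_eq_span by simp
  then obtain p where "v - p *\<^sub>R a \<in> span {\<delta>}"
    by (auto simp: span_breakdown_eq)
  then obtain q where "v - p *\<^sub>R a = q *\<^sub>R \<delta>"
    by (auto simp: span_singleton)
  then have "v = p *\<^sub>R a + q *\<^sub>R \<delta>" by (simp add: algebra_simps)
  then show thesis by (rule that)
qed

lemma Lambda_notin_F: "\<Lambda> \<notin> F"
  using I_F_delta I_Lambda_delta by force

text \<open>F is a hyperplane that misses Lambda0. Pairing with \<delta> kills F and is 1 at
  Lambda0, so it reads off the coefficient.\<close>

lemma sub_Lambda_in_F: "v - I v \<delta> *\<^sub>R \<Lambda> \<in> F"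
proof -
  have "\<Lambda> \<notin> span F" using Lambda_notin_F subspace_F by (metis span_eq_iff)
  then have "dim (insert \<Lambda> F) = DIM('v)"
    using marked by (simp add: dim_insert marked_elliptic_def is_hyperbolic_extension_def)
  then have "v \<in> span (insert \<Lambda> F)" by (simp add: dim_eq_full)
  then obtain k where k: "v - k *\<^sub>R \<Lambda> \<in> F"
    using subspace_F by (metis span_breakdown_eq span_eq_iff)
  have "I (v - k *\<^sub>R \<Lambda>) \<delta> = 0" using I_F_delta[OF k] .
  then have "k = I v \<delta>" by (simp add: I_simps I_Lambda_delta)
  then show ?thesis using k by simp
qed

lemma R_subset_F: "R \<subseteq> F"
  and R_nonisotropic: "\<alpha> \<in> R \<Longrightarrow> I \<alpha> \<alpha> \<noteq> 0"
  and R_integral: "\<alpha> \<in> R \<Longrightarrow> \<beta> \<in> R \<Longrightarrow> I \<alpha> (coroot I \<beta>) \<in> \<int>"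
  and R_reflection: "\<alpha> \<in> R \<Longrightarrow> reflection I \<alpha> ` R = R"
  using ers by (auto simp: elliptic_root_system_def)

text \<open>The lattice Q(R) contains a basis of F and lies in the real span of R.\<close>

lemma span_R: "span R = F"
proof -
  obtain B where B: "span B = F" "int_span R = int_span B"
    using ers by (auto simp: elliptic_root_system_def full_lattice_def)
  have "B \<subseteq> int_span R"
    unfolding B(2) unfolding int_span_def by (rule hull_subset)
  also have "int_span R \<subseteq> span R"
    unfolding int_span_def
    by (rule hull_minimal) (auto simp: span_base span_zero span_diff)
  finally have "F \<subseteq> span R"
    using B by (metis span_minimal subspace_span)
  moreover have "span R \<subseteq> F"
    using R_subset_F subspace_F by (simp add: span_minimal)
  ultimately show ?thesis by blast
qed

lemma R_I_pos: "\<alpha> \<in> R \<Longrightarrow> 0 < I \<alpha> \<alpha>"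
  using R_nonisotropic I_nonneg R_subset_F by (metis order_le_less subsetD)

lemma I_coroot_right: "I u (coroot I \<alpha>) = 2 * I u \<alpha> / I \<alpha> \<alpha>"
  by (simp add: coroot_def I_simps)

section \<open>Tangent functionals and the Euler direction\<close>

lemma functional_eqI:
  assumes "\<And>v. v \<in> F \<Longrightarrow> blinfun_apply \<xi> v = blinfun_apply \<eta> v"
    and "blinfun_apply \<xi> \<Lambda> = blinfun_apply \<eta> \<Lambda>"
  shows "\<xi> = (\<eta> :: 'v \<Rightarrow>\<^sub>L complex)"
proof (rule blinfun_eqI)
  fix v
  have *: "blinfun_apply \<theta> v = blinfun_apply \<theta> (v - I v \<delta> *\<^sub>R \<Lambda>) + I v \<delta> *\<^sub>R blinfun_apply \<theta> \<Lambda>"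
    for \<theta> :: "'v \<Rightarrow>\<^sub>L complex"
    by (simp add: blinfun.bilinear_simps)
  show "blinfun_apply \<xi> v = blinfun_apply \<eta> v"
    unfolding *[of \<xi>] *[of \<eta>] using assms sub_Lambda_in_F[of v] by simp
qed

text \<open>The functional I~(., w). Since \<open>a\<close> spans the radical, it kills
  \<open>a\<close> and is thus a direction tangent to Y.\<close>

definition form_hom :: "'v cpx \<Rightarrow> 'v \<Rightarrow>\<^sub>L complex" where
  "form_hom w = Blinfun (\<lambda>v. cpx_form I (of_vec v) w)"

lemma form_hom_apply: "blinfun_apply (form_hom w) v = Complex (I v (fst w)) (I v (snd w))"
proof -
  have "linear (\<lambda>v. cpx_form I (of_vec v) w)"
    by (rule linearI) (simp_all add: cpx_form_def of_vec_def I_simps complex_eq_iff)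
  then have "bounded_linear (\<lambda>v. cpx_form I (of_vec v) w)"
    by (simp add: linear_conv_bounded_linear)
  then show ?thesis
    by (simp add: form_hom_def bounded_linear_Blinfun_apply cpx_form_def of_vec_def I_simps)
qed

lemma cpx_eval_form_hom: "cpx_eval u (form_hom w) = cpx_form I u w"
  by (simp add: cpx_eval_def form_hom_apply cpx_form_def complex_eq_iff)

lemma form_hom_a [simp]: "blinfun_apply (form_hom w) a = 0"
  by (simp add: form_hom_apply zero_complex.ctr)

lemma cpx_form_sym: "cpx_form I u w = cpx_form I w u"
  by (simp add: cpx_form_def I_sym algebra_simps complex_eq_iff)

text \<open>The Euler field up to a scalar: it vanishes on F and is 1 at Lambda0. As a pairing with
  \<delta> it can be compared with the field dual to z^n.\<close>

definition E0 :: "'v \<Rightarrow>\<^sub>L complex" where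
  "E0 = form_hom (of_vec \<delta>)"

lemma E0_apply: "blinfun_apply E0 v = of_real (I v \<delta>)"
  by (simp add: E0_def form_hom_apply of_vec_def I_simps complex_eq_iff)

lemma E0_F [simp]: "v \<in> F \<Longrightarrow> blinfun_apply E0 v = 0"
  by (simp add: E0_apply I_F_delta)

lemma E0_a [simp]: "blinfun_apply E0 a = 0"
  by (simp add: a_in_F)

lemma E0_delta [simp]: "blinfun_apply E0 \<delta> = 0"
  by (simp add: delta_in_F)

lemma E0_Lambda [simp]: "blinfun_apply E0 \<Lambda> = 1"
  by (simp add: E0_apply I_Lambda_delta)

definition euler_scale :: complex where
  "euler_scale = of_real (even_scale D * dn D / m_max D)"

lemma euler_vec_eq: "euler_vec D = hom_scale euler_scale E0"
  unfolding euler_vec_def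
proof (rule the_equality)
  show "(\<forall>f\<in>F. blinfun_apply (hom_scale euler_scale E0) f = 0) \<and>
    blinfun_apply (hom_scale euler_scale E0) \<Lambda> = complex_of_real (even_scale D * real (dn D) / m_max D)"
    by (simp add: euler_scale_def)
next
  fix \<xi> assume "(\<forall>f\<in>F. blinfun_apply \<xi> f = 0) \<and>
    blinfun_apply \<xi> \<Lambda> = complex_of_real (even_scale D * real (dn D) / m_max D)"
  then show "\<xi> = hom_scale euler_scale E0"
    by (intro functional_eqI) (simp_all add: euler_scale_def)
qed

section \<open>Directional derivatives on Y\<close>

abbreviation "Y \<equiv> dom_Y D"

lemma dom_Y_add:
  assumes "y \<in> Y" "blinfun_apply \<xi> a = 0" "blinfun_apply \<xi> \<delta> = 0"
  shows "y + \<xi> \<in> Y"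
  using assms by (simp add: dom_Y_def blinfun.bilinear_simps)

lemma dom_Y_flow: "y \<in> Y \<Longrightarrow> y + hom_scale s E0 \<in> Y"
  by (rule dom_Y_add) simp_all

lemma open_line_dom_Y: "blinfun_apply \<xi> a = 0 \<Longrightarrow> open {t. y + hom_scale t \<xi> \<in> Y}"
proof -
  assume "blinfun_apply \<xi> a = 0"
  then have "{t. y + hom_scale t \<xi> \<in> Y} =
     (if blinfun_apply y a = - 2 * pi * \<i> then {t. 0 < Re (blinfun_apply y \<delta> + t * blinfun_apply \<xi> \<delta>)} else {})"
    by (auto simp: dom_Y_def blinfun.bilinear_simps)
  moreover have "open {t. 0 < Re (blinfun_apply y \<delta> + t * blinfun_apply \<xi> \<delta>)}"
    by (intro open_Collect_less continuous_intros)
  ultimately show ?thesis by simp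
qed

lemma line_has_derivative:
  assumes f: "(f has_derivative f') (at (y + hom_scale t \<xi>) within Y)"
    and lin: "\<And>c. f' (hom_scale c \<xi>) = c * f' \<xi>"
    and \<xi>: "blinfun_apply \<xi> a = 0" and y: "y + hom_scale t \<xi> \<in> Y"
  shows "((\<lambda>t. f (y + hom_scale t \<xi>)) has_field_derivative f' \<xi>) (at t)"
proof -
  let ?U = "{t. y + hom_scale t \<xi> \<in> Y}" and ?l = "\<lambda>t. y + hom_scale t \<xi>"
  have l: "(?l has_derivative (\<lambda>s. hom_scale s \<xi>)) (at t within ?U)"
    using bounded_linear_imp_has_derivative[OF bounded_linear_hom_scale_left]
    by (auto intro!: derivative_eq_intros)
  have "(f has_derivative f') (at (?l t) within ?l ` ?U)"
    by (rule has_derivative_subset[OF f]) auto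
  then have "((\<lambda>t. f (?l t)) has_derivative (\<lambda>s. f' (hom_scale s \<xi>))) (at t within ?U)"
    by (rule has_derivative_in_compose[OF l])
  then have "((\<lambda>t. f (?l t)) has_field_derivative f' \<xi>) (at t within ?U)"
    unfolding has_field_derivative_def lin by (simp add: mult.commute[of _ "f' \<xi>"])
  then show ?thesis
    using at_within_open[OF _ open_line_dom_Y[OF \<xi>], of t y] y by simp
qed

text \<open>A derivative within Y is determined only on directions that kill \<open>a\<close>; there
  it must agree with the directional derivatives.\<close>

lemma holo_Y_has_derivative:
  assumes "f \<in> holo_Y D" "y \<in> Y"
  shows "\<exists>f'. (f has_derivative f') (at y within Y) \<and>
    (\<forall>\<xi>. blinfun_apply \<xi> a = 0 \<longrightarrow> f' \<xi> = dir_deriv \<xi> f y) \<and>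
    (\<forall>c \<xi>. blinfun_apply \<xi> a = 0 \<longrightarrow> f' (hom_scale c \<xi>) = c * f' \<xi>)"
proof -
  obtain f' where f': "(f has_derivative f') (at y within Y)"
     "\<And>c \<xi>. blinfun_apply \<xi> a = 0 \<Longrightarrow> f' (hom_scale c \<xi>) = c * f' \<xi>"
    using assms by (auto simp: holo_Y_def)
  have "f' \<xi> = dir_deriv \<xi> f y" if "blinfun_apply \<xi> a = 0" for \<xi>
    unfolding dir_deriv_def
    by (rule DERIV_imp_deriv[symmetric], rule line_has_derivative)
      (use that f' assms in \<open>auto simp: mult.commute\<close>)
  with f' show ?thesis by auto
qed

lemma line_has_field_derivative:
  assumes "f \<in> holo_Y D" "blinfun_apply \<xi> a = 0" "y + hom_scale t \<xi> \<in> Y"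
  shows "((\<lambda>t. f (y + hom_scale t \<xi>)) has_field_derivative dir_deriv \<xi> f (y + hom_scale t \<xi>)) (at t)"
proof -
  obtain f' where f': "(f has_derivative f') (at (y + hom_scale t \<xi>) within Y)"
    "\<forall>\<eta>. blinfun_apply \<eta> a = 0 \<longrightarrow> f' \<eta> = dir_deriv \<eta> f (y + hom_scale t \<xi>)"
    "\<forall>c \<xi>. blinfun_apply \<xi> a = 0 \<longrightarrow> f' (hom_scale c \<xi>) = c * f' \<xi>"
    using holo_Y_has_derivative[OF assms(1,3)] by blast
  show ?thesis
    using line_has_derivative[OF f'(1)] f'(2,3) assms(2,3) by auto
qed

lemma dir_deriv_hom_scale:
  assumes "f \<in> holo_Y D" "y \<in> Y" "blinfun_apply \<xi> a = 0"
  shows "dir_deriv (hom_scale c \<xi>) f y = c * dir_deriv \<xi> f y"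
  using holo_Y_has_derivative[OF assms(1,2)] assms(3)
  by (metis hom_scale_apply mult_zero_right)

lemma dir_deriv_add:
  assumes "f \<in> holo_Y D" "y \<in> Y" "blinfun_apply \<xi> a = 0" "blinfun_apply \<eta> a = 0"
  shows "dir_deriv (\<xi> + \<eta>) f y = dir_deriv \<xi> f y + dir_deriv \<eta> f y"
proof -
  obtain f' where f': "(f has_derivative f') (at y within Y)"
    "\<forall>\<xi>. blinfun_apply \<xi> a = 0 \<longrightarrow> f' \<xi> = dir_deriv \<xi> f y"
    using holo_Y_has_derivative[OF assms(1,2)] by blast
  have "f' (\<xi> + \<eta>) = f' \<xi> + f' \<eta>"
    using has_derivative_linear[OF f'(1)] by (simp add: linear_add)
  then show ?thesis using f'(2) assms(3,4) by (simp add: blinfun.bilinear_simps)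
qed

lemma dir_deriv_sum:
  assumes "f \<in> holo_Y D" "y \<in> Y" "finite S" "\<And>i. i \<in> S \<Longrightarrow> blinfun_apply (\<xi> i) a = 0"
  shows "dir_deriv (\<Sum>i\<in>S. \<xi> i) f y = (\<Sum>i\<in>S. dir_deriv (\<xi> i) f y)"
  using assms(3,4)
proof (induction S rule: finite_induct)
  case empty
  have "dir_deriv (hom_scale 0 (0 :: 'v \<Rightarrow>\<^sub>L complex)) f y = 0 * dir_deriv 0 f y"
    by (rule dir_deriv_hom_scale[OF assms(1,2)]) simp
  then show ?case by simp
next
  case (insert i S)
  then show ?case
    using assms(1,2) by (simp add: dir_deriv_add blinfun.sum_left)
qed

lemma dir_deriv_cong:
  assumes "\<And>y. y \<in> Y \<Longrightarrow> f y = f' y" "y \<in> Y" "blinfun_apply \<xi> a = 0"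
  shows "dir_deriv \<xi> f y = dir_deriv \<xi> f' y"
  unfolding dir_deriv_def
proof (rule deriv_cong_ev)
  have "eventually (\<lambda>t. t \<in> {t. y + hom_scale t \<xi> \<in> Y}) (nhds 0)"
    by (rule eventually_nhds_in_open[OF open_line_dom_Y]) (use assms in auto)
  then show "\<forall>\<^sub>F t in nhds 0. f (y + hom_scale t \<xi>) = f' (y + hom_scale t \<xi>)"
    by eventually_elim (use assms(1) in auto)
qed simp

section \<open>Degrees and the Euler field\<close>

lemma S_W_deg_holo: "f \<in> S_W_deg D m \<Longrightarrow> f \<in> holo_Y D"
  by (simp add: S_W_deg_def)

lemma weyl_linear_bij:
  assumes "w \<in> weyl_group D"
  shows "linear w \<and> bij w"
  using assms
proof induction
  case one
  then show ?case by (simp add: linear_id id_def[symmetric] bij_id)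
next
  case (gen \<alpha>)
  have lin: "linear (reflection I \<alpha>)"
    by (rule linearI) (simp_all add: reflection_def I_simps algebra_simps)
  have "reflection I \<alpha> (reflection I \<alpha> v) = v" for v
    using R_nonisotropic[OF gen] by (simp add: reflection_def I_simps coroot_def)
  then have "bij (reflection I \<alpha>)"
    by (metis involuntory_imp_bij)
  with lin show ?case by blast
next
  case (mult g h)
  then show ?case using linear_compose[of h g] bij_comp[of h g] by (simp add: o_def)
next
  case (inverse g)
  then show ?case
    by (meson bij_imp_bij_inv bij_is_inj bij_is_surj inj_linear_imp_inv_linear)
qed

lemmas weyl_linear = weyl_linear_bij[THEN conjunct1]
lemmas weyl_bij = weyl_linear_bij[THEN conjunct2]

lemma S_W_deg_iff:
  "f \<in> S_W_deg D m \<longleftrightarrow> f \<in> holo_Y D \<and>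
     (\<forall>w\<in>weyl_group D. \<forall>y\<in>Y. f (pull w y) = f y) \<and>
     (\<forall>y\<in>Y. euler_scale * dir_deriv E0 f y = of_nat m * f y)"
  by (auto simp: S_W_deg_def act_fun_eq_pull weyl_bij euler_vec_eq dir_deriv_hom_scale)

text \<open>The Euler equation is integrated: \<open>h\<close> has derivative 0 along the flow of E.
  In this form homogeneity passes easily to translates, products and monomials.\<close>

lemma S_W_deg_flow:
  assumes f: "f \<in> S_W_deg D m" and y: "y \<in> Y"
  shows "f (y + hom_scale (s * euler_scale) E0) = exp (of_nat m * s) * f y"
proof -
  define h where "h t = exp (- (of_nat m * t)) * f (y + hom_scale (t * euler_scale) E0)" for t
  have "(h has_field_derivative 0) (at t)" for t
  proof -
    have yt: "y + hom_scale (t * euler_scale) E0 \<in> Y"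
      by (rule dom_Y_flow[OF y])
    have "((\<lambda>t. f (y + hom_scale t (hom_scale euler_scale E0))) has_field_derivative
        dir_deriv (hom_scale euler_scale E0) f (y + hom_scale t (hom_scale euler_scale E0))) (at t)"
      by (rule line_has_field_derivative) (use S_W_deg_holo[OF f] yt in auto)
    moreover have "dir_deriv (hom_scale euler_scale E0) f (y + hom_scale t (hom_scale euler_scale E0))
        = of_nat m * f (y + hom_scale (t * euler_scale) E0)"
      using f yt by (simp add: S_W_deg_iff dir_deriv_hom_scale)
    ultimately show ?thesis
      unfolding h_def by (auto intro!: derivative_eq_intros simp: algebra_simps)
  qed
  then obtain k where "h t = k" for t
    using has_field_derivative_zero_constant[of UNIV h] by auto
  then have "h s = h 0"
    by simp
  then show ?thesis
    by (simp add: h_def exp_minus field_simps)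
qed

section \<open>Polynomials in basic invariants\<close>

abbreviation "n \<equiv> nn D"
abbreviation "\<pi> \<equiv> proj_H D"

definition weight :: "(nat \<Rightarrow> nat) \<Rightarrow> nat" where
  "weight k = (\<Sum>i=1..n. k i * deg D i)"

definition x_monom :: "(nat \<Rightarrow> ('v \<Rightarrow>\<^sub>L complex) \<Rightarrow> complex) \<Rightarrow> (nat \<Rightarrow> nat) \<Rightarrow> ('v \<Rightarrow>\<^sub>L complex) \<Rightarrow> complex" where
  "x_monom x k y = (\<Prod>i=1..n. x i y ^ k i)"

lemma eval_poly_monom: "eval_poly D x c y = (\<Sum>k\<in>poly_supp D c. c k (\<pi> y) * x_monom x k y)"
  by (simp add: eval_poly_def x_monom_def)

lemma proj_H_dom: "y \<in> Y \<Longrightarrow> \<pi> y \<in> dom_H D"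
  using subspace_rad a_in_rad delta_in_rad
  by (auto simp: dom_H_def proj_H_def dom_Y_def subspace_def blinfun.bilinear_simps)

text \<open>The index set of \<open>eval_poly\<close> depends on the coefficients, so different
  families are compared over a common finite set.\<close>

lemma eval_poly_superset:
  assumes "finite S" "poly_supp D c \<subseteq> S" "y \<in> Y"
  shows "eval_poly D x c y = (\<Sum>k\<in>S. c k (\<pi> y) * x_monom x k y)"
  unfolding eval_poly_monom
  by (rule sum.mono_neutral_left) (use assms proj_H_dom in \<open>auto simp: poly_supp_def\<close>)

lemma proj_H_cong:
  assumes "\<And>v. v \<in> rad_I D \<Longrightarrow> blinfun_apply y v = blinfun_apply y' v"
  shows "\<pi> y = \<pi> y'"
  using assms by (auto simp: proj_H_def)

lemma proj_H_eqI:
  assumes "blinfun_apply y a = blinfun_apply y' a" "blinfun_apply y \<delta> = blinfun_apply y' \<delta>"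
  shows "\<pi> y = \<pi> y'"
proof (rule proj_H_cong)
  fix v assume "v \<in> rad_I D"
  then obtain p q where "v = p *\<^sub>R a + q *\<^sub>R \<delta>" by (rule rad_cases)
  with assms show "blinfun_apply y v = blinfun_apply y' v"
    by (simp add: blinfun.bilinear_simps)
qed

lemma proj_H_add [simp]:
  "blinfun_apply \<xi> a = 0 \<Longrightarrow> blinfun_apply \<xi> \<delta> = 0 \<Longrightarrow> \<pi> (y + \<xi>) = \<pi> y"
  by (rule proj_H_eqI) (simp_all add: blinfun.bilinear_simps)

lemma holo_H_lincomb:
  assumes "h \<in> holo_H D" "h' \<in> holo_H D"
  shows "(\<lambda>\<phi>. s * h \<phi> + s' * h' \<phi>) \<in> holo_H D"
proof -
  obtain f f' where f: "f holomorphic_on {w. 0 < Re w}" "\<And>\<phi>. \<phi> \<in> dom_H D \<Longrightarrow> h \<phi> = f (\<phi> \<delta>)"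
    "f' holomorphic_on {w. 0 < Re w}" "\<And>\<phi>. \<phi> \<in> dom_H D \<Longrightarrow> h' \<phi> = f' (\<phi> \<delta>)"
    using assms by (auto simp: holo_H_def)
  have "(\<lambda>w. s * f w + s' * f' w) holomorphic_on {w. 0 < Re w}"
    using f by (intro holomorphic_intros) auto
  with f show ?thesis unfolding holo_H_def by (intro CollectI exI[of _ "\<lambda>w. s * f w + s' * f' w"]) auto
qed

lemma holo_H_cmult: "h \<in> holo_H D \<Longrightarrow> (\<lambda>\<phi>. s * h \<phi>) \<in> holo_H D"
  using holo_H_lincomb[of h h s 0] by simp

lemma zero_in_holo_H: "(\<lambda>\<phi>. 0) \<in> holo_H D"
  unfolding holo_H_def by (intro CollectI exI[of _ "\<lambda>_. 0"]) (auto intro: holomorphic_intros)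

lemma one_in_holo_H: "(\<lambda>\<phi>. 1) \<in> holo_H D"
  unfolding holo_H_def by (intro CollectI exI[of _ "\<lambda>_. 1"]) (auto intro: holomorphic_intros)

lemma poly_supp_lincomb:
  "poly_supp D (\<lambda>k \<phi>. s k * c k \<phi> + s' k * c' k \<phi>) \<subseteq> poly_supp D c \<union> poly_supp D c'"
  by (force simp: poly_supp_def)

lemma poly_H_lincomb:
  assumes "c \<in> poly_H D" "c' \<in> poly_H D"
  shows "(\<lambda>k \<phi>. s k * c k \<phi> + s' k * c' k \<phi>) \<in> poly_H D"
  using assms poly_supp_lincomb[of s c s' c'] holo_H_lincomb
  unfolding poly_H_def by (auto dest: finite_subset)

lemma poly_unique:
  assumes x: "basic_invariants D x" and c: "c \<in> poly_H D" "c' \<in> poly_H D"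
    and eq: "\<And>y. y \<in> Y \<Longrightarrow> eval_poly D x c y = eval_poly D x c' y" and "\<phi> \<in> dom_H D"
  shows "c k \<phi> = c' k \<phi>"
proof -
  let ?d = "\<lambda>k \<phi>. 1 * c k \<phi> + (- 1) * c' k \<phi>" and ?S = "poly_supp D c \<union> poly_supp D c'"
  have fin: "finite ?S" using c by (auto simp: poly_H_def)
  have "eval_poly D x ?d y = 0" if y: "y \<in> Y" for y
  proof -
    have "eval_poly D x ?d y = (\<Sum>k\<in>?S. ?d k (\<pi> y) * x_monom x k y)"
      by (rule eval_poly_superset[OF fin _ y]) (rule poly_supp_lincomb)
    also have "\<dots> = eval_poly D x c y - eval_poly D x c' y"
      by (subst (1 2) eval_poly_superset[OF fin _ y])
        (auto simp: sum_subtractf algebra_simps)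
    finally show ?thesis using eq[OF y] by simp
  qed
  moreover have "?d \<in> poly_H D"
    using poly_H_lincomb[OF c, of "\<lambda>_. 1" "\<lambda>_. - 1"] .
  ultimately have "poly_supp D ?d = {}"
    using x unfolding basic_invariants_def by blast
  with \<open>\<phi> \<in> dom_H D\<close> show ?thesis
    by (simp add: poly_supp_def)
qed

lemma basic_invariants_deg: "basic_invariants D x \<Longrightarrow> i \<in> {1..n} \<Longrightarrow> x i \<in> S_W_deg D (deg D i)"
  by (simp add: basic_invariants_def)

lemma x_monom_flow:
  assumes "basic_invariants D x" "y \<in> Y"
  shows "x_monom x k (y + hom_scale (s * euler_scale) E0) = exp (of_nat (weight k) * s) * x_monom x k y"
proof -
  have "x i (y + hom_scale (s * euler_scale) E0) ^ k i = exp (of_nat (k i * deg D i) * s) * x i y ^ k i"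
    if "i \<in> {1..n}" for i
    using S_W_deg_flow[OF basic_invariants_deg[OF assms(1) that] assms(2)]
    by (simp add: power_mult_distrib exp_of_nat_mult[symmetric] algebra_simps)
  then have "x_monom x k (y + hom_scale (s * euler_scale) E0) =
      (\<Prod>i=1..n. exp (of_nat (k i * deg D i) * s)) * x_monom x k y"
    by (simp add: x_monom_def prod.distrib)
  also have "(\<Prod>i=1..n. exp (of_nat (k i * deg D i) * s)) = exp (of_nat (weight k) * s)"
    by (simp add: exp_sum weight_def sum_distrib_right)
  finally show ?thesis .
qed

text \<open>Flowing for time 1 multiplies the monomial k by e^(weight k) and f by e^m. Uniqueness of
  coefficients then forces e^(weight k) = e^m wherever the coefficient is nonzero.\<close>

lemma poly_homogeneous:
  assumes x: "basic_invariants D x" and f: "f \<in> S_W_deg D m" and c: "c \<in> poly_H D"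
    and eq: "\<And>y. y \<in> Y \<Longrightarrow> f y = eval_poly D x c y" and k: "k \<in> poly_supp D c"
  shows "weight k = m"
proof (rule ccontr)
  assume "weight k \<noteq> m"
  let ?e = "\<lambda>j::nat. exp (of_nat j) :: complex"
  have fin: "finite (poly_supp D c)" using c by (auto simp: poly_H_def)
  have H: "(\<lambda>k \<phi>. ?e (weight k) * c k \<phi> + 0 * c k \<phi>) \<in> poly_H D"
    "(\<lambda>k \<phi>. ?e m * c k \<phi> + 0 * c k \<phi>) \<in> poly_H D"
    using poly_H_lincomb[OF c c, of "\<lambda>k. ?e (weight k)" "\<lambda>_. 0"]
      poly_H_lincomb[OF c c, of "\<lambda>k. ?e m" "\<lambda>_. 0"] by simp_all
  obtain \<phi> where \<phi>: "\<phi> \<in> dom_H D" "c k \<phi> \<noteq> 0" using k by (auto simp: poly_supp_def)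
  have "?e (weight k) * c k \<phi> + 0 * c k \<phi> = ?e m * c k \<phi> + 0 * c k \<phi>"
  proof (rule poly_unique[OF x H _ \<phi>(1)])
    fix y assume y: "y \<in> Y"
    let ?y = "y + hom_scale (1 * euler_scale) E0"
    have y': "?y \<in> Y" by (rule dom_Y_flow[OF y])
    have *: "eval_poly D x (\<lambda>k \<phi>. s k * c k \<phi> + 0 * c k \<phi>) y =
        (\<Sum>k\<in>poly_supp D c. s k * c k (\<pi> y) * x_monom x k y)" for s
      by (subst eval_poly_superset[OF fin _ y]) (auto simp: poly_supp_def)
    have "eval_poly D x (\<lambda>k \<phi>. ?e (weight k) * c k \<phi> + 0 * c k \<phi>) y = eval_poly D x c ?y"
      unfolding *[of "\<lambda>k. ?e (weight k)"] eval_poly_monom[of x c]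
      using x_monom_flow[OF x y, of _ 1] by (intro sum.cong) auto
    also have "\<dots> = ?e m * f y"
      using eq[OF y'] S_W_deg_flow[OF f y, of 1] by simp
    also have "\<dots> = eval_poly D x (\<lambda>k \<phi>. ?e m * c k \<phi> + 0 * c k \<phi>) y"
      unfolding *[of "\<lambda>_. ?e m"] eq[OF y] eval_poly_monom[of x c] by (simp add: sum_distrib_left mult.assoc)
    finally show "eval_poly D x (\<lambda>k \<phi>. ?e (weight k) * c k \<phi> + 0 * c k \<phi>) y =
        eval_poly D x (\<lambda>k \<phi>. ?e m * c k \<phi> + 0 * c k \<phi>) y" .
  qed
  with \<phi> have "?e (weight k) = ?e m" by simp
  \<comment> \<open>Norms lead to the real exponential, which is injective.\<close>
  then have "norm (?e (weight k)) = norm (?e m)" by simp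
  then show False using \<open>weight k \<noteq> m\<close> by simp
qed

lemma S_W_deg_subset: "S_W_deg D m \<subseteq> S_W D"
proof
  fix f assume f: "f \<in> S_W_deg D m"
  have zero: "(\<lambda>y. 0) \<in> S_W_deg D j" for j
    by (auto simp: S_W_deg_iff holo_Y_def dir_deriv_def intro!: exI[of _ "\<lambda>_. 0"])
  show "f \<in> S_W D"
    unfolding S_W_def
    by (intro CollectI exI[of _ m] exI[of _ "\<lambda>j. if j = m then f else (\<lambda>y. 0)"])
      (use f zero in \<open>auto simp: if_distrib[of "\<lambda>h. h _"] cong: if_cong\<close>)
qed

lemma basic_invariants_expand:
  assumes x: "basic_invariants D x" and f: "f \<in> S_W_deg D m"
  obtains c where "c \<in> poly_H D" "\<And>y. y \<in> Y \<Longrightarrow> f y = eval_poly D x c y"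
    "\<And>k. k \<in> poly_supp D c \<Longrightarrow> weight k = m"
proof -
  obtain c where "c \<in> poly_H D" "\<And>y. y \<in> Y \<Longrightarrow> f y = eval_poly D x c y"
    using x f S_W_deg_subset unfolding basic_invariants_def by blast
  then show thesis using poly_homogeneous[OF x f] that by blast
qed

text \<open>Invariants of positive degree have no constant term.\<close>

lemma invariant_vanishes:
  assumes x: "basic_invariants D x" and f: "f \<in> S_W_deg D m" and "0 < m" "y \<in> Y"
    and 0: "\<And>i. i \<in> {1..n} \<Longrightarrow> x i y = 0"
  shows "f y = 0"
proof -
  obtain c where c: "\<And>y. y \<in> Y \<Longrightarrow> f y = eval_poly D x c y"
    "\<And>k. k \<in> poly_supp D c \<Longrightarrow> weight k = m"
    using basic_invariants_expand[OF x f] by metis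
  have "x_monom x k y = 0" if "k \<in> poly_supp D c" for k
  proof -
    have "weight k \<noteq> 0" using c(2)[OF that] \<open>0 < m\<close> by simp
    then have "\<exists>i\<in>{1..n}. k i * deg D i \<noteq> 0"
      unfolding weight_def by (rule contrapos_np) (simp add: sum.neutral)
    then obtain i where "i \<in> {1..n}" "k i \<noteq> 0" by auto
    then show ?thesis using 0 by (auto simp: x_monom_def)
  qed
  then show ?thesis using c(1)[OF \<open>y \<in> Y\<close>] by (simp add: eval_poly_monom)
qed

text \<open>A basis of L stays independent when \<delta> and \<open>a\<close> are added. The case L
  = {0} yields points of Y; the L of the triplet yields points and directions of L^perp.\<close>

lemma functional_exists:
  assumes L: "subspace L" "L \<inter> rad_I D = {0}"
  obtains \<xi> :: "'v \<Rightarrow>\<^sub>L complex"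
  where "\<And>v. v \<in> L \<Longrightarrow> blinfun_apply \<xi> v = 0" "blinfun_apply \<xi> a = s" "blinfun_apply \<xi> \<delta> = t"
proof -
  obtain B where B: "finite B" "B \<subseteq> L" "independent B" "span B = L" "card B = dim L"
    by (rule basis_subspace_exists[OF L(1)])
  have L0: "v = 0" if "v \<in> L" "v \<in> rad_I D" for v
    using that L(2) by blast
  have \<delta>0: "\<delta> \<noteq> 0"
    using indep_a_delta(2) dependent_zero[of "{a, \<delta>}"] by force
  have "\<delta> \<notin> span B"
    unfolding B(4) using L0[of \<delta>] delta_in_rad \<delta>0 by blast
  then have i1: "independent (insert \<delta> B)" using B(3) by (metis independent_insertI)
  have "a \<notin> span (insert \<delta> B)"
  proof
    assume "a \<in> span (insert \<delta> B)"
    then obtain k where k: "a - k *\<^sub>R \<delta> \<in> L" unfolding span_breakdown_eq B(4) by blast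
    moreover have "a - k *\<^sub>R \<delta> \<in> rad_I D"
      using subspace_rad a_in_rad delta_in_rad by (simp add: subspace_diff subspace_scale)
    ultimately have "a - k *\<^sub>R \<delta> = 0" by (rule L0)
    then have "a \<in> span {\<delta>}" by (auto simp: span_singleton)
    then show False using indep_a_delta unfolding independent_insert by simp
  qed
  then have i2: "independent (insert a (insert \<delta> B))" using i1 by (metis independent_insertI)
  obtain h where h: "linear h"
     "\<forall>v\<in>insert a (insert \<delta> B). h v = (if v = a then s else if v = \<delta> then t else 0)"
    using linear_independent_extend[OF i2, of "\<lambda>v. if v = a then s else if v = \<delta> then t else 0"] by blast
  have bl: "blinfun_apply (Blinfun h) = h"
    using h(1) by (simp add: linear_conv_bounded_linear bounded_linear_Blinfun_apply)
  have B0: "h v = 0" if "v \<in> B" for v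
  proof -
    have "v \<noteq> \<delta>" using that \<open>\<delta> \<notin> span B\<close> span_base by blast
    moreover have "v \<noteq> a" using that \<open>a \<notin> span (insert \<delta> B)\<close> span_base[of a "insert \<delta> B"] by blast
    ultimately show ?thesis using h(2) that by auto
  qed
  have "h v = 0" if "v \<in> L" for v
    using linear_eq_0_on_span[OF h(1), of B v] B0 that unfolding B(4) by blast
  moreover have "h a = s" "h \<delta> = t"
    using h(2) indep_a_delta(1) by auto
  ultimately show thesis
    by (intro that[of "Blinfun h"]) (simp_all only: bl)
qed

lemma dom_Y_nonempty: "Y \<noteq> {}"
proof -
  have "{0} \<inter> rad_I D = {0}" using subspace_rad subspace_0 by auto
  then obtain \<xi> :: "'v \<Rightarrow>\<^sub>L complex"
    where "\<And>v. v \<in> {0} \<Longrightarrow> blinfun_apply \<xi> v = 0"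
      "blinfun_apply \<xi> a = - 2 * pi * \<i>" "blinfun_apply \<xi> \<delta> = 1"
    by (rule functional_exists[OF subspace_single_0, of "- 2 * pi * \<i>" 1]) (rule that)
  then have "\<xi> \<in> Y" by (simp add: dom_Y_def)
  then show ?thesis by blast
qed

text \<open>Algebraic independence is applied to the polynomial x^i. Its support is nonempty only
  because H is, which comes from a point of Y.\<close>

lemma basic_invariant_nonzero:
  assumes x: "basic_invariants D x" and i: "i \<in> {1..n}"
  shows "\<exists>y\<in>Y. x i y \<noteq> 0"
proof (rule ccontr)
  assume "\<not> ?thesis"
  then have 0: "x i y = 0" if "y \<in> Y" for y using that by blast
  define e :: "nat \<Rightarrow> nat" where "e = (\<lambda>j. if j = i then 1 else 0)"
  define c :: "(nat \<Rightarrow> nat) \<Rightarrow> ('v \<Rightarrow> complex) \<Rightarrow> complex"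
    where "c = (\<lambda>k \<phi>. if k = e then 1 else 0)"
  have supp: "poly_supp D c \<subseteq> {e}" by (auto simp: c_def poly_supp_def split: if_splits)
  have "c \<in> poly_H D"
    unfolding poly_H_def using supp i one_in_holo_H zero_in_holo_H finite_subset[OF supp]
    by (auto simp: c_def e_def)
  moreover have "eval_poly D x c y = 0" if "y \<in> Y" for y
    using supp 0[OF that] i that
    by (subst eval_poly_superset[of "{e}"]) (auto simp: x_monom_def e_def intro!: bexI[of _ i])
  ultimately have "poly_supp D c = {}" using x unfolding basic_invariants_def by blast
  then have "c e \<phi> = 0" if "\<phi> \<in> dom_H D" for \<phi> using that by (auto simp: poly_supp_def)
  then have "dom_H D = {}" by (auto simp: c_def)
  then show False using proj_H_dom dom_Y_nonempty by blast
qed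

section \<open>Invariants without common zeros\<close>

lemma holo_Y_const: "(\<lambda>y. c) \<in> holo_Y D"
  by (auto simp: holo_Y_def intro!: exI[of _ "\<lambda>_. 0"])

lemma holo_Y_mult:
  assumes "f \<in> holo_Y D" "g \<in> holo_Y D"
  shows "(\<lambda>y. f y * g y) \<in> holo_Y D"
  unfolding holo_Y_def
proof (intro CollectI ballI)
  fix y assume y: "y \<in> Y"
  obtain f' where f': "(f has_derivative f') (at y within Y)"
      "\<forall>c \<xi>. blinfun_apply \<xi> a = 0 \<longrightarrow> f' (hom_scale c \<xi>) = c * f' \<xi>"
    using assms(1) y by (auto simp: holo_Y_def)
  obtain g' where g': "(g has_derivative g') (at y within Y)"
      "\<forall>c \<xi>. blinfun_apply \<xi> a = 0 \<longrightarrow> g' (hom_scale c \<xi>) = c * g' \<xi>"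
    using assms(2) y by (auto simp: holo_Y_def)
  show "\<exists>h'. ((\<lambda>y. f y * g y) has_derivative h') (at y within Y) \<and>
     (\<forall>c \<xi>. blinfun_apply \<xi> a = 0 \<longrightarrow> h' (hom_scale c \<xi>) = c * h' \<xi>)"
    by (rule exI, rule conjI, rule has_derivative_mult[OF f'(1) g'(1)])
      (use f'(2) g'(2) in \<open>simp add: algebra_simps\<close>)
qed

lemma holo_Y_add:
  assumes "f \<in> holo_Y D" "g \<in> holo_Y D"
  shows "(\<lambda>y. f y + g y) \<in> holo_Y D"
  unfolding holo_Y_def
proof (intro CollectI ballI)
  fix y assume y: "y \<in> Y"
  obtain f' where f': "(f has_derivative f') (at y within Y)"
      "\<forall>c \<xi>. blinfun_apply \<xi> a = 0 \<longrightarrow> f' (hom_scale c \<xi>) = c * f' \<xi>"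
    using assms(1) y by (auto simp: holo_Y_def)
  obtain g' where g': "(g has_derivative g') (at y within Y)"
      "\<forall>c \<xi>. blinfun_apply \<xi> a = 0 \<longrightarrow> g' (hom_scale c \<xi>) = c * g' \<xi>"
    using assms(2) y by (auto simp: holo_Y_def)
  show "\<exists>h'. ((\<lambda>y. f y + g y) has_derivative h') (at y within Y) \<and>
     (\<forall>c \<xi>. blinfun_apply \<xi> a = 0 \<longrightarrow> h' (hom_scale c \<xi>) = c * h' \<xi>)"
    by (rule exI, rule conjI, rule has_derivative_add[OF f'(1) g'(1)])
      (use f'(2) g'(2) in \<open>simp add: algebra_simps\<close>)
qed

lemma holo_Y_sum:
  "finite S \<Longrightarrow> (\<And>i. i \<in> S \<Longrightarrow> f i \<in> holo_Y D) \<Longrightarrow> (\<lambda>y. \<Sum>i\<in>S. f i y) \<in> holo_Y D"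
  by (induction S rule: finite_induct) (auto intro: holo_Y_const holo_Y_add)

lemma holo_Y_prod:
  "finite S \<Longrightarrow> (\<And>i. i \<in> S \<Longrightarrow> f i \<in> holo_Y D) \<Longrightarrow> (\<lambda>y. \<Prod>i\<in>S. f i y) \<in> holo_Y D"
  by (induction S rule: finite_induct) (auto intro: holo_Y_const holo_Y_mult)

lemma holo_Y_translate:
  assumes "f \<in> holo_Y D" "blinfun_apply \<xi> a = 0" "blinfun_apply \<xi> \<delta> = 0"
  shows "(\<lambda>y. f (y + \<xi>)) \<in> holo_Y D"
  unfolding holo_Y_def
proof (intro CollectI ballI)
  fix y assume y: "y \<in> Y"
  have "y + \<xi> \<in> Y" by (rule dom_Y_add[OF y assms(2,3)])
  then obtain f' where f': "(f has_derivative f') (at (y + \<xi>) within Y)"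
      "\<forall>c \<xi>. blinfun_apply \<xi> a = 0 \<longrightarrow> f' (hom_scale c \<xi>) = c * f' \<xi>"
    using assms(1) by (auto simp: holo_Y_def)
  have "(f has_derivative f') (at (y + \<xi>) within (\<lambda>y. y + \<xi>) ` Y)"
    by (rule has_derivative_subset[OF f'(1)]) (use dom_Y_add assms in auto)
  then have "((\<lambda>y. f (y + \<xi>)) has_derivative (\<lambda>h. f' h)) (at y within Y)"
    by (rule has_derivative_in_compose[rotated]) (auto intro!: derivative_eq_intros)
  with f'(2) show "\<exists>h'. ((\<lambda>y. f (y + \<xi>)) has_derivative h') (at y within Y) \<and>
     (\<forall>c \<xi>. blinfun_apply \<xi> a = 0 \<longrightarrow> h' (hom_scale c \<xi>) = c * h' \<xi>)"
    by blast
qed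

text \<open>Converse of \<open>S_W_deg_flow\<close>: the flow equation is differentiated at s =
  0.\<close>

lemma S_W_degI:
  assumes f: "f \<in> holo_Y D"
    and inv: "\<And>w y. w \<in> weyl_group D \<Longrightarrow> y \<in> Y \<Longrightarrow> f (pull w y) = f y"
    and flow: "\<And>s y. y \<in> Y \<Longrightarrow> f (y + hom_scale (s * euler_scale) E0) = exp (of_nat m * s) * f y"
  shows "f \<in> S_W_deg D m"
proof -
  have "euler_scale * dir_deriv E0 f y = of_nat m * f y" if y: "y \<in> Y" for y
  proof -
    let ?\<xi> = "hom_scale euler_scale E0"
    have "((\<lambda>t. f (y + hom_scale t ?\<xi>)) has_field_derivative dir_deriv ?\<xi> f (y + hom_scale 0 ?\<xi>)) (at 0)"
      by (rule line_has_field_derivative) (use f y in auto)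
    moreover have "((\<lambda>t. f (y + hom_scale t ?\<xi>)) has_field_derivative of_nat m * f y) (at 0)"
      using flow[OF y] by (auto intro!: derivative_eq_intros)
    ultimately have "dir_deriv ?\<xi> f (y + hom_scale 0 ?\<xi>) = of_nat m * f y"
      by (rule DERIV_unique)
    then show ?thesis using dir_deriv_hom_scale[OF f y] by simp
  qed
  then show ?thesis using f inv by (simp add: S_W_deg_iff)
qed

section \<open>Isometry properties of the Weyl group\<close>

lemma in_F_iff: "v \<in> F \<longleftrightarrow> I v \<delta> = 0"
  using I_F_delta sub_Lambda_in_F[of v] by auto

lemma weyl_props:
  assumes "w \<in> weyl_group D"
  shows "(\<forall>u v. I (w u) (w v) = I u v) \<and> (\<forall>r\<in>rad_I D. w r = r) \<and> w ` R = R"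
  using assms
proof induction
  case one
  then show ?case by simp
next
  case (gen \<alpha>)
  have nz: "I \<alpha> \<alpha> \<noteq> 0" using R_nonisotropic[OF gen] .
  have "I (reflection I \<alpha> u) (reflection I \<alpha> v) = I u v" for u v
    using nz by (simp add: reflection_def I_simps I_coroot_right I_sym[of \<alpha> v])
  moreover have "reflection I \<alpha> r = r" if "r \<in> rad_I D" for r
    using I_F_rad[OF _ that, of \<alpha>] gen R_subset_F
    by (auto simp: reflection_def I_coroot_right I_sym[of r \<alpha>])
  ultimately show ?case using R_reflection[OF gen] by blast
next
  case (mult g h)
  have "(g \<circ> h) ` R = g ` (h ` R)" by (rule image_comp[symmetric])
  with mult.IH show ?case by simp
next
  case (inverse g)
  have g: "bij g" using weyl_bij[OF inverse.hyps] .
  have s: "g (inv_into UNIV g u) = u" "inv_into UNIV g (g u) = u" for u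
    using g by (simp_all add: bij_is_surj bij_is_inj surj_f_inv_f)
  have "I (inv_into UNIV g u) (inv_into UNIV g v) = I (g (inv_into UNIV g u)) (g (inv_into UNIV g v))" for u v
    using inverse.IH by simp
  then have "I (inv_into UNIV g u) (inv_into UNIV g v) = I u v" for u v
    by (simp only: s)
  moreover have "inv_into UNIV g r = r" if "r \<in> rad_I D" for r
    using inverse.IH s(2)[of r] that by simp
  moreover have "inv_into UNIV g ` R = inv_into UNIV g ` (g ` R)"
    using inverse.IH by simp
  then have "inv_into UNIV g ` R = R"
    by (simp only: image_inv_f_f[OF bij_is_inj[OF g]])
  ultimately show ?case by simp
qed

lemma
  assumes "w \<in> weyl_group D"
  shows weyl_form: "I (w u) (w v) = I u v"
    and weyl_rad: "r \<in> rad_I D \<Longrightarrow> w r = r"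
    and weyl_root: "\<alpha> \<in> R \<Longrightarrow> w \<alpha> \<in> R"
    and weyl_F: "v \<in> F \<Longrightarrow> w v \<in> F"
proof -
  show "I (w u) (w v) = I u v" "r \<in> rad_I D \<Longrightarrow> w r = r" "\<alpha> \<in> R \<Longrightarrow> w \<alpha> \<in> R"
    using weyl_props[OF assms] by auto
  show "w v \<in> F" if "v \<in> F"
  proof -
    have "I (w v) \<delta> = I (w v) (w \<delta>)" using weyl_props[OF assms] delta_in_rad by simp
    also have "\<dots> = I v \<delta>" using weyl_props[OF assms] by simp
    finally show ?thesis using that by (simp add: in_F_iff)
  qed
qed

lemma pull_weyl_dom_Y: "w \<in> weyl_group D \<Longrightarrow> y \<in> Y \<Longrightarrow> pull w y \<in> Y"
  by (simp add: dom_Y_def weyl_linear weyl_rad a_in_rad delta_in_rad)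

text \<open>
  Directions tangent to the fibres of \<open>Y \<longrightarrow> H\<close> modulo the Euler direction; the Weyl group acts on
  them through its finite quotient.
\<close>

definition fib :: "('v \<Rightarrow>\<^sub>L complex) set" where
  "fib = {u. (\<forall>r\<in>rad_I D. blinfun_apply u r = 0) \<and> blinfun_apply u \<Lambda> = 0}"

text \<open>Since w moves Lambda0, the pullback of u may be nonzero there. Subtracting a multiple of
  \<open>E0\<close> restores the value 0 at Lambda0 without changing values on F.\<close>

definition fib_act :: "('v \<Rightarrow> 'v) \<Rightarrow> ('v \<Rightarrow>\<^sub>L complex) \<Rightarrow> ('v \<Rightarrow>\<^sub>L complex)" where
  "fib_act w u = pull w u - hom_scale (blinfun_apply u (w \<Lambda>)) E0"

lemma rad_subset_F: "rad_I D \<subseteq> F"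
  by (auto simp: rad_I_def radical_on_def)

lemma fib_act_F: "w \<in> weyl_group D \<Longrightarrow> v \<in> F \<Longrightarrow> blinfun_apply (fib_act w u) v = blinfun_apply u (w v)"
  by (simp add: fib_act_def blinfun.bilinear_simps weyl_linear)

lemma fib_act_Lambda: "w \<in> weyl_group D \<Longrightarrow> blinfun_apply (fib_act w u) \<Lambda> = 0"
  by (simp add: fib_act_def blinfun.bilinear_simps weyl_linear)

lemma fib_act_fib: "w \<in> weyl_group D \<Longrightarrow> u \<in> fib \<Longrightarrow> fib_act w u \<in> fib"
  using rad_subset_F by (auto simp: fib_def fib_act_F fib_act_Lambda weyl_rad)

lemma fib_eqI:
  assumes "u \<in> fib" "u' \<in> fib" "\<And>v. v \<in> F \<Longrightarrow> blinfun_apply u v = blinfun_apply u' v"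
  shows "u = u'"
  by (rule functional_eqI) (use assms in \<open>auto simp: fib_def\<close>)

text \<open>Precomposition is a right action, hence the reversed order.\<close>

lemma fib_act_comp:
  assumes "w \<in> weyl_group D" "w' \<in> weyl_group D" "u \<in> fib"
  shows "fib_act w (fib_act w' u) = fib_act (w' \<circ> w) u"
  by (rule fib_eqI) (use assms in \<open>auto simp: fib_act_F weyl_F weyl_group.mult intro!: fib_act_fib\<close>)

lemma fib_act_id: "u \<in> fib \<Longrightarrow> fib_act id u = u"
  by (rule fib_eqI) (auto simp: fib_act_F weyl_group.one intro!: fib_act_fib)

lemma fib_act_inv:
  assumes w: "w \<in> weyl_group D" and u: "u \<in> fib"
  shows "fib_act (inv_into UNIV w) (fib_act w u) = u" "fib_act w (fib_act (inv_into UNIV w) u) = u"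
  using weyl_bij[OF w] weyl_group.inverse[OF w] assms
  by (simp_all add: fib_act_comp fib_act_id bij_is_inj bij_is_surj surj_iff[THEN iffD1])

lemma fib_sum: "(\<And>i. i \<in> S \<Longrightarrow> u i \<in> fib) \<Longrightarrow> (\<Sum>i\<in>S. u i) \<in> fib"
  by (simp add: fib_def blinfun.sum_left)

section \<open>Finiteness of the Weyl action modulo the radical\<close>

lemma I_Cauchy_Schwarz:
  assumes "u \<in> F" "v \<in> F" "0 < I v v"
  shows "(I u v)\<^sup>2 \<le> I u u * I v v"
proof -
  let ?t = "I u v / I v v"
  have "0 \<le> I (u - ?t *\<^sub>R v) (u - ?t *\<^sub>R v)"
    using assms subspace_F by (intro I_nonneg subspace_diff subspace_scale)
  also have "\<dots> = I u u - (I u v)\<^sup>2 / I v v"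
    using assms(3) by (simp add: I_simps I_sym[of v u] power2_eq_square field_simps)
  finally show ?thesis using assms(3) by (simp add: field_simps)
qed

text \<open>The two Cartan integers p, q satisfy p q = 4 I(\<alpha>,\<beta>)^2 /
  (I(\<alpha>,\<alpha>) I(\<beta>,\<beta>)), which is at most 4 by Cauchy-Schwarz. They have equal
  sign, so p is 0 or |p| <= p q <= 4.\<close>

lemma cartan_integer_finite:
  assumes "\<alpha> \<in> R" "\<beta> \<in> R"
  shows "I \<alpha> (coroot I \<beta>) \<in> of_int ` {-4..4}"
proof -
  obtain p q where p: "I \<alpha> (coroot I \<beta>) = of_int p" and q: "I \<beta> (coroot I \<alpha>) = of_int q"
    using R_integral assms by (meson Ints_cases)
  have pos: "0 < I \<alpha> \<alpha>" "0 < I \<beta> \<beta>" using R_I_pos assms by auto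
  have pq: "of_int p = 2 * I \<alpha> \<beta> / I \<beta> \<beta>" "of_int q = 2 * I \<alpha> \<beta> / I \<alpha> \<alpha>"
    using p q by (simp_all add: I_coroot_right I_sym)
  have "of_int (p * q) \<le> (4::real)"
    using I_Cauchy_Schwarz[of \<alpha> \<beta>] assms R_subset_F pos
    by (auto simp: pq power2_eq_square field_simps)
  then have "p * q \<le> 4" by linarith
  moreover have "(0 < p \<and> 0 < q) \<or> (p < 0 \<and> q < 0) \<or> p = 0"
  proof -
    consider "0 < I \<alpha> \<beta>" | "I \<alpha> \<beta> < 0" | "I \<alpha> \<beta> = 0" by linarith
    then show ?thesis
    proof cases
      case 1
      then have "0 < real_of_int p" "0 < real_of_int q" unfolding pq using pos by simp_all
      then show ?thesis by simp
    next
      case 2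
      then have "real_of_int p < 0" "real_of_int q < 0" unfolding pq using pos by (simp_all add: divide_neg_pos)
      then show ?thesis by simp
    next
      case 3
      then have "real_of_int p = 0" unfolding pq by simp
      then show ?thesis by simp
    qed
  qed
  ultimately have "p \<in> {-4..4}"
  proof (elim disjE conjE)
    assume a: "p * q \<le> 4" "0 < p" "0 < q"
    then have "p * 1 \<le> p * q" by (intro mult_left_mono) auto
    with a have "p \<le> 4" by linarith
    with a show ?thesis by simp
  next
    assume a: "p * q \<le> 4" "p < 0" "q < 0"
    then have "(-p) * 1 \<le> (-p) * (-q)" by (intro mult_left_mono) auto
    with a have "- p \<le> 4" by (simp only: mult_1_right minus_mult_minus)
    with a show ?thesis by simp
  qed auto
  then show ?thesis unfolding p by blast
qed

text \<open>Pairings with a spanning set determine a coroot modulo the radical, and the coroot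
  determines the root once the lengths are known to agree.\<close>

lemma roots_congruent:
  assumes "\<beta> \<in> R" "\<beta>' \<in> R" and B: "span B = F"
    and eq: "\<And>\<gamma>. \<gamma> \<in> B \<Longrightarrow> I \<gamma> (coroot I \<beta>) = I \<gamma> (coroot I \<beta>')"
  shows "\<beta> - \<beta>' \<in> rad_I D"
proof -
  let ?d = "coroot I \<beta> - coroot I \<beta>'"
  have F: "\<beta> \<in> F" "\<beta>' \<in> F" "coroot I \<beta> \<in> F" "coroot I \<beta>' \<in> F"
    using assms R_subset_F subspace_F by (auto simp: coroot_def subspace_scale)
  have z: "I v ?d = 0" if "v \<in> F" for v
  proof -
    have "subspace {v. I v ?d = 0}" by (simp add: subspace_def I_simps)
    moreover have "B \<subseteq> {v. I v ?d = 0}" using eq by (auto simp: I_simps)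
    ultimately have "span B \<subseteq> {v. I v ?d = 0}" by (rule span_minimal[rotated])
    then show ?thesis using that B by auto
  qed
  \<comment> \<open>The norm of a coroot is 4 / I(\<beta>,\<beta>), so this recovers the length of
    the root.\<close>
  have "I (coroot I \<beta>) (coroot I \<beta>) = I (coroot I \<beta>') (coroot I \<beta>')"
    using z[OF F(3)] z[OF F(4)] I_sym[of "coroot I \<beta>" "coroot I \<beta>'"] by (simp add: I_simps)
  then have len: "I \<beta> \<beta> = I \<beta>' \<beta>'"
    using R_I_pos[OF assms(1)] R_I_pos[OF assms(2)] by (simp add: coroot_def I_simps field_simps)
  have "?d = (2 / I \<beta> \<beta>) *\<^sub>R (\<beta> - \<beta>')"
    by (simp add: coroot_def len algebra_simps)
  then have "I (\<beta> - \<beta>') v = 0" if "v \<in> F" for v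
    using z[OF that] R_I_pos[OF assms(1)] I_sym[of "\<beta> - \<beta>'" v] by (simp add: I_simps)
  then show ?thesis
    using F subspace_F by (simp add: rad_I_def radical_on_def subspace_diff)
qed

text \<open>With B a basis of F made of roots, w is determined modulo the radical by the Cartan
  integers of its images w \<beta> against B. These lie in -4..4, so finitely many classes occur;
  since \<open>fib\<close> kills the radical, elements of one class act alike.\<close>

lemma fib_act_finite:
  obtains W' where "finite W'" "W' \<subseteq> weyl_group D"
    "\<And>w. w \<in> weyl_group D \<Longrightarrow> \<exists>w'\<in>W'. \<forall>u\<in>fib. fib_act w u = fib_act w' u"
proof -
  obtain B where B: "B \<subseteq> R" "independent B" "R \<subseteq> span B"
    by (rule maximal_independent_subset)
  have spanB: "span B = F"
    using B(1,3) span_R by (metis span_mono span_minimal subspace_span subset_antisym)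
  have finB: "finite B" using B(2) by (rule independent_imp_finite)
  define cls where "cls w = restrict (\<lambda>\<beta>. restrict (\<lambda>\<gamma>. I \<gamma> (coroot I (w \<beta>))) B) B" for w :: "'v \<Rightarrow> 'v"
  have "cls ` weyl_group D \<subseteq> B \<rightarrow>\<^sub>E (B \<rightarrow>\<^sub>E of_int ` {-4..4})"
    unfolding cls_def
    by (intro image_subsetI restrict_PiE_iff[THEN iffD2] ballI cartan_integer_finite)
      (use B(1) weyl_root in auto)
  moreover have "finite (B \<rightarrow>\<^sub>E (B \<rightarrow>\<^sub>E (of_int ` {-4..4} :: real set)))"
    using finB by (intro finite_PiE) auto
  ultimately have "finite (cls ` weyl_group D)" by (rule finite_subset)
  then obtain W' where W': "W' \<subseteq> weyl_group D" "finite W'" "cls ` weyl_group D = cls ` W'"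
    using finite_subset_image[of "cls ` weyl_group D" cls "weyl_group D"] by auto
  have "\<exists>w'\<in>W'. \<forall>u\<in>fib. fib_act w u = fib_act w' u" if w: "w \<in> weyl_group D" for w
  proof -
    obtain w' where w': "w' \<in> W'" "cls w = cls w'" using W'(3) w by blast
    have w'W: "w' \<in> weyl_group D" using w' W' by blast
    have cong: "w \<beta> - w' \<beta> \<in> rad_I D" if "\<beta> \<in> B" for \<beta>
    proof (rule roots_congruent[OF _ _ spanB])
      show "w \<beta> \<in> R" "w' \<beta> \<in> R" using that B(1) weyl_root w w'W by auto
      fix \<gamma> assume "\<gamma> \<in> B"
      have "cls w \<beta> \<gamma> = cls w' \<beta> \<gamma>" using w'(2) by simp
      then show "I \<gamma> (coroot I (w \<beta>)) = I \<gamma> (coroot I (w' \<beta>))"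
        using that \<open>\<gamma> \<in> B\<close> by (simp add: cls_def)
    qed
    have "fib_act w u = fib_act w' u" if u: "u \<in> fib" for u
    proof (rule fib_eqI)
      fix v assume v: "v \<in> F"
      let ?S = "{v. blinfun_apply u (w v) = blinfun_apply u (w' v)}"
      have "subspace ?S"
        unfolding subspace_def using weyl_linear[OF w] weyl_linear[OF w'W]
        by (auto simp: linear_add linear_scale linear_0 blinfun.bilinear_simps)
      moreover have "B \<subseteq> ?S"
      proof
        fix \<beta> assume "\<beta> \<in> B"
        then have "blinfun_apply u (w \<beta> - w' \<beta>) = 0" using cong u by (simp add: fib_def)
        then show "\<beta> \<in> ?S" by (simp add: blinfun.bilinear_simps)
      qed
      ultimately have "span B \<subseteq> ?S" by (rule span_minimal[rotated])
      then show "blinfun_apply (fib_act w u) v = blinfun_apply (fib_act w' u) v"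
        using v spanB by (auto simp: fib_act_F w w'W)
    qed (use u w w'W in \<open>auto intro: fib_act_fib\<close>)
    then show ?thesis using w'(1) by blast
  qed
  with W' show thesis by (intro that)
qed

definition fib_orbit :: "('v \<Rightarrow>\<^sub>L complex) \<Rightarrow> ('v \<Rightarrow>\<^sub>L complex) set" where
  "fib_orbit u = (\<lambda>w. fib_act w u) ` weyl_group D"

lemma fib_orbit_finite:
  assumes "u \<in> fib"
  shows "finite (fib_orbit u)"
proof -
  obtain W' where W': "finite W'" "W' \<subseteq> weyl_group D"
    "\<And>w. w \<in> weyl_group D \<Longrightarrow> \<exists>w'\<in>W'. \<forall>u\<in>fib. fib_act w u = fib_act w' u"
    by (rule fib_act_finite) (rule that)
  have "fib_orbit u \<subseteq> (\<lambda>w. fib_act w u) ` W'"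
    unfolding fib_orbit_def using W'(3) assms by (force simp: image_iff)
  then show ?thesis using W'(1) by (simp add: finite_subset)
qed

lemma fib_orbit_subset: "u \<in> fib \<Longrightarrow> fib_orbit u \<subseteq> fib"
  by (auto simp: fib_orbit_def fib_act_fib)

text \<open>An injective self-map of a finite set is onto. This permits reindexing sums and products
  over the orbit by w.\<close>

lemma fib_orbit_bij:
  assumes u: "u \<in> fib" and w: "w \<in> weyl_group D"
  shows "bij_betw (fib_act w) (fib_orbit u) (fib_orbit u)"
proof -
  have "inj_on (fib_act w) (fib_orbit u)"
    by (rule inj_on_inverseI[of _ "fib_act (inv_into UNIV w)"])
      (use fib_act_inv(1)[OF w] fib_orbit_subset[OF u] in auto)
  moreover have "fib_act w ` fib_orbit u \<subseteq> fib_orbit u"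
    by (auto simp: fib_orbit_def fib_act_comp u w weyl_group.mult)
  ultimately show ?thesis
    using endo_inj_surj[OF fib_orbit_finite[OF u]] by (auto simp: bij_betw_def)
qed

lemma fib_act_linear: "linear (fib_act w)" if "w \<in> weyl_group D"
  by (rule linearI)
    (use weyl_linear[OF that] in \<open>auto intro!: blinfun_eqI simp: fib_act_def blinfun.bilinear_simps algebra_simps\<close>)

text \<open>The finite Weyl group has no invariant vectors besides 0, since each reflection negates its root.\<close>

lemma fib_orbit_sum:
  assumes u: "u \<in> fib"
  shows "(\<Sum>v\<in>fib_orbit u. v) = 0"
proof (rule fib_eqI)
  let ?\<sigma> = "\<Sum>v\<in>fib_orbit u. v"
  show \<sigma>: "?\<sigma> \<in> fib"
    using fib_orbit_subset[OF u] by (intro fib_sum) auto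
  show "0 \<in> fib" by (simp add: fib_def)
  have root: "blinfun_apply ?\<sigma> \<alpha> = 0" if \<alpha>: "\<alpha> \<in> R" for \<alpha>
  proof -
    let ?w = "reflection I \<alpha>"
    have w: "?w \<in> weyl_group D" by (rule weyl_group.gen[OF \<alpha>])
    have "fib_act ?w ?\<sigma> = (\<Sum>v\<in>fib_orbit u. fib_act ?w v)"
      by (rule linear_sum[OF fib_act_linear[OF w]])
    also have "\<dots> = ?\<sigma>"
      by (rule sum.reindex_bij_betw[OF fib_orbit_bij[OF u w]])
    finally have "blinfun_apply ?\<sigma> \<alpha> = blinfun_apply ?\<sigma> (?w \<alpha>)"
      using fib_act_F[OF w, of \<alpha> ?\<sigma>] \<alpha> R_subset_F by auto
    also have "?w \<alpha> = - \<alpha>"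
      using R_nonisotropic[OF \<alpha>] by (simp add: reflection_def I_coroot_right algebra_simps scaleR_2)
    finally have "blinfun_apply ?\<sigma> \<alpha> = - blinfun_apply ?\<sigma> \<alpha>"
      by (simp only: blinfun.minus_right)
    then show ?thesis by simp
  qed
  fix v assume "v \<in> F"
  moreover have "linear (blinfun_apply ?\<sigma>)"
    by (rule bounded_linear.linear[OF blinfun.bounded_linear_right])
  ultimately show "blinfun_apply ?\<sigma> v = blinfun_apply 0 v"
    using linear_eq_0_on_span[of "blinfun_apply ?\<sigma>" R v] root span_R by auto
qed

text \<open>
  The analogue of the theorem of the square: \<open>f\<close> translated by \<open>v\<close> is invariant up to a factor
  that is exponential in \<open>v\<close>, and these factors cancel over an orbit of the finite Weyl group.
\<close>

lemma orbit_product_invariant: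
  assumes f: "f \<in> S_W_deg D d" and u: "u \<in> fib" and nz: "euler_scale \<noteq> 0"
  shows "(\<lambda>y. \<Prod>v\<in>fib_orbit u. f (y + v)) \<in> S_W_deg D (d * card (fib_orbit u))"
proof (rule S_W_degI)
  have fib0: "blinfun_apply v a = 0" "blinfun_apply v \<delta> = 0" if "v \<in> fib_orbit u" for v
    using fib_orbit_subset[OF u] that a_in_rad delta_in_rad by (auto simp: fib_def)
  have Yv: "y + v \<in> Y" if "y \<in> Y" "v \<in> fib_orbit u" for y v
    using dom_Y_add[OF that(1)] fib0[OF that(2)] by simp
  show "(\<lambda>y. \<Prod>v\<in>fib_orbit u. f (y + v)) \<in> holo_Y D"
    by (intro holo_Y_prod fib_orbit_finite[OF u] holo_Y_translate S_W_deg_holo[OF f] fib0)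
  {
    fix s y assume y: "y \<in> Y"
    have "f (y + hom_scale (s * euler_scale) E0 + v) = exp (of_nat d * s) * f (y + v)"
      if "v \<in> fib_orbit u" for v
      using S_W_deg_flow[OF f Yv[OF y that], of s] by (simp add: add_ac)
    then show "(\<Prod>v\<in>fib_orbit u. f (y + hom_scale (s * euler_scale) E0 + v)) =
        exp (of_nat (d * card (fib_orbit u)) * s) * (\<Prod>v\<in>fib_orbit u. f (y + v))"
      by (simp add: prod.distrib exp_of_nat_mult[symmetric] mult_ac)
  }
  fix w y assume w: "w \<in> weyl_group D" and y: "y \<in> Y"
  let ?e = "\<lambda>v. exp (of_nat d * (- blinfun_apply v (w \<Lambda>) / euler_scale))"
  have "f (pull w y + fib_act w v) = ?e v * f (y + v)" if v: "v \<in> fib_orbit u" for v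
  proof -
    \<comment> \<open>The flow time that reproduces the multiple of \<open>E0\<close> subtracted in
      \<open>fib_act\<close>; the flow equation then turns this shift into a scalar.\<close>
    let ?s = "- blinfun_apply v (w \<Lambda>) / euler_scale"
    have "pull w y + fib_act w v = pull w (y + v) + hom_scale (?s * euler_scale) E0"
      using nz by (intro blinfun_eqI)
        (simp add: fib_act_def weyl_linear[OF w] blinfun.bilinear_simps)
    then have "f (pull w y + fib_act w v) = ?e v * f (pull w (y + v))"
      by (simp only: S_W_deg_flow[OF f pull_weyl_dom_Y[OF w Yv[OF y v]]])
    also have "f (pull w (y + v)) = f (y + v)"
      using f w Yv[OF y v] by (simp add: S_W_deg_iff)
    finally show ?thesis .
  qed
  then have "(\<Prod>v\<in>fib_orbit u. f (pull w y + fib_act w v)) =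
      (\<Prod>v\<in>fib_orbit u. ?e v) * (\<Prod>v\<in>fib_orbit u. f (y + v))"
    by (simp add: prod.distrib)
  also have "(\<Prod>v\<in>fib_orbit u. ?e v) =
      exp (of_nat d * (- blinfun_apply (\<Sum>v\<in>fib_orbit u. v) (w \<Lambda>) / euler_scale))"
    using fib_orbit_finite[OF u]
    by (simp add: exp_sum[symmetric] blinfun.sum_left sum_distrib_left sum_divide_distrib sum_negf)
  also have "\<dots> = 1"
    by (simp add: fib_orbit_sum[OF u])
  also have "(\<Prod>v\<in>fib_orbit u. f (pull w y + fib_act w v)) = (\<Prod>v\<in>fib_orbit u. f (pull w y + v))"
    by (rule prod.reindex_bij_betw[OF fib_orbit_bij[OF u w]])
  finally show "(\<Prod>v\<in>fib_orbit u. f (pull w y + v)) = (\<Prod>v\<in>fib_orbit u. f (y + v))"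
    by simp
qed

section \<open>Generic translations\<close>

lemma fib_hom_scale: "u \<in> fib \<Longrightarrow> hom_scale c u \<in> fib"
  by (simp add: fib_def)

lemma fib_add: "u \<in> fib \<Longrightarrow> v \<in> fib \<Longrightarrow> u + v \<in> fib"
  by (simp add: fib_def blinfun.bilinear_simps)

text \<open>Induction over W': u works for the elements treated so far, and \<open>?u'\<close> works
  for the new w. On the line from u to \<open>?u'\<close> every condition is an entire function of
  t. The one for w is nonzero at t = 1, so its zeros are isolated; the others are nonzero at t = 0
  and stay so nearby. A small nonzero t serves all.\<close>

lemma generic_direction:
  assumes f: "f \<in> holo_Y D" and y0: "y0 \<in> Y" and v0: "v0 \<in> fib" "f (y0 + v0) \<noteq> 0"
    and "finite W'" "W' \<subseteq> weyl_group D"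
  shows "\<exists>u\<in>fib. \<forall>w\<in>W'. f (y0 + fib_act w u) \<noteq> 0"
  using assms(5,6)
proof (induction W' rule: finite_induct)
  case empty
  then show ?case using v0 by auto
next
  case (insert w W')
  then obtain u where u: "u \<in> fib" "\<And>w. w \<in> W' \<Longrightarrow> f (y0 + fib_act w u) \<noteq> 0" by auto
  have w: "w \<in> weyl_group D" using insert by simp
  \<comment> \<open>Chosen so that w carries it to v0, where f is known to be nonzero.\<close>
  let ?u' = "fib_act (inv_into UNIV w) v0"
  have u': "?u' \<in> fib" "fib_act w ?u' = v0"
    using fib_act_inv(2)[OF w v0(1)] fib_act_fib weyl_group.inverse[OF w] v0(1) by auto
  have diff: "?u' - u \<in> fib" using u(1) u'(1) by (simp add: fib_def blinfun.bilinear_simps)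
  define p where "p t = u + hom_scale t (?u' - u)" for t
  have p_fib: "p t \<in> fib" for t unfolding p_def by (intro fib_add fib_hom_scale u(1) diff)
  have hol: "(\<lambda>t. f (y0 + fib_act w' (p t))) holomorphic_on UNIV" if w': "w' \<in> weyl_group D" for w'
  proof -
    let ?y = "y0 + fib_act w' u" and ?\<xi> = "fib_act w' (?u' - u)"
    have eq: "y0 + fib_act w' (p t) = ?y + hom_scale t ?\<xi>" for t
      by (rule blinfun_eqI)
        (simp add: p_def fib_act_def weyl_linear[OF w'] blinfun.bilinear_simps algebra_simps)
    have \<xi>: "blinfun_apply (fib_act w' v) r = 0" if "v \<in> fib" "r \<in> {a, \<delta>}" for v r
      using fib_act_fib[OF w' that(1)] that(2) a_in_rad delta_in_rad by (auto simp: fib_def)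
    have "?y + hom_scale t ?\<xi> \<in> Y" for t
      by (intro dom_Y_add y0) (use \<xi> u(1) diff in auto)
    then have "((\<lambda>t. f (?y + hom_scale t ?\<xi>)) has_field_derivative
        dir_deriv ?\<xi> f (?y + hom_scale t ?\<xi>)) (at t)" for t
      by (intro line_has_field_derivative f) (use \<xi> diff in auto)
    then show ?thesis
      unfolding eq holomorphic_on_def field_differentiable_def by auto
  qed
  have "p 1 = ?u'" "p 0 = u" by (simp_all add: p_def)
  then have "\<forall>\<^sub>F t in at 0. f (y0 + fib_act w (p t)) \<noteq> 0 \<and> t \<in> UNIV"
    using u'(2) v0(2) by (intro non_zero_neighbour_alt[OF hol[OF w], of _ 1]) auto
  moreover have "\<forall>\<^sub>F t in at 0. \<forall>w'\<in>W'. f (y0 + fib_act w' (p t)) \<noteq> 0"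
  proof (rule eventually_ball_finite[OF \<open>finite W'\<close>], rule ballI)
    fix w' assume w': "w' \<in> W'"
    have "isCont (\<lambda>t. f (y0 + fib_act w' (p t))) 0"
      using holomorphic_on_imp_continuous_on[OF hol[of w']] w' insert.prems
      by (simp add: continuous_on_eq_continuous_at subset_iff)
    then show "\<forall>\<^sub>F t in at 0. f (y0 + fib_act w' (p t)) \<noteq> 0"
      using u(2)[OF w'] \<open>p 0 = u\<close> by (intro tendsto_imp_eventually_ne) (auto simp: isCont_def)
  qed
  ultimately have "\<forall>\<^sub>F t in at 0. \<forall>w'\<in>insert w W'. f (y0 + fib_act w' (p t)) \<noteq> 0"
    by eventually_elim auto
  then obtain t where "\<forall>w'\<in>insert w W'. f (y0 + fib_act w' (p t)) \<noteq> 0"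
    using eventually_happens[of _ "at (0::complex)"] by auto
  then show ?case using p_fib by blast
qed

text \<open>With scale 0 the Euler equation would read d f = 0. This spares any evaluation of
  \<open>even_scale\<close> and \<open>m_max\<close>.\<close>

lemma euler_scale_nonzero:
  assumes f: "f \<in> S_W_deg D d" "0 < d" and y: "y \<in> Y" "f y \<noteq> 0"
  shows "euler_scale \<noteq> 0"
  using f y by (auto simp: S_W_deg_iff)

text \<open>Points of one fibre differ by an element of \<open>fib\<close> and a multiple of
  \<open>E0\<close>, which the flow absorbs. A translation that is generic for finitely many
  representatives of W is generic for its whole orbit, so the orbit product is nonzero at
  y0.\<close>

lemma exists_invariant_nonvanishing:
  assumes f: "f \<in> S_W_deg D d" "0 < d" and y: "y \<in> Y" "f y \<noteq> 0"
    and y0: "y0 \<in> Y" "blinfun_apply y0 \<delta> = blinfun_apply y \<delta>"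
  shows "\<exists>m>0. \<exists>P\<in>S_W_deg D m. P y0 \<noteq> 0"
proof -
  have nz: "euler_scale \<noteq> 0" using euler_scale_nonzero[OF f y] .
  \<comment> \<open>Accounts for the value of y - y0 at Lambda0, so that the remainder
    \<open>v0\<close> lies in \<open>fib\<close>.\<close>
  let ?s = "blinfun_apply (y - y0) \<Lambda> / euler_scale"
  define v0 where "v0 = y - y0 - hom_scale (?s * euler_scale) E0"
  have rad0: "blinfun_apply (y - y0) r = 0" if "r \<in> rad_I D" for r
    using that
  proof (rule rad_cases)
    fix p q assume "r = p *\<^sub>R a + q *\<^sub>R \<delta>"
    then show ?thesis using y(1) y0 by (simp add: blinfun.bilinear_simps dom_Y_def)
  qed
  have v0: "v0 \<in> fib"
    using rad0 rad_subset_F nz by (auto simp: fib_def v0_def blinfun.bilinear_simps)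
  have "y0 + v0 + hom_scale (?s * euler_scale) E0 = y" by (simp add: v0_def)
  moreover have "y0 + v0 \<in> Y"
    using v0 a_in_rad delta_in_rad by (intro dom_Y_add y0(1)) (auto simp: fib_def)
  ultimately have fv0: "f (y0 + v0) \<noteq> 0"
    using S_W_deg_flow[OF f(1), of "y0 + v0" ?s] y(2) by auto
  obtain W' where W': "finite W'" "W' \<subseteq> weyl_group D"
    "\<And>w. w \<in> weyl_group D \<Longrightarrow> \<exists>w'\<in>W'. \<forall>u\<in>fib. fib_act w u = fib_act w' u"
    by (rule fib_act_finite) (rule that)
  obtain u where u: "u \<in> fib" "\<forall>w\<in>W'. f (y0 + fib_act w u) \<noteq> 0"
    using generic_direction[OF S_W_deg_holo[OF f(1)] y0(1) v0 fv0 W'(1,2)] by blast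
  have "f (y0 + v) \<noteq> 0" if v: "v \<in> fib_orbit u" for v
  proof -
    obtain w where "w \<in> weyl_group D" "v = fib_act w u" using v unfolding fib_orbit_def by blast
    then show ?thesis using W'(3)[of w] u by auto
  qed
  then have "(\<Prod>v\<in>fib_orbit u. f (y0 + v)) \<noteq> 0"
    using fib_orbit_finite[OF u(1)] by simp
  moreover have "0 < card (fib_orbit u)"
    using fib_orbit_finite[OF u(1)] weyl_group.one by (auto simp: card_gt_0_iff fib_orbit_def)
  ultimately show ?thesis
    using orbit_product_invariant[OF f(1) u(1) nz] f(2) by (metis nat_0_less_mult_iff)
qed

end

section \<open>Flat coordinates and the form on invariants\<close>

locale flat_coordinates = elliptic D
  for D :: "'v::euclidean_space ell_data" +
  fixes L :: "'v set" and z :: "nat \<Rightarrow> 'v cpx"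
  assumes L_subspace: "subspace L"
    and L_sum: "direct_sum_is UNIV L (rad_I D)"
    and z_span: "cpx.span (z ` {..nn D}) = complexify {u + r *\<^sub>R vec_delta D | u r. u \<in> L}"
    and z_0: "z 0 = cpx_scale (1 / (- 2 * pi * \<i>)) (of_vec (vec_delta D))"
    and z_mid: "\<And>\<alpha>. \<alpha> \<in> {1..nn D - 1} \<Longrightarrow> z \<alpha> \<in> complexify (L \<inter> space_F D)"
    and z_n: "z (nn D) \<in> complexify (perp_L D L)"
    and z_form: "\<And>\<alpha> \<beta>. \<alpha> \<le> nn D \<Longrightarrow> \<beta> \<le> nn D \<Longrightarrow>
      cpx_form (form D) (z \<alpha>) (z \<beta>) = (if \<alpha> + \<beta> = nn D then 1 else 0)"
begin

text \<open>I~(z^\<alpha>, z^\<beta>) is 1 exactly for \<alpha> + \<beta> = n, so pairing with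
  z^(n-\<gamma>) is the field dual to z^\<gamma>.\<close>

definition coord :: "nat \<Rightarrow> 'v \<Rightarrow>\<^sub>L complex" where
  "coord \<gamma> = form_hom (z (n - \<gamma>))"

lemma coord_a [simp]: "blinfun_apply (coord \<gamma>) a = 0"
  by (simp add: coord_def)

lemma n_ge_2: "2 \<le> n"
  using marked by (simp add: nn_def marked_elliptic_def)

lemma cpx_eval_coord: "\<gamma> \<le> n \<Longrightarrow> \<beta> \<le> n \<Longrightarrow> cpx_eval (z \<gamma>) (coord \<beta>) = (if \<gamma> = \<beta> then 1 else 0)"
  by (auto simp: coord_def cpx_eval_form_hom z_form)

text \<open>F~ is the sum of L and the lines of \<open>a\<close> and \<delta>, and the z^\<gamma>
  span the complexification of L + R \<delta>.\<close>

lemma tangent_eq_0: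
  assumes a: "blinfun_apply \<xi> a = 0" and z: "\<And>\<gamma>. \<gamma> \<le> n \<Longrightarrow> cpx_eval (z \<gamma>) \<xi> = 0"
  shows "\<xi> = 0"
proof (rule blinfun_eqI)
  fix v
  have "v \<in> {u + r | u r. u \<in> L \<and> r \<in> rad_I D}"
    using L_sum unfolding direct_sum_is_def by blast
  then obtain u r where v: "v = u + r" "u \<in> L" "r \<in> rad_I D"
    by blast
  obtain p q where r: "r = p *\<^sub>R a + q *\<^sub>R \<delta>" using v(3) by (rule rad_cases)
  have "0 \<in> L" using L_subspace by (rule subspace_0)
  then have "\<exists>u r. 0 = u + r *\<^sub>R \<delta> \<and> u \<in> L" by (intro exI[of _ 0]) simp
  then have "of_vec (u + q *\<^sub>R \<delta>) \<in> complexify {u + r *\<^sub>R vec_delta D | u r. u \<in> L}"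
    using v(2) by (auto simp: of_vec_def complexify_def)
  then have "cpx_eval (of_vec (u + q *\<^sub>R \<delta>)) \<xi> = 0"
    unfolding z_span[symmetric] by (rule cpx_eval_zero_on_span) (use z in auto)
  then show "blinfun_apply \<xi> v = blinfun_apply 0 v"
    using a by (simp add: v r blinfun.bilinear_simps)
qed

lemma tangent_expand:
  assumes "blinfun_apply \<xi> a = 0"
  shows "\<xi> = (\<Sum>\<gamma>\<le>n. hom_scale (cpx_eval (z \<gamma>) \<xi>) (coord \<gamma>))"
proof -
  have "\<xi> - (\<Sum>\<gamma>\<le>n. hom_scale (cpx_eval (z \<gamma>) \<xi>) (coord \<gamma>)) = 0"
    by (rule tangent_eq_0)
      (use assms in \<open>simp_all add: blinfun.bilinear_simps cpx_eval_diff cpx_eval_sum cpx_eval_coord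
        blinfun.sum_left if_distrib cong: if_cong\<close>)
  then show ?thesis by simp
qed

lemma coord_vec_eq:
  assumes "\<beta> \<le> n"
  shows "coord_vec D z \<beta> = coord \<beta>"
  unfolding coord_vec_def
proof (rule the_equality)
  show "blinfun_apply (coord \<beta>) a = 0 \<and> (\<forall>\<gamma>\<le>n. cpx_eval (z \<gamma>) (coord \<beta>) = (if \<gamma> = \<beta> then 1 else 0))"
    using assms by (simp add: cpx_eval_coord)
next
  fix \<xi> assume "blinfun_apply \<xi> a = 0 \<and> (\<forall>\<gamma>\<le>n. cpx_eval (z \<gamma>) \<xi> = (if \<gamma> = \<beta> then 1 else 0))"
  then have "\<xi> - coord \<beta> = 0"
    using assms by (intro tangent_eq_0) (auto simp: cpx_eval_diff cpx_eval_coord blinfun.bilinear_simps)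
  then show "\<xi> = coord \<beta>" by simp
qed

lemma partial_z_eq: "\<gamma> \<le> n \<Longrightarrow> partial_z D z \<gamma> f y = dir_deriv (coord \<gamma>) f y"
  by (simp add: partial_z_def coord_vec_eq)

lemma dir_deriv_expand:
  assumes "f \<in> holo_Y D" "y \<in> Y" "blinfun_apply \<xi> a = 0"
  shows "dir_deriv \<xi> f y = (\<Sum>\<gamma>\<le>n. cpx_eval (z \<gamma>) \<xi> * dir_deriv (coord \<gamma>) f y)"
proof -
  have "dir_deriv \<xi> f y = dir_deriv (\<Sum>\<gamma>\<le>n. hom_scale (cpx_eval (z \<gamma>) \<xi>) (coord \<gamma>)) f y"
    by (subst tangent_expand[OF assms(3)]) (rule refl)
  also have "\<dots> = (\<Sum>\<gamma>\<le>n. cpx_eval (z \<gamma>) \<xi> * dir_deriv (coord \<gamma>) f y)"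
    using assms by (simp add: dir_deriv_sum dir_deriv_hom_scale)
  finally show ?thesis .
qed

text \<open>The functional I~(., v) is expanded in the frame \<open>coord\<close>. No condition on
  u, v is imposed, because \<open>a\<close> pairs to 0 on both sides.\<close>

lemma Parseval:
  "cpx_form I u v = (\<Sum>\<gamma>\<le>n. cpx_form I u (z (n - \<gamma>)) * cpx_form I v (z \<gamma>))"
proof -
  have "form_hom v = (\<Sum>\<gamma>\<le>n. hom_scale (cpx_form I (z \<gamma>) v) (coord \<gamma>))"
    using tangent_expand[of "form_hom v"] by (simp add: cpx_eval_form_hom)
  then have "cpx_eval u (form_hom v) = (\<Sum>\<gamma>\<le>n. cpx_form I (z \<gamma>) v * cpx_eval u (coord \<gamma>))"
    by (simp add: cpx_eval_sum)
  then show ?thesis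
    by (simp add: cpx_eval_form_hom coord_def cpx_form_sym[of v] mult.commute)
qed

subsection \<open>Holomorphy of partial derivatives\<close>

text \<open>The sum of the (partial f / partial z^\<gamma>) dz^\<gamma>, extended to all directions.
  As a bounded linear map varying with y it fits \<open>leibniz_rule\<close>.\<close>

definition differential :: "(('v \<Rightarrow>\<^sub>L complex) \<Rightarrow> complex) \<Rightarrow> ('v \<Rightarrow>\<^sub>L complex) \<Rightarrow> ('v \<Rightarrow>\<^sub>L complex) \<Rightarrow>\<^sub>L complex" where
  "differential f y =
     (\<Sum>\<gamma>\<le>n. blinfun_compose (blinfun_mult_right (dir_deriv (coord \<gamma>) f y)) (Blinfun (cpx_eval (z \<gamma>))))"

lemma bounded_linear_cpx_eval: "bounded_linear (cpx_eval w)"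
  unfolding cpx_eval_def
  by (intro bounded_linear_add bounded_linear_const_mult blinfun.bounded_linear_left)

lemma differential_apply:
  "blinfun_apply (differential f y) \<eta> = (\<Sum>\<gamma>\<le>n. dir_deriv (coord \<gamma>) f y * cpx_eval (z \<gamma>) \<eta>)"
  by (simp add: differential_def blinfun.sum_left bounded_linear_Blinfun_apply[OF bounded_linear_cpx_eval])

text \<open>Only increments y' - y between points of Y enter the limit, and these kill
  \<open>a\<close>, so \<open>f'\<close> may be replaced by \<open>differential\<close>.\<close>

lemma has_derivative_differential:
  assumes f: "f \<in> holo_Y D" and y: "y \<in> Y"
  shows "(f has_derivative blinfun_apply (differential f y)) (at y within Y)"
proof -
  obtain f' where f': "(f has_derivative f') (at y within Y)"
    "\<forall>\<xi>. blinfun_apply \<xi> a = 0 \<longrightarrow> f' \<xi> = dir_deriv \<xi> f y"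
    using holo_Y_has_derivative[OF f y] by blast
  have eq: "f' (y' - y) = blinfun_apply (differential f y) (y' - y)" if "y' \<in> Y" for y'
  proof -
    have "blinfun_apply (y' - y) a = 0"
      using that y by (simp add: dom_Y_def blinfun.bilinear_simps)
    then show ?thesis
      using f'(2) dir_deriv_expand[OF f y] by (simp add: differential_apply mult.commute)
  qed
  have "((\<lambda>y'. (1 / norm (y' - y)) *\<^sub>R (f y' - (f y + f' (y' - y)))) \<longlongrightarrow> 0) (at y within Y)"
    using f'(1) by (simp add: has_derivative_within)
  then have "((\<lambda>y'. (1 / norm (y' - y)) *\<^sub>R (f y' - (f y + blinfun_apply (differential f y) (y' - y)))) \<longlongrightarrow> 0) (at y within Y)"
    by (rule Lim_transform_eventually) (auto simp: eventually_at_filter eq)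
  then show ?thesis
    by (simp add: has_derivative_within blinfun.bounded_linear_right)
qed

lemma holo_Y_continuous: "f \<in> holo_Y D \<Longrightarrow> continuous_on Y f"
  using has_derivative_differential has_derivative_continuous
  by (blast intro: continuous_on_eq_continuous_within[THEN iffD2])

text \<open>With the circle parametrised by s, its velocity is 2 pi i times the path itself. This
  cancels 1 / (2 pi i) and one of the two powers in the denominator.\<close>

lemma Cauchy_dir_deriv:
  assumes f: "f \<in> holo_Y D" and \<xi>: "blinfun_apply \<xi> a = 0" and r: "0 < r"
    and Yt: "\<And>t. t \<in> cball 0 r \<Longrightarrow> y + hom_scale t \<xi> \<in> Y"
  shows "dir_deriv \<xi> f y = integral {0..1} (\<lambda>s. f (y + hom_scale (circlepath 0 r s) \<xi>) / circlepath 0 r s)"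
proof -
  let ?g = "\<lambda>t. f (y + hom_scale t \<xi>)"
  have dg: "(?g has_field_derivative dir_deriv \<xi> f (y + hom_scale t \<xi>)) (at t)" if "t \<in> cball 0 r" for t
    by (rule line_has_field_derivative[OF f \<xi> Yt[OF that]])
  have "continuous_on (cball 0 r) ?g"
    using dg by (intro DERIV_continuous_on) (auto intro: has_field_derivative_at_within)
  moreover have "?g holomorphic_on ball 0 r"
    unfolding holomorphic_on_def field_differentiable_def
    using has_field_derivative_at_within[OF dg] by (meson ball_subset_cball subsetD)
  ultimately have "(?g has_field_derivative
      1 / (2 * complex_of_real pi * \<i>) * contour_integral (circlepath 0 r) (\<lambda>u. ?g u / (u - 0)\<^sup>2)) (at 0)"
    using r by (intro Cauchy_derivative_integral_circlepath(2)) auto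
  moreover have "(?g has_field_derivative dir_deriv \<xi> f y) (at 0)"
    using dg[of 0] r by simp
  ultimately have "dir_deriv \<xi> f y =
      1 / (2 * complex_of_real pi * \<i>) * contour_integral (circlepath 0 r) (\<lambda>u. ?g u / (u - 0)\<^sup>2)"
    by (rule DERIV_unique[rotated])
  also have "\<dots> = integral {0..1} (\<lambda>s. 1 / (2 * complex_of_real pi * \<i>) *
      (?g (circlepath 0 r s) / (circlepath 0 r s)\<^sup>2 * (2 * pi * \<i> * r * exp (2 * of_real pi * \<i> * s))))"
    by (simp only: contour_integral_integral vector_derivative_circlepath integral_mult_right diff_zero)
  also have "\<dots> = integral {0..1} (\<lambda>s. ?g (circlepath 0 r s) / circlepath 0 r s)"
    using r by (intro integral_cong) (simp add: circlepath field_simps power2_eq_square)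
  finally show ?thesis .
qed

text \<open>
  The slab \<open>{y. \<epsilon> < Re (y \<delta>)}\<close> lies far enough inside \<open>Y\<close> for Cauchy's formula with a fixed radius.
\<close>

definition slab :: "real \<Rightarrow> ('v \<Rightarrow>\<^sub>L complex) set" where
  "slab e = {y \<in> Y. e < Re (blinfun_apply y \<delta>)}"

lemma slab_radius:
  assumes "0 < e"
  obtains r where "0 < r" "\<And>y t. y \<in> slab e \<Longrightarrow> blinfun_apply \<xi> a = 0 \<Longrightarrow> t \<in> cball (0 :: complex) r \<Longrightarrow> y + hom_scale t \<xi> \<in> Y"
proof -
  \<comment> \<open>The summand 1 keeps the quotient meaningful when the direction kills
    \<delta>.\<close>
  let ?r = "e / (norm (blinfun_apply \<xi> \<delta>) + 1)"
  have N: "0 < norm (blinfun_apply \<xi> \<delta>) + 1" by (simp add: add_nonneg_pos)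
  have r: "0 < ?r" using assms N by simp
  show thesis
  proof (rule that[OF r])
    fix y :: "'v \<Rightarrow>\<^sub>L complex" and t :: complex assume y: "y \<in> slab e" and \<xi>: "blinfun_apply \<xi> a = 0" and t: "t \<in> cball 0 ?r"
    have "norm (t * blinfun_apply \<xi> \<delta>) \<le> ?r * norm (blinfun_apply \<xi> \<delta>)"
      unfolding norm_mult by (rule mult_right_mono) (use t in simp_all)
    also have "\<dots> \<le> e"
      using assms N by (simp add: pos_divide_le_eq algebra_simps)
    finally have "- e \<le> Re (t * blinfun_apply \<xi> \<delta>)"
      using abs_Re_le_cmod[of "t * blinfun_apply \<xi> \<delta>"] by linarith
    then show "y + hom_scale t \<xi> \<in> Y"
      using y \<xi> by (simp add: slab_def dom_Y_def blinfun.bilinear_simps)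
  qed
qed

lemma at_within_slab:
  assumes "y \<in> slab e"
  shows "at y within slab e = at y within Y"
proof (rule at_within_nhd)
  show "y \<in> {y. e < Re (blinfun_apply y \<delta>)}" using assms by (simp add: slab_def)
  show "open {y :: 'v \<Rightarrow>\<^sub>L complex. e < Re (blinfun_apply y \<delta>)}"
    by (intro open_Collect_less continuous_intros)
qed (auto simp: slab_def)

lemma in_slab: "y \<in> Y \<Longrightarrow> y \<in> slab (Re (blinfun_apply y \<delta>) / 2)"
  by (simp add: slab_def dom_Y_def)

text \<open>Convexity of the parameter set is a hypothesis of \<open>leibniz_rule\<close>.\<close>

lemma convex_slab: "convex (slab e)"
proof -
  have *: "{c. blinfun_apply c a = k} = (\<lambda>y. blinfun_apply y a) -` {k}"
     "{c. k' < Re (blinfun_apply c \<delta>)} = (\<lambda>y. Re (blinfun_apply y \<delta>)) -` {k'<..}" for k and k'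
    by auto
  have "slab e = {y. blinfun_apply y a = - 2 * pi * \<i>} \<inter> {y. 0 < Re (blinfun_apply y \<delta>)} \<inter> {y. e < Re (blinfun_apply y \<delta>)}"
    by (auto simp: slab_def dom_Y_def)
  moreover have "linear (\<lambda>y :: 'v \<Rightarrow>\<^sub>L complex. Re (blinfun_apply y \<delta>))"
    "linear (\<lambda>y :: 'v \<Rightarrow>\<^sub>L complex. blinfun_apply y a)"
    by (auto intro!: linearI simp: blinfun.bilinear_simps)
  ultimately show ?thesis
    unfolding * by (auto intro!: convex_Int convex_linear_vimage)
qed

lemma continuous_on_circle_translate:
  assumes "continuous_on Y h" "0 < r" "\<And>y t. y \<in> U \<Longrightarrow> t \<in> cball 0 r \<Longrightarrow> y + hom_scale t \<xi> \<in> Y"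
  shows "continuous_on (U \<times> cbox 0 1) (\<lambda>(y, s). h (y + hom_scale (circlepath 0 r s) \<xi>))"
proof -
  have c: "circlepath 0 r s \<in> cball 0 r" for s
    using assms(2) by (simp add: circlepath norm_mult)
  have "continuous_on (U \<times> cbox 0 1) (\<lambda>p. fst p + hom_scale (circlepath 0 r (snd p)) \<xi>)"
    unfolding circlepath
    by (intro continuous_intros bounded_linear.continuous_on[OF bounded_linear_hom_scale_left])
  then have "continuous_on (U \<times> cbox 0 1) (\<lambda>p. h (fst p + hom_scale (circlepath 0 r (snd p)) \<xi>))"
    by (rule continuous_on_compose2[OF assms(1)]) (use assms(3) c in auto)
  then show ?thesis by (simp add: case_prod_unfold)
qed

lemma circlepath_nonzero: "0 < r \<Longrightarrow> circlepath 0 r s \<noteq> 0"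
  by (simp add: circlepath)

lemma continuous_on_inverse_circlepath: "0 < r \<Longrightarrow> continuous_on A (\<lambda>p. inverse (circlepath 0 r (snd p)))"
  by (intro continuous_on_inverse ballI circlepath_nonzero) (auto simp: circlepath intro!: continuous_intros)

text \<open>Continuity comes before differentiability, since \<open>leibniz_rule\<close> requires a
  jointly continuous derivative of the integrand.\<close>

lemma continuous_on_dir_deriv:
  assumes f: "f \<in> holo_Y D" and \<xi>: "blinfun_apply \<xi> a = 0"
  shows "continuous_on Y (dir_deriv \<xi> f)"
  unfolding continuous_on_eq_continuous_within
proof
  fix y0 assume y0: "y0 \<in> Y"
  define e where "e = Re (blinfun_apply y0 \<delta>) / 2"
  have y0s: "y0 \<in> slab e" and e: "0 < e" using y0 in_slab by (auto simp: e_def dom_Y_def)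
  obtain r where r: "0 < r"
    "\<And>y t. y \<in> slab e \<Longrightarrow> blinfun_apply \<xi> a = 0 \<Longrightarrow> t \<in> cball (0 :: complex) r \<Longrightarrow> y + hom_scale t \<xi> \<in> Y"
    by (rule slab_radius[OF e]) (rule that)
  have "continuous_on (slab e \<times> cbox 0 1) (\<lambda>(y, s). f (y + hom_scale (circlepath 0 r s) \<xi>) / circlepath 0 r s)"
    using continuous_on_mult[OF continuous_on_circle_translate[OF holo_Y_continuous[OF f] r(1) r(2)[OF _ \<xi>]]
        continuous_on_inverse_circlepath[OF r(1)]]
    by (simp add: case_prod_unfold divide_inverse)
  then have "continuous_on (slab e) (\<lambda>y. integral (cbox 0 1) (\<lambda>s. f (y + hom_scale (circlepath 0 r s) \<xi>) / circlepath 0 r s))"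
    by (rule integral_continuous_on_param)
  then have "continuous_on (slab e) (dir_deriv \<xi> f)"
    by (rule continuous_on_eq) (use Cauchy_dir_deriv[OF f \<xi> r(1) r(2)[OF _ \<xi>]] in auto)
  then show "continuous (at y0 within Y) (dir_deriv \<xi> f)"
    using y0s by (simp add: continuous_on_eq_continuous_within flip: at_within_slab[OF y0s])
qed

lemma continuous_on_differential:
  assumes f: "f \<in> holo_Y D"
  shows "continuous_on Y (differential f)"
  unfolding differential_def
  by (intro continuous_intros bounded_linear.continuous_on[OF bounded_linear_blinfun_mult_right]
      continuous_on_dir_deriv f) simp_all

text \<open>Near y0 Cauchy's formula writes the derivative as an integral of translates of f over a
  circle of fixed radius. It is differentiated under the integral, and complex linearity passes
  through the integral.\<close>

lemma holo_Y_dir_deriv: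
  assumes f: "f \<in> holo_Y D" and \<xi>: "blinfun_apply \<xi> a = 0"
  shows "dir_deriv \<xi> f \<in> holo_Y D"
  unfolding holo_Y_def
proof (intro CollectI ballI)
  fix y0 assume y0: "y0 \<in> Y"
  define e where "e = Re (blinfun_apply y0 \<delta>) / 2"
  have y0s: "y0 \<in> slab e" and e: "0 < e" using y0 in_slab by (auto simp: e_def dom_Y_def)
  obtain r where r: "0 < r"
    "\<And>y t. y \<in> slab e \<Longrightarrow> blinfun_apply \<xi> a = 0 \<Longrightarrow> t \<in> cball (0 :: complex) r \<Longrightarrow> y + hom_scale t \<xi> \<in> Y"
    by (rule slab_radius[OF e]) (rule that)
  let ?c = "circlepath 0 r" and ?p = "\<lambda>y s. y + hom_scale (circlepath 0 r s) \<xi>"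
  have c: "?c s \<in> cball 0 r" for s
    using r(1) by (simp add: circlepath norm_mult)
  have pY: "?p y s \<in> Y" if "y \<in> slab e" for y s using r(2)[OF that \<xi> c] .
  \<comment> \<open>The derivative in y of the Cauchy integrand.\<close>
  define A where "A y s = blinfun_compose (blinfun_mult_right (inverse (?c s))) (differential f (?p y s))" for y s
  have A_apply: "blinfun_apply (A y s) \<eta> =
      inverse (?c s) * (\<Sum>\<gamma>\<le>n. dir_deriv (coord \<gamma>) f (?p y s) * cpx_eval (z \<gamma>) \<eta>)" for y s \<eta>
    by (simp add: A_def differential_apply)
  have contA: "continuous_on (slab e \<times> cbox 0 1) (\<lambda>(y, s). A y s)"
    unfolding A_def case_prod_unfold
    using continuous_on_circle_translate[OF continuous_on_differential[OF f] r(1) r(2)[OF _ \<xi>]]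
    by (intro continuous_intros bounded_linear.continuous_on[OF bounded_linear_blinfun_mult_right]
       continuous_on_inverse_circlepath[OF r(1)]) (simp add: case_prod_unfold)
  have cont: "continuous_on (slab e \<times> cbox 0 1) (\<lambda>(y, s). inverse (?c s) * f (?p y s))"
    using continuous_on_mult[OF continuous_on_inverse_circlepath[OF r(1)]
        continuous_on_circle_translate[OF holo_Y_continuous[OF f] r(1) r(2)[OF _ \<xi>]]]
    by (simp add: case_prod_unfold)
  have "((\<lambda>y. integral (cbox 0 1) (\<lambda>s. inverse (?c s) * f (?p y s))) has_derivative
      blinfun_apply (integral (cbox 0 1) (A y0))) (at y0 within slab e)"
  proof (rule leibniz_rule[OF _ _ contA y0s convex_slab])
    fix y s assume y: "y \<in> slab e"
    have "(f has_derivative blinfun_apply (differential f (?p y s))) (at (?p y s) within (\<lambda>y. ?p y s) ` slab e)"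
      by (rule has_derivative_subset[OF has_derivative_differential[OF f pY[OF y]]]) (use pY in auto)
    then have "((\<lambda>y. f (?p y s)) has_derivative (\<lambda>h. blinfun_apply (differential f (?p y s)) h)) (at y within slab e)"
      by (rule has_derivative_in_compose[rotated]) (auto intro!: derivative_eq_intros)
    then show "((\<lambda>y. inverse (?c s) * f (?p y s)) has_derivative blinfun_apply (A y s)) (at y within slab e)"
      unfolding A_def by (auto intro!: derivative_eq_intros)
  next
    fix y assume "y \<in> slab e"
    then have "continuous_on (cbox 0 1) (\<lambda>s. case (y, s) of (y, s) \<Rightarrow> inverse (?c s) * f (?p y s))"
      by (intro continuous_on_compose2[OF cont] continuous_intros) auto
    then have "continuous_on (cbox 0 1) (\<lambda>s. inverse (?c s) * f (?p y s))"
      by (simp only: prod.case)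
    then show "(\<lambda>s. inverse (?c s) * f (?p y s)) integrable_on cbox 0 1"
      by (rule integrable_continuous)
  qed
  moreover have "dir_deriv \<xi> f y = integral (cbox 0 1) (\<lambda>s. inverse (?c s) * f (?p y s))"
    if "y \<in> slab e" for y
    using Cauchy_dir_deriv[OF f \<xi> r(1) r(2)[OF that \<xi>]]
    by (simp add: divide_inverse mult.commute)
  ultimately have d: "(dir_deriv \<xi> f has_derivative blinfun_apply (integral (cbox 0 1) (A y0))) (at y0 within slab e)"
    by (rule has_derivative_transform[OF y0s, rotated])
  have "continuous_on (cbox 0 1) (\<lambda>s. case (y0, s) of (y, s) \<Rightarrow> A y s)"
    by (intro continuous_on_compose2[OF contA] continuous_intros) (use y0s in auto)
  then have "continuous_on (cbox 0 1) (A y0)"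
    by (simp only: prod.case)
  then have int: "A y0 integrable_on cbox 0 1" by (rule integrable_continuous)
  have "blinfun_apply (integral (cbox 0 1) (A y0)) (hom_scale c \<eta>) =
      c * blinfun_apply (integral (cbox 0 1) (A y0)) \<eta>" for c \<eta>
  proof -
    have "blinfun_apply (A y0 s) (hom_scale c \<eta>) = c * blinfun_apply (A y0 s) \<eta>" for s
      by (simp add: A_apply sum_distrib_left mult_ac)
    then show ?thesis
      by (simp only: blinfun_apply_integral[OF int] integral_mult_right)
  qed
  with d show "\<exists>f'. (dir_deriv \<xi> f has_derivative f') (at y0 within Y) \<and>
      (\<forall>c \<eta>. blinfun_apply \<eta> a = 0 \<longrightarrow> f' (hom_scale c \<eta>) = c * f' \<eta>)"
    unfolding at_within_slab[OF y0s] by blast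
qed

end

context elliptic
begin

section \<open>Derivatives of functions with a transformation rule\<close>

lemma dir_deriv_cmult:
  assumes f: "f \<in> holo_Y D" and y: "y \<in> Y" and \<xi>: "blinfun_apply \<xi> a = 0"
  shows "dir_deriv \<xi> (\<lambda>y. c * f y) y = c * dir_deriv \<xi> f y"
proof -
  have "((\<lambda>t. f (y + hom_scale t \<xi>)) has_field_derivative dir_deriv \<xi> f (y + hom_scale 0 \<xi>)) (at 0)"
    by (rule line_has_field_derivative) (use assms in auto)
  then have "((\<lambda>t. c * f (y + hom_scale t \<xi>)) has_field_derivative c * dir_deriv \<xi> f y) (at 0)"
    by (auto intro!: derivative_eq_intros)
  then show ?thesis unfolding dir_deriv_def[of \<xi> "\<lambda>y. c * f y"] by (rule DERIV_imp_deriv)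
qed

lemma dir_deriv_pull:
  assumes f: "f \<in> holo_Y D" and y: "y \<in> Y" and \<xi>: "blinfun_apply \<xi> a = 0" and w: "linear w"
    and inv: "\<And>y. y \<in> Y \<Longrightarrow> f (pull w y) = c * f y"
  shows "dir_deriv (pull w \<xi>) f (pull w y) = c * dir_deriv \<xi> f y"
proof -
  have "dir_deriv (pull w \<xi>) f (pull w y) = dir_deriv \<xi> (\<lambda>y. f (pull w y)) y"
    by (simp add: dir_deriv_def pull_add[OF w] pull_hom_scale[OF w])
  also have "\<dots> = dir_deriv \<xi> (\<lambda>y. c * f y) y"
    by (rule dir_deriv_cong[OF inv y \<xi>])
  finally show ?thesis by (simp add: dir_deriv_cmult[OF f y \<xi>])
qed

lemma dir_deriv_translate:
  assumes f: "f \<in> holo_Y D" and y: "y \<in> Y" and \<xi>: "blinfun_apply \<xi> a = 0"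
    and inv: "\<And>y. y \<in> Y \<Longrightarrow> f (y + v) = c * f y"
  shows "dir_deriv \<xi> f (y + v) = c * dir_deriv \<xi> f y"
proof -
  have "dir_deriv \<xi> f (y + v) = dir_deriv \<xi> (\<lambda>y. f (y + v)) y"
    by (simp add: dir_deriv_def add_ac)
  also have "\<dots> = dir_deriv \<xi> (\<lambda>y. c * f y) y"
    by (rule dir_deriv_cong[OF inv y \<xi>])
  finally show ?thesis by (simp add: dir_deriv_cmult[OF f y \<xi>])
qed

lemma weyl_cpx_form:
  "w \<in> weyl_group D \<Longrightarrow> cpx_form I (cpx_map w u) (cpx_map w v) = cpx_form I u v"
  by (simp add: cpx_form_def cpx_map_def weyl_form)

subsection \<open>Derivation with respect to a basic invariant\<close>

text \<open>The formal derivative in x^j, indexed by the exponent vector after differentiation;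
  hence the shift by 1.\<close>

definition coeff_deriv ::
    "nat \<Rightarrow> ((nat \<Rightarrow> nat) \<Rightarrow> ('v \<Rightarrow> complex) \<Rightarrow> complex) \<Rightarrow> (nat \<Rightarrow> nat) \<Rightarrow> ('v \<Rightarrow> complex) \<Rightarrow> complex" where
  "coeff_deriv j c k \<phi> = of_nat (k j + 1) * c (k(j := k j + 1)) \<phi>"

lemma poly_supp_coeff_deriv:
  "poly_supp D (coeff_deriv j c) \<subseteq> (\<lambda>k. k(j := k j - 1)) ` {k \<in> poly_supp D c. 0 < k j}"
proof
  fix m assume "m \<in> poly_supp D (coeff_deriv j c)"
  then have "m(j := m j + 1) \<in> poly_supp D c"
    by (auto simp: poly_supp_def coeff_deriv_def)
  then show "m \<in> (\<lambda>k. k(j := k j - 1)) ` {k \<in> poly_supp D c. 0 < k j}"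
    by (intro image_eqI[of _ _ "m(j := m j + 1)"]) auto
qed

lemma coeff_deriv_poly_H:
  assumes c: "c \<in> poly_H D" and j: "j \<in> {1..n}"
  shows "coeff_deriv j c \<in> poly_H D"
proof -
  have "coeff_deriv j c k \<in> holo_H D" for k
    unfolding coeff_deriv_def using c by (intro holo_H_cmult) (simp add: poly_H_def)
  moreover have "finite (poly_supp D (coeff_deriv j c))"
    by (rule finite_subset[OF poly_supp_coeff_deriv]) (use c in \<open>simp add: poly_H_def\<close>)
  moreover have "k i = 0" if "k \<in> poly_supp D (coeff_deriv j c)" "i \<notin> {1..n}" for k i
    using subsetD[OF poly_supp_coeff_deriv that(1)] c j that(2) by (auto simp: poly_H_def)
  ultimately show ?thesis unfolding poly_H_def by blast
qed

text \<open>\<open>partial_x\<close> chooses its coefficients; uniqueness identifies them with c on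
  H, which also fixes the support.\<close>

lemma partial_x_eval:
  assumes x: "basic_invariants D x" and c: "c \<in> poly_H D" and j: "j \<in> {1..n}"
    and f: "\<And>y. y \<in> Y \<Longrightarrow> f y = eval_poly D x c y" and y: "y \<in> Y"
  shows "partial_x D x j f y = eval_poly D x (coeff_deriv j c) y"
proof -
  define c' where "c' = (SOME c. c \<in> poly_H D \<and> (\<forall>y\<in>Y. f y = eval_poly D x c y))"
  have "c' \<in> poly_H D \<and> (\<forall>y\<in>Y. f y = eval_poly D x c' y)"
    unfolding c'_def by (rule someI[of _ c]) (use c f in auto)
  then have eq: "c' k \<phi> = c k \<phi>" if "\<phi> \<in> dom_H D" for k \<phi>
    using poly_unique[OF x _ c _ that] f by auto
  then have supp: "poly_supp D c' = poly_supp D c" by (simp add: poly_supp_def)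
  \<comment> \<open>Lowering k j is injective only where k j > 0, as subtraction is truncated; the
    other terms carry the factor k j = 0.\<close>
  let ?S = "{k \<in> poly_supp D c. 0 < k j}" and ?d = "\<lambda>k::nat \<Rightarrow> nat. k(j := k j - 1)"
  have fin: "finite (poly_supp D c)" using c by (simp add: poly_H_def)
  have inj: "inj_on ?d ?S"
  proof (rule inj_on_inverseI[of _ "\<lambda>k. k(j := k j + 1)"])
    fix k assume "k \<in> ?S"
    then show "(?d k)(j := ?d k j + 1) = k" by auto
  qed
  have mon: "x_monom x (?d k) y = (\<Prod>i=1..n. x i y ^ (k i - (if i = j then 1 else 0)))" for k
    unfolding x_monom_def by (rule prod.cong) auto
  have "partial_x D x j f y = (\<Sum>k\<in>poly_supp D c. of_nat (k j) * c k (\<pi> y) * x_monom x (?d k) y)"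
    unfolding partial_x_def c'_def[symmetric] Let_def supp mon
    using eq[OF proj_H_dom[OF y]] by simp
  also have "\<dots> = (\<Sum>k\<in>?S. of_nat (k j) * c k (\<pi> y) * x_monom x (?d k) y)"
    by (rule sum.mono_neutral_right) (use fin in auto)
  also have "\<dots> = (\<Sum>k\<in>?S. coeff_deriv j c (?d k) (\<pi> y) * x_monom x (?d k) y)"
    by (rule sum.cong) (auto simp: coeff_deriv_def)
  also have "\<dots> = (\<Sum>m\<in>?d ` ?S. coeff_deriv j c m (\<pi> y) * x_monom x m y)"
    using sum.reindex[OF inj, of "\<lambda>m. coeff_deriv j c m (\<pi> y) * x_monom x m y"] by (simp only: o_def)
  also have "\<dots> = eval_poly D x (coeff_deriv j c) y"
    by (rule eval_poly_superset[symmetric, OF _ poly_supp_coeff_deriv y]) (use fin in auto)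
  finally show ?thesis .
qed

lemma weight_upd: "j \<in> {1..n} \<Longrightarrow> weight (k(j := k j + r)) = weight k + r * deg D j"
proof -
  assume "j \<in> {1..n}"
  then have "weight k' = k' j * deg D j + (\<Sum>i\<in>{1..n}-{j}. k' i * deg D i)" for k'
    unfolding weight_def by (simp add: sum.remove)
  then show ?thesis by (simp add: algebra_simps)
qed

lemma weight_eq_0:
  assumes pos: "\<And>i. i \<in> {1..n} \<Longrightarrow> 0 < deg D i"
    and "weight k = 0" and k0: "\<And>i. i \<notin> {1..n} \<Longrightarrow> k i = 0"
  shows "k = (\<lambda>_. 0)"
proof
  fix i
  have "\<forall>i\<in>{1..n}. k i * deg D i = 0"
    using \<open>weight k = 0\<close> unfolding weight_def by (subst (asm) sum_eq_0_iff) auto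
  then show "k i = 0"
    using pos[of i] k0[of i] by (cases "i \<in> {1..n}") auto
qed

text \<open>Two derivatives in x^j lower the weight 2 d_j to 0, so only the constant term survives.
  The factor 2 comes from differentiating (x^j)^2 twice.\<close>

lemma partial_x_twice:
  assumes x: "basic_invariants D x" and c: "c \<in> poly_H D" and j: "j \<in> {1..n}"
    and pos: "\<And>i. i \<in> {1..n} \<Longrightarrow> 0 < deg D i"
    and f: "\<And>y. y \<in> Y \<Longrightarrow> f y = eval_poly D x c y"
    and w: "\<And>k. k \<in> poly_supp D c \<Longrightarrow> weight k = 2 * deg D j" and y: "y \<in> Y"
  shows "partial_x D x j (partial_x D x j f) y = 2 * c ((\<lambda>_. 0)(j := 2)) (\<pi> y)"
proof -
  let ?c = "coeff_deriv j (coeff_deriv j c)"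
  have c1: "coeff_deriv j c \<in> poly_H D" by (rule coeff_deriv_poly_H[OF c j])
  have c2: "?c \<in> poly_H D" by (rule coeff_deriv_poly_H[OF c1 j])
  have "partial_x D x j (partial_x D x j f) y = eval_poly D x ?c y"
    by (rule partial_x_eval[OF x c1 j partial_x_eval[OF x c j f] y])
  moreover have "poly_supp D ?c \<subseteq> {\<lambda>_. 0}"
  proof
    fix k assume k: "k \<in> poly_supp D ?c"
    then have "k(j := k j + 2) \<in> poly_supp D c"
      by (auto simp: poly_supp_def coeff_deriv_def)
    then have "weight k = 0" using w weight_upd[OF j, of k 2] by simp
    moreover have "k i = 0" if "i \<notin> {1..n}" for i
      using k c2 that by (auto simp: poly_H_def)
    ultimately show "k \<in> {\<lambda>_. 0}" using weight_eq_0[OF pos] by blast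
  qed
  then have "eval_poly D x ?c y = ?c (\<lambda>_. 0) (\<pi> y)"
    by (subst eval_poly_superset[of "{\<lambda>_. 0}"]) (use y in \<open>auto simp: x_monom_def\<close>)
  moreover have "?c (\<lambda>_. 0) (\<pi> y) = 2 * c ((\<lambda>_. 0)(j := 2)) (\<pi> y)"
    by (simp add: coeff_deriv_def numeral_2_eq_2)
  ultimately show ?thesis by simp
qed

text \<open>Where the other x^i vanish only powers of x^j remain, and the weight selects the power
  r.\<close>

lemma eval_poly_single:
  assumes c: "c \<in> poly_H D" and j: "j \<in> {1..n}" and pos: "0 < deg D j"
    and w: "\<And>k. k \<in> poly_supp D c \<Longrightarrow> weight k = r * deg D j" and y: "y \<in> Y"
    and x: "\<And>i. i \<in> {1..n} - {j} \<Longrightarrow> x i y = 0"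
  shows "eval_poly D x c y = c ((\<lambda>_. 0)(j := r)) (\<pi> y) * x j y ^ r"
proof -
  let ?e = "(\<lambda>_. 0)(j := r)"
  \<comment> \<open>\<open>?e\<close> is adjoined because it may lie outside the support.\<close>
  have zero: "c k (\<pi> y) * x_monom x k y = 0" if k: "k \<in> insert ?e (poly_supp D c) - {?e}" for k
  proof (cases "\<exists>i\<in>{1..n} - {j}. k i \<noteq> 0")
    case True
    then show ?thesis using x by (auto simp: x_monom_def)
  next
    case False
    then have k0: "k i = 0" if "i \<noteq> j" for i
      using that k c by (cases "i \<in> {1..n}") (auto simp: poly_H_def)
    have "k = (\<lambda>_. 0)(j := 0 + k j)" using k0 by auto
    then have "weight k = k j * deg D j"
      using weight_upd[OF j, of "\<lambda>_. 0" "k j"] by (simp add: weight_def)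
    then have "k j = r" using w[of k] k pos by auto
    then have "k = ?e" using k0 by auto
    with k show ?thesis by simp
  qed
  have "finite (poly_supp D c)" using c by (simp add: poly_H_def)
  then have "eval_poly D x c y = (\<Sum>k\<in>insert ?e (poly_supp D c). c k (\<pi> y) * x_monom x k y)"
    using y by (intro eval_poly_superset) auto
  then have "eval_poly D x c y = c ?e (\<pi> y) * x_monom x ?e y +
      (\<Sum>k\<in>insert ?e (poly_supp D c) - {?e}. c k (\<pi> y) * x_monom x k y)"
    using \<open>finite (poly_supp D c)\<close> by (subst (asm) sum.remove[of _ ?e]) auto
  moreover have "(\<Sum>k\<in>insert ?e (poly_supp D c) - {?e}. c k (\<pi> y) * x_monom x k y) = 0"
    by (rule sum.neutral) (use zero in blast)
  ultimately have "eval_poly D x c y = c ?e (\<pi> y) * x_monom x ?e y"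
    by simp
  moreover have "x_monom x ?e y = x j y ^ r"
    using j by (simp add: x_monom_def if_distrib[of "\<lambda>e. _ ^ e"] prod.delta cong: if_cong)
  ultimately show ?thesis by simp
qed

subsection \<open>Degrees in codimension one\<close>

text \<open>The sign of \<open>m_max\<close> is extracted from d_(n-1) < d_n. If it were 0, division
  by 0 would give d_n = 0; if it were negative, the previous exponent divided by it would be at
  least 1, so that d_(n-1) >= d_n.\<close>

lemma deg_codimension_one:
  assumes cod: "codimension_one D"
  shows deg_n: "deg D n = dn D" "0 < dn D"
    and deg_mono: "1 \<le> i \<Longrightarrow> i \<le> k \<Longrightarrow> k \<le> n \<Longrightarrow> deg D i \<le> deg D k"
proof -
  let ?e = "exponent D"
  have rk: "1 \<le> rk D" "n = rk D + 1"
    using marked by (auto simp: marked_elliptic_def nn_def)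
  have lt: "deg D (rk D) < deg D n"
    using cod by (simp add: codimension_one_def nn_def)
  have mono: "?e i \<le> ?e k" if "i \<le> k" "k \<le> rk D" for i k
    unfolding exponent_def using that by (intro sorted_nth_mono) auto
  have degn: "deg D n = nat \<lfloor>m_max D * dn D / m_max D\<rfloor>"
    by (simp add: deg_def rk(2) m_max_def)
  have nz: "m_max D \<noteq> 0"
    using lt by (auto simp: degn)
  then show n: "deg D n = dn D" by (simp add: degn)
  then show "0 < dn D" using lt by simp
  have pos: "0 < m_max D"
  proof (rule ccontr)
    assume "\<not> ?thesis"
    then have neg: "m_max D < 0" using nz by simp
    have "?e (rk D - 1) \<le> m_max D" using mono by (simp add: m_max_def)
    then have "1 \<le> ?e (rk D - 1) / m_max D" using neg by (simp add: neg_le_divide_eq)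
    then have "real (dn D) \<le> ?e (rk D - 1) / m_max D * real (dn D)"
      using mult_right_mono[of 1 "?e (rk D - 1) / m_max D" "real (dn D)"] by simp
    then have "int (dn D) \<le> \<lfloor>?e (rk D - 1) * dn D / m_max D\<rfloor>"
      by (simp add: le_floor_iff)
    then have "dn D \<le> deg D (rk D)"
      using rk by (simp add: deg_def le_nat_iff)
    then show False using lt n by simp
  qed
  show "deg D i \<le> deg D k" if "1 \<le> i" "i \<le> k" "k \<le> n"
  proof -
    have "?e (i - 1) * dn D / m_max D \<le> ?e (k - 1) * dn D / m_max D"
      using mono[of "i - 1" "k - 1"] that rk pos by (intro divide_right_mono mult_right_mono) auto
    then show ?thesis using that by (simp add: deg_def nat_mono floor_mono)
  qed
qed

end

section \<open>The form I_W(df, df) as an invariant\<close>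

context flat_coordinates
begin

definition gradient_norm :: "(('v \<Rightarrow>\<^sub>L complex) \<Rightarrow> complex) \<Rightarrow> ('v \<Rightarrow>\<^sub>L complex) \<Rightarrow> complex" where
  "gradient_norm f y = (\<Sum>\<gamma>\<le>n. dir_deriv (coord \<gamma>) f y * dir_deriv (coord (n - \<gamma>)) f y)"

lemma sum_z_form:
  "(\<Sum>\<beta>\<le>n. \<Sum>\<beta>'\<le>n. p \<beta> * p \<beta>' * cpx_form I (z \<beta>) (z \<beta>')) = (\<Sum>\<beta>\<le>n. p \<beta> * p (n - \<beta>) :: complex)"
proof (rule sum.cong[OF refl])
  fix \<beta> assume \<beta>: "\<beta> \<in> {..n}"
  have "(\<Sum>\<beta>'\<le>n. p \<beta> * p \<beta>' * cpx_form I (z \<beta>) (z \<beta>')) = (\<Sum>\<beta>'\<le>n. if \<beta>' = n - \<beta> then p \<beta> * p \<beta>' else 0)"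
    using \<beta> by (intro sum.cong) (auto simp: z_form)
  then show "(\<Sum>\<beta>'\<le>n. p \<beta> * p \<beta>' * cpx_form I (z \<beta>) (z \<beta>')) = p \<beta> * p (n - \<beta>)"
    by simp
qed

lemma form_W_eq: "form_W D z x \<alpha> \<alpha> y = gradient_norm (x \<alpha>) y"
  unfolding form_W_def gradient_norm_def sum_z_form[symmetric, of "\<lambda>\<gamma>. dir_deriv (coord \<gamma>) (x \<alpha>) y"]
  by (intro sum.cong refl) (simp add: partial_z_eq)

text \<open>The partial derivatives of f at y arise from those at \<open>pull w y\<close> through
  the matrix \<open>?M\<close>. By \<open>Parseval\<close> the contraction of two copies of it is
  I~(w z, w z'), and w is an isometry.\<close>

lemma gradient_norm_weyl:
  assumes f: "f \<in> S_W_deg D m" and w: "w \<in> weyl_group D" and y: "y \<in> Y"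
  shows "gradient_norm f (pull w y) = gradient_norm f y"
proof -
  note hol = S_W_deg_holo[OF f]
  let ?y = "pull w y" and ?M = "\<lambda>\<beta> \<gamma>. cpx_form I (cpx_map w (z \<beta>)) (z (n - \<gamma>))"
  let ?p = "\<lambda>\<beta>. dir_deriv (coord \<beta>) f (pull w y)"
  have lin: "linear w" and y': "?y \<in> Y" using weyl_linear[OF w] pull_weyl_dom_Y[OF w y] by auto
  have inv: "f (pull w y) = 1 * f y" if "y \<in> Y" for y
    using f w that by (simp add: S_W_deg_iff)
  have dd: "dir_deriv (coord \<gamma>) f y = (\<Sum>\<beta>\<le>n. ?M \<beta> \<gamma> * ?p \<beta>)" for \<gamma>
  proof -
    have "dir_deriv (coord \<gamma>) f y = dir_deriv (pull w (coord \<gamma>)) f ?y"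
      using dir_deriv_pull[OF hol y _ lin inv, of "coord \<gamma>"] by simp
    also have "\<dots> = (\<Sum>\<beta>\<le>n. cpx_eval (z \<beta>) (pull w (coord \<gamma>)) * ?p \<beta>)"
      by (rule dir_deriv_expand[OF hol y']) (use lin weyl_rad[OF w a_in_rad] in simp)
    also have "\<dots> = (\<Sum>\<beta>\<le>n. ?M \<beta> \<gamma> * ?p \<beta>)"
      by (simp add: cpx_eval_pull[OF lin] coord_def cpx_eval_form_hom)
    finally show ?thesis .
  qed
  have "gradient_norm f y = (\<Sum>\<gamma>\<le>n. (\<Sum>\<beta>\<le>n. ?M \<beta> \<gamma> * ?p \<beta>) * (\<Sum>\<beta>'\<le>n. ?M \<beta>' (n - \<gamma>) * ?p \<beta>'))"
    by (simp add: gradient_norm_def dd)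
  also have "\<dots> = (\<Sum>\<gamma>\<le>n. \<Sum>\<beta>\<le>n. \<Sum>\<beta>'\<le>n. ?p \<beta> * ?p \<beta>' * (?M \<beta> \<gamma> * ?M \<beta>' (n - \<gamma>)))"
    unfolding sum_product by (intro sum.cong refl) (simp only: mult_ac)
  also have "\<dots> = (\<Sum>\<beta>\<le>n. \<Sum>\<beta>'\<le>n. \<Sum>\<gamma>\<le>n. ?p \<beta> * ?p \<beta>' * (?M \<beta> \<gamma> * ?M \<beta>' (n - \<gamma>)))"
    by (subst sum.swap, rule sum.cong[OF refl], rule sum.swap)
  also have "\<dots> = (\<Sum>\<beta>\<le>n. \<Sum>\<beta>'\<le>n. ?p \<beta> * ?p \<beta>' * cpx_form I (z \<beta>) (z \<beta>'))"
  proof (intro sum.cong refl)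
    fix \<beta> \<beta>'
    have "(\<Sum>\<gamma>\<le>n. ?M \<beta> \<gamma> * ?M \<beta>' (n - \<gamma>)) = cpx_form I (cpx_map w (z \<beta>)) (cpx_map w (z \<beta>'))"
      by (rule trans[OF _ Parseval[symmetric]]) (intro sum.cong, auto)
    then show "(\<Sum>\<gamma>\<le>n. ?p \<beta> * ?p \<beta>' * (?M \<beta> \<gamma> * ?M \<beta>' (n - \<gamma>))) = ?p \<beta> * ?p \<beta>' * cpx_form I (z \<beta>) (z \<beta>')"
      by (simp add: weyl_cpx_form[OF w] flip: sum_distrib_left)
  qed
  also have "\<dots> = gradient_norm f ?y"
    unfolding sum_z_form gradient_norm_def ..
  finally show ?thesis by simp
qed

text \<open>The fields \<open>coord\<close> are constant, so each partial derivative scales along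
  the flow as f does; products of two double the degree.\<close>

lemma gradient_norm_invariant:
  assumes f: "f \<in> S_W_deg D m"
  shows "gradient_norm f \<in> S_W_deg D (2 * m)"
proof (rule S_W_degI)
  note hol = S_W_deg_holo[OF f]
  show "gradient_norm f \<in> holo_Y D"
    unfolding gradient_norm_def
    by (intro holo_Y_sum holo_Y_mult holo_Y_dir_deriv hol) simp_all
  show "gradient_norm f (pull w y) = gradient_norm f y" if "w \<in> weyl_group D" "y \<in> Y" for w y
    using gradient_norm_weyl[OF f that] .
  fix s y assume y: "y \<in> Y"
  have "dir_deriv (coord \<gamma>) f (y + hom_scale (s * euler_scale) E0) = exp (of_nat m * s) * dir_deriv (coord \<gamma>) f y" for \<gamma>
    by (rule dir_deriv_translate[OF hol y]) (use S_W_deg_flow[OF f] in auto)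
  moreover have "exp (of_nat (2 * m) * s) = exp (of_nat m * s) * exp (of_nat m * s)"
    unfolding exp_add[symmetric] by (simp add: algebra_simps)
  ultimately show "gradient_norm f (y + hom_scale (s * euler_scale) E0) = exp (of_nat (2 * m) * s) * gradient_norm f y"
    by (simp add: gradient_norm_def sum_distrib_left mult_ac)
qed

end

section \<open>Restriction to the fixed locus of \<open>g\<close>\<close>

context elliptic
begin

text \<open>The triplet supplies eigenvalues for some set of basic invariants. As g fixes the
  radical and hence F(H), comparing weights transfers the rule to every homogeneous invariant, in
  particular to another basic set.\<close>

lemma eigen_invariant:
  assumes x: "basic_invariants D x"
    and eig: "\<And>\<alpha> y. \<alpha> \<in> {1..n} \<Longrightarrow> y \<in> Y \<Longrightarrow> x \<alpha> (pull g y) = \<zeta> ^ deg D \<alpha> * x \<alpha> y"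
    and g: "linear g" "\<And>r. r \<in> rad_I D \<Longrightarrow> g r = r"
    and f: "f \<in> S_W_deg D m" and y: "y \<in> Y"
  shows "f (pull g y) = \<zeta> ^ m * f y"
proof -
  have y': "pull g y \<in> Y" using y g a_in_rad delta_in_rad by (simp add: dom_Y_def)
  have \<pi>: "\<pi> (pull g y) = \<pi> y" by (rule proj_H_cong) (simp add: g)
  obtain c where c: "c \<in> poly_H D" "\<And>y. y \<in> Y \<Longrightarrow> f y = eval_poly D x c y"
    "\<And>k. k \<in> poly_supp D c \<Longrightarrow> weight k = m"
    by (rule basic_invariants_expand[OF x f]) (rule that)
  have mon: "x_monom x k (pull g y) = \<zeta> ^ weight k * x_monom x k y" for k
  proof -
    have "x_monom x k (pull g y) = (\<Prod>i=1..n. \<zeta> ^ (k i * deg D i) * x i y ^ k i)"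
      unfolding x_monom_def
      by (rule prod.cong[OF refl]) (simp add: eig[OF _ y] power_mult_distrib power_mult[symmetric] mult.commute)
    then show ?thesis by (simp add: prod.distrib x_monom_def weight_def power_sum)
  qed
  have "f (pull g y) = (\<Sum>k\<in>poly_supp D c. c k (\<pi> y) * (\<zeta> ^ m * x_monom x k y))"
    unfolding c(2)[OF y'] eval_poly_monom \<pi> mon using c(3) by (intro sum.cong) auto
  also have "\<dots> = \<zeta> ^ m * f y"
    unfolding c(2)[OF y] eval_poly_monom by (simp add: sum_distrib_left mult_ac)
  finally show ?thesis .
qed

lemma form_hom_cpx_scale: "form_hom (cpx_scale c w) = hom_scale c (form_hom w)"
  by (rule blinfun_eqI) (simp add: form_hom_apply cpx_scale_def I_simps complex_eq_iff)

end

locale admissible = flat_coordinates D L z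
  for D :: "'v::euclidean_space ell_data" and L z +
  fixes g :: "'v \<Rightarrow> 'v" and \<zeta> :: complex and x :: "nat \<Rightarrow> ('v \<Rightarrow>\<^sub>L complex) \<Rightarrow> complex"
  assumes codim: "codimension_one D"
    and triplet: "admissible_triplet D g \<zeta> L"
    and z_eigen: "\<And>\<alpha>. \<alpha> \<le> nn D \<Longrightarrow> cpx_map g (z \<alpha>) = cpx_scale (\<zeta> ^ deg D \<alpha>) (z \<alpha>)"
    and x_basic: "basic_invariants D x"
begin

lemma g_linear: "linear g" and g_rad: "r \<in> rad_I D \<Longrightarrow> g r = r" and g_L: "g ` L = L"
  and zeta_root: "primitive_root (dn D) \<zeta>"
  using triplet by (auto simp: admissible_triplet_def orth_group_def)

lemma invariant_pull_g:
  assumes "f \<in> S_W_deg D m" "y \<in> Y"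
  shows "f (pull g y) = \<zeta> ^ m * f y"
proof -
  obtain x' where x': "basic_invariants D x'"
    "\<forall>\<alpha>\<in>{1..n}. \<forall>y\<in>Y. act_fun g (x' \<alpha>) y = \<zeta> ^ deg D \<alpha> * x' \<alpha> y" and "bij g"
    using triplet by (auto simp: admissible_triplet_def orth_group_def)
  then have "x' \<alpha> (pull g y) = \<zeta> ^ deg D \<alpha> * x' \<alpha> y" if "\<alpha> \<in> {1..n}" "y \<in> Y" for \<alpha> y
    using that by (simp add: act_fun_eq_pull)
  then show ?thesis
    using eigen_invariant[OF x'(1) _ g_linear g_rad assms] by blast
qed

lemma deg_pos: "i \<in> {1..n} \<Longrightarrow> 0 < deg D i"
  using deg_mono[OF codim, of 1 i] x_basic by (auto simp: basic_invariants_def)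

lemma deg_less: "i \<in> {1..n - 1} \<Longrightarrow> deg D i < deg D n"
  using deg_mono[OF codim, of i "n - 1"] codim by (auto simp: codimension_one_def)

lemma zeta_power_ne_1: "i \<in> {1..n - 1} \<Longrightarrow> \<zeta> ^ deg D i \<noteq> 1"
  using zeta_root deg_pos[of i] deg_less[of i] deg_n[OF codim] by (auto simp: primitive_root_def)

lemma zeta_power_n: "\<zeta> ^ deg D n = 1"
  using zeta_root deg_n[OF codim] by (simp add: primitive_root_def)

lemma n_in: "n \<in> {1..n}"
  using n_ge_2 by simp

lemma x_n: "x n \<in> S_W_deg D (deg D n)"
  by (rule basic_invariants_deg[OF x_basic n_in])

lemmas x_n_holo = S_W_deg_holo[OF x_n]

abbreviation "Lperp \<equiv> perp_Y D L"

section \<open>Points and directions of L^perp\<close>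

lemma L_decomp: obtains u p q where "v = u + (p *\<^sub>R a + q *\<^sub>R \<delta>)" "u \<in> L"
proof -
  have "v \<in> {u + r | u r. u \<in> L \<and> r \<in> rad_I D}"
    using L_sum unfolding direct_sum_is_def by blast
  then obtain u r where v: "v = u + r" "u \<in> L" "r \<in> rad_I D" by blast
  obtain p q where "r = p *\<^sub>R a + q *\<^sub>R \<delta>" using v(3) by (rule rad_cases)
  with v that show thesis by blast
qed

lemma functional_eqI_L:
  assumes "\<And>v. v \<in> L \<Longrightarrow> blinfun_apply \<xi> v = blinfun_apply \<eta> v"
    and "blinfun_apply \<xi> a = blinfun_apply \<eta> a" "blinfun_apply \<xi> \<delta> = blinfun_apply \<eta> \<delta>"
  shows "\<xi> = (\<eta> :: 'v \<Rightarrow>\<^sub>L complex)"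
proof (rule blinfun_eqI)
  fix v
  obtain u p q where "v = u + (p *\<^sub>R a + q *\<^sub>R \<delta>)" "u \<in> L" by (rule L_decomp)
  then show "blinfun_apply \<xi> v = blinfun_apply \<eta> v"
    using assms by (simp add: blinfun.bilinear_simps)
qed

lemma Lperp_Y: "y \<in> Lperp \<Longrightarrow> y \<in> Y"
  by (simp add: perp_Y_def)

lemma Lperp_fixed: "y \<in> Lperp \<Longrightarrow> pull g y = y"
  by (rule functional_eqI_L)
    (use g_L in \<open>auto simp: g_linear g_rad a_in_rad delta_in_rad perp_Y_def\<close>)

lemma L_rad: "L \<inter> rad_I D = {0}"
  using L_sum by (simp add: direct_sum_is_def)

lemma Lperp_exists:
  assumes "0 < Re t"
  obtains y where "y \<in> Lperp" "blinfun_apply y \<delta> = t"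
proof -
  obtain y :: "'v \<Rightarrow>\<^sub>L complex" where "\<And>v. v \<in> L \<Longrightarrow> blinfun_apply y v = 0"
    "blinfun_apply y a = - 2 * pi * \<i>" "blinfun_apply y \<delta> = t"
    by (rule functional_exists[OF L_subspace L_rad, of "- 2 * pi * \<i>" t]) (rule that)
  then have "y \<in> Lperp" "blinfun_apply y \<delta> = t"
    using assms by (auto simp: perp_Y_def dom_Y_def)
  then show thesis by (rule that)
qed

lemma x_vanishes: "i \<in> {1..n - 1} \<Longrightarrow> y \<in> Lperp \<Longrightarrow> x i y = 0"
  using invariant_pull_g[OF basic_invariants_deg[OF x_basic, of i], of y]
    zeta_power_ne_1[of i] by (auto simp: Lperp_fixed Lperp_Y)

lemma x_n_nonzero: "\<exists>y\<in>Lperp. x n y \<noteq> 0"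
proof -
  obtain y where y: "y \<in> Y" "x n y \<noteq> 0"
    using basic_invariant_nonzero[OF x_basic n_in] by blast
  obtain y0 where y0: "y0 \<in> Lperp" "blinfun_apply y0 \<delta> = blinfun_apply y \<delta>"
    by (rule Lperp_exists[of "blinfun_apply y \<delta>"]) (use y(1) in \<open>auto simp: dom_Y_def intro: that\<close>)
  obtain m P where P: "0 < m" "P \<in> S_W_deg D m" "P y0 \<noteq> 0"
    using exists_invariant_nonvanishing[OF x_n deg_pos[OF n_in] y Lperp_Y[OF y0(1)] y0(2)] by blast
  have "x n y0 \<noteq> 0"
  proof
    assume "x n y0 = 0"
    then have "x i y0 = 0" if "i \<in> {1..n}" for i
      using x_vanishes[OF _ y0(1), of i] that by (cases "i = n") auto
    then show False
      using invariant_vanishes[OF x_basic P(2,1) Lperp_Y[OF y0(1)]] P(3) by blast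
  qed
  then show ?thesis using y0(1) by blast
qed

lemma euler_nz: "euler_scale \<noteq> 0"
proof -
  obtain y where "y \<in> Lperp" "x n y \<noteq> 0" using x_n_nonzero by blast
  then show ?thesis
    using euler_scale_nonzero[OF x_n deg_pos[OF n_in]] Lperp_Y by blast
qed

text \<open>E is \<open>euler_scale\<close> times \<open>E0\<close>, while the field dual to z^n is
  \<open>E0\<close> / (-2 pi i). The Euler equation for x^n gives this ratio.\<close>

definition partial_factor :: complex where
  "partial_factor = of_nat (deg D n) / (- 2 * pi * \<i> * euler_scale)"

lemma partial_factor_nz: "partial_factor \<noteq> 0"
  using euler_nz deg_pos[OF n_in] by (simp add: partial_factor_def)

lemma coord_n: "coord n = hom_scale (1 / (- 2 * pi * \<i>)) E0"
  by (simp only: coord_def diff_self_eq_0 z_0 form_hom_cpx_scale E0_def)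

lemma dir_deriv_coord_n: "y \<in> Y \<Longrightarrow> dir_deriv (coord n) (x n) y = partial_factor * x n y"
proof -
  assume y: "y \<in> Y"
  have "euler_scale * dir_deriv E0 (x n) y = of_nat (deg D n) * x n y"
    using x_n y by (simp add: S_W_deg_iff)
  then have "dir_deriv E0 (x n) y = of_nat (deg D n) * x n y / euler_scale"
    using euler_nz by (simp add: field_simps)
  then show ?thesis
    by (simp add: coord_n dir_deriv_hom_scale[OF x_n_holo y] partial_factor_def)
qed

text \<open>g multiplies the field \<open>coord\<close> \<gamma> by \<zeta>^(d_\<gamma>), which is
  not 1, but fixes x^n and the points of L^perp.\<close>

lemma dir_deriv_coord_mid:
  assumes \<gamma>: "\<gamma> \<in> {1..n - 1}" and y: "y \<in> Lperp"
  shows "dir_deriv (coord \<gamma>) (x n) y = 0"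
proof -
  have \<gamma>n: "\<gamma> \<le> n" using \<gamma> by auto
  have "pull g (coord \<gamma>) - hom_scale (\<zeta> ^ deg D \<gamma>) (coord \<gamma>) = 0"
    by (rule tangent_eq_0)
      (use \<gamma>n in \<open>auto simp: blinfun.bilinear_simps g_linear g_rad a_in_rad cpx_eval_diff
        cpx_eval_pull z_eigen cpx_eval_coord\<close>)
  then have "pull g (coord \<gamma>) = hom_scale (\<zeta> ^ deg D \<gamma>) (coord \<gamma>)" by simp
  moreover have "dir_deriv (pull g (coord \<gamma>)) (x n) (pull g y) = 1 * dir_deriv (coord \<gamma>) (x n) y"
    by (rule dir_deriv_pull[OF x_n_holo Lperp_Y[OF y] coord_a g_linear])
      (use invariant_pull_g[OF x_n] zeta_power_n in simp)
  ultimately have "\<zeta> ^ deg D \<gamma> * dir_deriv (coord \<gamma>) (x n) y = dir_deriv (coord \<gamma>) (x n) y"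
    using y by (simp add: Lperp_fixed dir_deriv_hom_scale[OF x_n_holo Lperp_Y])
  then show ?thesis using zeta_power_ne_1[OF \<gamma>] by auto
qed

lemma gradient_norm_Lperp:
  assumes y: "y \<in> Lperp"
  shows "gradient_norm (x n) y = 2 * partial_factor * x n y * dir_deriv (coord 0) (x n) y"
proof -
  let ?t = "\<lambda>\<gamma>. dir_deriv (coord \<gamma>) (x n) y * dir_deriv (coord (n - \<gamma>)) (x n) y"
  have "gradient_norm (x n) y = (\<Sum>\<gamma>\<in>{0, n}. ?t \<gamma>)"
    unfolding gradient_norm_def
  proof (rule sum.mono_neutral_right)
    show "\<forall>\<gamma>\<in>{..n} - {0, n}. ?t \<gamma> = 0"
      using dir_deriv_coord_mid[OF _ y] by auto
  qed auto
  then show ?thesis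
    using n_ge_2 dir_deriv_coord_n[OF Lperp_Y[OF y]] by simp
qed

text \<open>L^perp is a half plane in the complex line of direction \<eta>, which kills L and is 1
  on \<delta>. As z^1, ..., z^n lie over L, the field dual to z^0 is a multiple of \<eta>; the
  factor is that of \<delta> = -2 pi i z^0.\<close>

lemma Lperp_direction:
  obtains \<eta> where "blinfun_apply \<eta> a = 0" "coord 0 = hom_scale (- 2 * pi * \<i>) \<eta>"
    "\<And>y t. y \<in> Lperp \<Longrightarrow> y + hom_scale t \<eta> \<in> Y \<Longrightarrow> y + hom_scale t \<eta> \<in> Lperp"
    "\<And>y y'. y \<in> Lperp \<Longrightarrow> y' \<in> Lperp \<Longrightarrow> \<exists>t. y' = y + hom_scale t \<eta>"
proof -
  obtain \<eta> :: "'v \<Rightarrow>\<^sub>L complex" where \<eta>: "\<And>v. v \<in> L \<Longrightarrow> blinfun_apply \<eta> v = 0"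
    "blinfun_apply \<eta> a = 0" "blinfun_apply \<eta> \<delta> = 1"
    by (rule functional_exists[OF L_subspace L_rad, of 0 1]) (rule that)
  have zL: "cpx_eval (z \<gamma>) \<eta> = 0" if "\<gamma> \<le> n" "\<gamma> \<noteq> 0" for \<gamma>
  proof -
    have "z \<gamma> \<in> L \<times> L"
    proof (cases "\<gamma> = n")
      case True
      then show ?thesis using z_n by (auto simp: complexify_def perp_L_def)
    next
      case False
      then have "\<gamma> \<in> {1..n - 1}" using that by auto
      then show ?thesis using z_mid[of \<gamma>] by (auto simp: complexify_def)
    qed
    then show ?thesis using \<eta>(1) by (auto simp: cpx_eval_def)
  qed
  have z0: "cpx_eval (z 0) \<eta> = 1 / (- 2 * pi * \<i>)"
    by (simp only: z_0 cpx_eval_cpx_scale cpx_eval_of_vec \<eta>(3) mult_1_right)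
  have "coord 0 - hom_scale (- 2 * pi * \<i>) \<eta> = 0"
  proof (rule tangent_eq_0)
    show "blinfun_apply (coord 0 - hom_scale (- 2 * pi * \<i>) \<eta>) a = 0"
      by (simp add: blinfun.bilinear_simps \<eta>)
    fix \<gamma> assume "\<gamma> \<le> n"
    then show "cpx_eval (z \<gamma>) (coord 0 - hom_scale (- 2 * pi * \<i>) \<eta>) = 0"
      using zL[of \<gamma>] by (cases "\<gamma> = 0") (simp_all add: cpx_eval_diff cpx_eval_coord z0)
  qed
  then have c0: "coord 0 = hom_scale (- 2 * pi * \<i>) \<eta>" by simp
  have "y + hom_scale t \<eta> \<in> Lperp" if "y \<in> Lperp" "y + hom_scale t \<eta> \<in> Y" for y t
    using that \<eta>(1) by (simp add: perp_Y_def blinfun.bilinear_simps)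
  moreover have "\<exists>t. y' = y + hom_scale t \<eta>" if "y \<in> Lperp" "y' \<in> Lperp" for y y'
    by (intro exI[of _ "blinfun_apply y' \<delta> - blinfun_apply y \<delta>"] functional_eqI_L)
      (use that \<eta> in \<open>auto simp: perp_Y_def dom_Y_def blinfun.bilinear_simps\<close>)
  ultimately show thesis using that \<eta>(2) c0 by blast
qed

lemma Lperp_line_const:
  assumes \<eta>: "blinfun_apply \<eta> a = 0" and y0: "y0 \<in> Y" and f: "f \<in> holo_Y D"
    and d: "\<And>t. y0 + hom_scale t \<eta> \<in> Y \<Longrightarrow> dir_deriv \<eta> f (y0 + hom_scale t \<eta>) = 0"
    and t: "y0 + hom_scale t \<eta> \<in> Y"
  shows "f (y0 + hom_scale t \<eta>) = f y0"
proof -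
  let ?T = "{t. y0 + hom_scale t \<eta> \<in> Y}"
  have "?T = {t. 0 < Re (blinfun_apply y0 \<delta> + t * blinfun_apply \<eta> \<delta>)}"
    using y0 \<eta> by (auto simp: dom_Y_def blinfun.bilinear_simps)
  also have "\<dots> = (\<lambda>t. Re (t * blinfun_apply \<eta> \<delta>)) -` {- Re (blinfun_apply y0 \<delta>)<..}"
    by auto
  also have "convex \<dots>"
    by (intro convex_linear_vimage linearI) (auto simp: algebra_simps)
  finally have "convex ?T" .
  then have "\<exists>c. \<forall>t\<in>?T. f (y0 + hom_scale t \<eta>) = c"
  proof (rule has_field_derivative_zero_constant)
    fix t assume "t \<in> ?T"
    then show "((\<lambda>t. f (y0 + hom_scale t \<eta>)) has_field_derivative 0) (at t within ?T)"
      using line_has_field_derivative[OF f \<eta>, of y0 t] d[of t]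
      by (auto intro: has_field_derivative_at_within)
  qed
  then obtain c where c: "\<And>t. t \<in> ?T \<Longrightarrow> f (y0 + hom_scale t \<eta>) = c" by blast
  show ?thesis using c[of t] c[of 0] t y0 by simp
qed

text \<open>On L^perp the gradient norm is a nonzero multiple of x^n times the derivative of x^n
  along \<eta>.\<close>

lemma x_n_const_iff:
  "nonzero_const_on Lperp (x n) \<longleftrightarrow> (\<forall>y\<in>Lperp. gradient_norm (x n) y = 0)"
proof -
  obtain \<eta> where \<eta>: "blinfun_apply \<eta> a = 0" "coord 0 = hom_scale (- 2 * pi * \<i>) \<eta>"
    and move: "\<And>y t. y \<in> Lperp \<Longrightarrow> y + hom_scale t \<eta> \<in> Y \<Longrightarrow> y + hom_scale t \<eta> \<in> Lperp"
    and conn: "\<And>y y'. y \<in> Lperp \<Longrightarrow> y' \<in> Lperp \<Longrightarrow> \<exists>t. y' = y + hom_scale t \<eta>"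
    by (rule Lperp_direction) (rule that)
  obtain y0 where y0: "y0 \<in> Lperp" "x n y0 \<noteq> 0" using x_n_nonzero by blast
  have gn: "gradient_norm (x n) y = 0 \<longleftrightarrow> x n y * dir_deriv \<eta> (x n) y = 0" if "y \<in> Lperp" for y
    using that partial_factor_nz
    by (simp add: gradient_norm_Lperp \<eta>(2) dir_deriv_hom_scale[OF x_n_holo Lperp_Y \<eta>(1)])
  have line_in: "y0 + hom_scale t \<eta> \<in> Lperp" if "y0 + hom_scale t \<eta> \<in> Y" for t
    by (rule move[OF y0(1) that])
  show ?thesis
  proof
    assume "nonzero_const_on Lperp (x n)"
    then obtain c where c: "\<And>y. y \<in> Lperp \<Longrightarrow> x n y = c" by (auto simp: nonzero_const_on_def)
    have "dir_deriv \<eta> (x n) y = 0" if y: "y \<in> Lperp" for y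
    proof -
      have "\<forall>\<^sub>F t in nhds 0. t \<in> {t. y + hom_scale t \<eta> \<in> Y}"
        by (rule eventually_nhds_in_open[OF open_line_dom_Y[OF \<eta>(1)]]) (use Lperp_Y[OF y] in simp)
      then have "\<forall>\<^sub>F t in nhds 0. x n (y + hom_scale t \<eta>) = c"
        by eventually_elim (use c move[OF y] in auto)
      then have "deriv (\<lambda>t. x n (y + hom_scale t \<eta>)) 0 = deriv (\<lambda>t. c) 0"
        by (rule deriv_cong_ev) simp
      then show ?thesis by (simp add: dir_deriv_def)
    qed
    then show "\<forall>y\<in>Lperp. gradient_norm (x n) y = 0" using gn by simp
  next
    assume "\<forall>y\<in>Lperp. gradient_norm (x n) y = 0"
    then have prod0: "x n y * dir_deriv \<eta> (x n) y = 0" if "y \<in> Lperp" for y using gn that by blast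
    \<comment> \<open>Dividing by x^n is not yet allowed. Its square has derivative 0, hence is
      constant and equal to its nonzero value at \<open>y0\<close>; only then does the derivative of
      x^n itself vanish.\<close>
    let ?q = "\<lambda>y. x n y * x n y"
    have q: "?q \<in> holo_Y D" by (intro holo_Y_mult x_n_holo)
    have dq: "dir_deriv \<eta> ?q y = 0" if y: "y \<in> Lperp" for y
    proof -
      have "((\<lambda>t. x n (y + hom_scale t \<eta>)) has_field_derivative dir_deriv \<eta> (x n) (y + hom_scale 0 \<eta>)) (at 0)"
        by (rule line_has_field_derivative[OF x_n_holo \<eta>(1)]) (use Lperp_Y[OF y] in simp)
      from DERIV_mult[OF this this]
      have "((\<lambda>t. ?q (y + hom_scale t \<eta>)) has_field_derivative 0) (at 0)"
        using prod0[OF y] by (simp add: mult.commute)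
      then show ?thesis unfolding dir_deriv_def by (rule DERIV_imp_deriv)
    qed
    have qc: "?q (y0 + hom_scale t \<eta>) = ?q y0" if "y0 + hom_scale t \<eta> \<in> Y" for t
      by (rule Lperp_line_const[OF \<eta>(1) Lperp_Y[OF y0(1)] q dq[OF line_in] that])
    have nz: "x n (y0 + hom_scale t \<eta>) \<noteq> 0" if "y0 + hom_scale t \<eta> \<in> Y" for t
      using qc[OF that] y0(2) by auto
    have "dir_deriv \<eta> (x n) (y0 + hom_scale t \<eta>) = 0" if "y0 + hom_scale t \<eta> \<in> Y" for t
      using prod0[OF line_in[OF that]] nz[OF that] by simp
    then have "x n (y0 + hom_scale t \<eta>) = x n y0" if "y0 + hom_scale t \<eta> \<in> Y" for t
      by (rule Lperp_line_const[OF \<eta>(1) Lperp_Y[OF y0(1)] x_n_holo _ that])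
    then have "x n y = x n y0" if "y \<in> Lperp" for y
      using conn[OF y0(1) that] Lperp_Y[OF that] by auto
    then show "nonzero_const_on Lperp (x n)"
      using y0(2) by (auto simp: nonzero_const_on_def)
  qed
qed

text \<open>The coefficient A depends only on the image in H, and L^perp meets every fibre over H,
  so vanishing on L^perp and on Y are the same for A. Cancelling (x^n)^2 requires x^n to have no
  zero on L^perp, which \<open>x_n_const_iff\<close> supplies.\<close>

lemma second_derivative_iff:
  "(\<forall>y\<in>Lperp. gradient_norm (x n) y = 0) \<longleftrightarrow>
   (\<forall>y\<in>Y. partial_x D x n (partial_x D x n (gradient_norm (x n))) y = 0)"
proof -
  let ?f = "gradient_norm (x n)"
  obtain c where c: "c \<in> poly_H D" "\<And>y. y \<in> Y \<Longrightarrow> ?f y = eval_poly D x c y"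
    "\<And>k. k \<in> poly_supp D c \<Longrightarrow> weight k = 2 * deg D n"
    by (rule basic_invariants_expand[OF x_basic gradient_norm_invariant[OF x_n]]) (rule that)
  let ?A = "\<lambda>y. c ((\<lambda>_. 0)(n := 2)) (\<pi> y)"
  have second: "partial_x D x n (partial_x D x n ?f) y = 2 * ?A y" if "y \<in> Y" for y
    by (rule partial_x_twice[OF x_basic c(1) n_in deg_pos c(2) c(3) that])
  have restr: "?f y = ?A y * x n y ^ 2" if y: "y \<in> Lperp" for y
  proof -
    have "x i y = 0" if "i \<in> {1..n} - {n}" for i
      by (rule x_vanishes[OF _ y]) (use that in auto)
    then show ?thesis
      unfolding c(2)[OF Lperp_Y[OF y]]
      using eval_poly_single[OF c(1) n_in deg_pos[OF n_in] c(3) Lperp_Y[OF y]] by blast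
  qed
  show ?thesis
  proof
    assume 0: "\<forall>y\<in>Lperp. ?f y = 0"
    then have "nonzero_const_on Lperp (x n)" by (simp add: x_n_const_iff)
    then have nz: "x n y \<noteq> 0" if "y \<in> Lperp" for y
      using that by (auto simp: nonzero_const_on_def)
    show "\<forall>y\<in>Y. partial_x D x n (partial_x D x n ?f) y = 0"
    proof
      fix y assume y: "y \<in> Y"
      obtain y' where y': "y' \<in> Lperp" "blinfun_apply y' \<delta> = blinfun_apply y \<delta>"
        by (rule Lperp_exists[of "blinfun_apply y \<delta>"]) (use y in \<open>auto simp: dom_Y_def intro: that\<close>)
      have "\<pi> y' = \<pi> y"
        by (rule proj_H_eqI) (use y y' in \<open>auto simp: dom_Y_def perp_Y_def\<close>)
      then have "?A y = 0" using restr[OF y'(1)] 0 y'(1) nz[OF y'(1)] by auto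
      then show "partial_x D x n (partial_x D x n ?f) y = 0" using second[OF y] by simp
    qed
  next
    assume "\<forall>y\<in>Y. partial_x D x n (partial_x D x n ?f) y = 0"
    then have "?A y = 0" if "y \<in> Y" for y using second[OF that] that by simp
    then show "\<forall>y\<in>Lperp. ?f y = 0" using restr Lperp_Y by simp
  qed
qed

lemma partial_z_const_iff:
  "nonzero_const_on Lperp (partial_z D z n (x n)) \<longleftrightarrow> nonzero_const_on Lperp (x n)"
proof -
  have eq: "partial_z D z n (x n) y = partial_factor * x n y" if "y \<in> Lperp" for y
    using dir_deriv_coord_n[OF Lperp_Y[OF that]] by (simp add: partial_z_eq)
  show ?thesis
  proof
    assume "nonzero_const_on Lperp (partial_z D z n (x n))"
    then obtain c where "c \<noteq> 0" "\<forall>y\<in>Lperp. partial_factor * x n y = c"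
      using eq by (auto simp: nonzero_const_on_def)
    then show "nonzero_const_on Lperp (x n)"
      using partial_factor_nz unfolding nonzero_const_on_def
      by (intro exI[of _ "c / partial_factor"]) (auto simp: field_simps)
  next
    assume "nonzero_const_on Lperp (x n)"
    then obtain c where "c \<noteq> 0" "\<forall>y\<in>Lperp. x n y = c"
      by (auto simp: nonzero_const_on_def)
    then show "nonzero_const_on Lperp (partial_z D z n (x n))"
      using partial_factor_nz eq unfolding nonzero_const_on_def
      by (intro exI[of _ "partial_factor * c"]) auto
  qed
qed

end

theorem proposition8p3:
  fixes D :: "'v::euclidean_space ell_data"
    and g :: "'v \<Rightarrow> 'v" and \<zeta> :: complex and L :: "'v set"
    and z :: "nat \<Rightarrow> 'v cpx"
    and x :: "nat \<Rightarrow> ('v \<Rightarrow>\<^sub>L complex) \<Rightarrow> complex"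
  defines "n \<equiv> nn D"
  assumes "marked_elliptic D"
    and "codimension_one D"
    and "admissible_triplet D g \<zeta> L"
    and "zero_type D L"
    and z_indep: "inj_on z {..n}" "\<not> cpx.dependent (z ` {..n})"
    and z_span: "cpx.span (z ` {..n}) = complexify {u + r *\<^sub>R vec_delta D | u r. u \<in> L}"
    and z_0: "z 0 = cpx_scale (1 / (- 2 * pi * \<i>)) (of_vec (vec_delta D))"
    and z_mid: "\<And>\<alpha>. \<alpha> \<in> {1..n - 1} \<Longrightarrow> z \<alpha> \<in> complexify (L \<inter> space_F D)"
    and z_n: "z n \<in> complexify (perp_L D L)"
    and z_form: "\<And>\<alpha> \<beta>. \<alpha> \<le> n \<Longrightarrow> \<beta> \<le> n \<Longrightarrow>
      cpx_form (form D) (z \<alpha>) (z \<beta>) = (if \<alpha> + \<beta> = n then 1 else 0)"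
    and z_eigen: "\<And>\<alpha>. \<alpha> \<le> n \<Longrightarrow> cpx_map g (z \<alpha>) = cpx_scale (\<zeta> ^ deg D \<alpha>) (z \<alpha>)"
    and x_0: "\<And>y. y \<in> dom_Y D \<Longrightarrow> x 0 y = blinfun_apply y (vec_delta D) / (- 2 * pi * \<i>)"
    and x_basic: "basic_invariants D x"
  shows
    "(nonzero_const_on (perp_Y D L) (partial_z D z n (x n)) \<longleftrightarrow> nonzero_const_on (perp_Y D L) (x n)) \<and>
     (nonzero_const_on (perp_Y D L) (x n) \<longleftrightarrow> (\<forall>y\<in>perp_Y D L. form_W D z x n n y = 0)) \<and>
     ((\<forall>y\<in>perp_Y D L. form_W D z x n n y = 0) \<longleftrightarrow>
        (\<forall>y\<in>dom_Y D. partial_x D x n (partial_x D x n (form_W D z x n n)) y = 0))"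
proof -
  interpret admissible D L z g \<zeta> x
  proof unfold_locales
    show "subspace L" "direct_sum_is UNIV L (rad_I D)"
      using assms(4) by (auto simp: admissible_triplet_def)
  qed (use assms in auto)
  \<comment> \<open>Equality as functions permits rewriting inside \<open>partial_x\<close>.\<close>
  have "form_W D z x n n = gradient_norm (x n)"
    by (rule ext) (rule form_W_eq)
  then show ?thesis
    using partial_z_const_iff x_n_const_iff second_derivative_iff by (simp add: n_def)
qed

end
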